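(* For each (discrete) group $G$: if the full group $C^*$-algebra $C^*(G)$ is just-infinite, then $\mathbb{C}[G]$ is $^*$-just-infinite; and if $\mathbb{C}[G]$ is $^*$-just-infinite, then the group $G$ is just-infinite.
   Context: A $C^*$-algebra $A$ is just-infinite if it is infinite dimensional and $A/I$ is finite dimensional for each non-zero closed two-sided ideal $I$ of $A$. A group is just-infinite if it is infinite and all its quotients by non-trivial normal subgroups are finite. The group algebra $\mathbb{C}[G]$ is a $^*$-algebra in which each $g \in G$ is unitary, and $C^*(G)$ is its completion in the maximal $C^*$-norm. $\mathbb{C}[G]$ is called $^*$-just-infinite if it is infinite dimensional (i.e., $G$ is infinite) and each (unital) $^*$-representation of $\mathbb{C}[G]$ on a Hilbert space either is injective or has finite dimensional image. *)

theory Defs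
  imports
    "HOL-Analysis.Analysis"
    "HOL-Algebra.QuotRing"
    "Jordan_Normal_Form.VS_Connect"
begin

text \<open>
  Complex vector spaces are the \<^typ>\<open>(complex, 'a) module\<close> records of HOL-Algebra over the field
  \<^term>\<open>class_ring :: complex ring\<close>. Such a record also carries a multiplication and a unit, so
  it serves for unital complex algebras as well (and for plain vector spaces, where the two extra
  fields are ignored, as is usual for modules in HOL-Algebra).
\<close>

record 'a star_algebra = "(complex, 'a) module" +
  star :: "'a \<Rightarrow> 'a"

record 'a normed_star_algebra = "'a star_algebra" +
  alg_norm :: "'a \<Rightarrow> real"

abbreviation finite_dimensional :: "(complex, 'a, 'z) module_scheme \<Rightarrow> bool" where
  "finite_dimensional V \<equiv> vectorspace.fin_dim (class_ring :: complex ring) V"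

text \<open>
  The locale \<^locale>\<open>Metric_space\<close> wants its distance function to be non-negative and symmetric on
  the whole type, hence the value 0 off the carrier.
\<close>

definition norm_dist :: "('a, 'z) ring_scheme \<Rightarrow> ('a \<Rightarrow> real) \<Rightarrow> 'a \<Rightarrow> 'a \<Rightarrow> real" where
  "norm_dist A p x y =
     (if x \<in> carrier A \<and> y \<in> carrier A then p (x \<ominus>\<^bsub>A\<^esub> y) else 0)"


subsection \<open>Just-infinite groups\<close>

definition just_infinite_group :: "('g, 'm) monoid_scheme \<Rightarrow> bool" where
  "just_infinite_group G \<longleftrightarrow>
     infinite (carrier G) \<and>
     (\<forall>N. N \<lhd> G \<and> N \<noteq> {\<one>\<^bsub>G\<^esub>} \<longrightarrow> finite (carrier (G Mod N)))"


subsection \<open>The complex group algebra\<close>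

text \<open>
  The function \<^term>\<open>f\<close> stands for the formal sum of the \<open>f g \<cdot> g\<close>; the star is the conjugate-linear
  extension of inversion, so that every group element is unitary.
\<close>

definition group_algebra :: "('g, 'm) monoid_scheme \<Rightarrow> ('g \<Rightarrow> complex) star_algebra" where
  "group_algebra G = \<lparr>
     carrier = {f. finite {g. f g \<noteq> 0} \<and> {g. f g \<noteq> 0} \<subseteq> carrier G},
     mult = (\<lambda>f h x. if x \<in> carrier G
                     then \<Sum>y \<in> {y \<in> carrier G. f y \<noteq> 0}. f y * h (inv\<^bsub>G\<^esub> y \<otimes>\<^bsub>G\<^esub> x) else 0),
     one = (\<lambda>x. if x = \<one>\<^bsub>G\<^esub> then 1 else 0),
     zero = (\<lambda>x. 0),
     add = (\<lambda>f h x. f x + h x),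
     smult = (\<lambda>c f x. c * f x),
     star = (\<lambda>f x. if x \<in> carrier G then cnj (f (inv\<^bsub>G\<^esub> x)) else 0)\<rparr>"


subsection \<open>The full group C*-algebra\<close>

definition cstar_norm :: "('a, 'z) star_algebra_scheme \<Rightarrow> ('a \<Rightarrow> real) \<Rightarrow> bool" where
  "cstar_norm A p \<longleftrightarrow>
     (\<forall>x \<in> carrier A. 0 \<le> p x) \<and>
     (\<forall>x \<in> carrier A. p x = 0 \<longleftrightarrow> x = \<zero>\<^bsub>A\<^esub>) \<and>
     (\<forall>c. \<forall>x \<in> carrier A. p (c \<odot>\<^bsub>A\<^esub> x) = cmod c * p x) \<and>
     (\<forall>x \<in> carrier A. \<forall>y \<in> carrier A. p (x \<oplus>\<^bsub>A\<^esub> y) \<le> p x + p y) \<and>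
     (\<forall>x \<in> carrier A. \<forall>y \<in> carrier A. p (x \<otimes>\<^bsub>A\<^esub> y) \<le> p x * p y) \<and>
     (\<forall>x \<in> carrier A. p (star A x \<otimes>\<^bsub>A\<^esub> x) = (p x)\<^sup>2)"

text \<open>
  On a group algebra the supremum is over a non-empty bounded set: the left regular representation
  gives a C*-norm, and \<open>p f \<le> (\<Sum>g. \<bar>f g\<bar>)\<close> for every C*-norm \<^term>\<open>p\<close>, since group elements are
  unitary.
\<close>

definition max_cstar_norm :: "('a, 'z) star_algebra_scheme \<Rightarrow> 'a \<Rightarrow> real" where
  "max_cstar_norm A x = (SUP p \<in> {p. cstar_norm A p}. p x)"

text \<open>Completion with respect to a norm: Cauchy sequences modulo null sequences.\<close>

definition cauchy_seqs :: "('a, 'z) star_algebra_scheme \<Rightarrow> ('a \<Rightarrow> real) \<Rightarrow> (nat \<Rightarrow> 'a) set" where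
  "cauchy_seqs A p = {u. Metric_space.MCauchy (carrier A) (norm_dist A p) u}"

definition null_rel :: "('a, 'z) star_algebra_scheme \<Rightarrow> ('a \<Rightarrow> real) \<Rightarrow> (nat \<Rightarrow> 'a) rel" where
  "null_rel A p = {(u, v). u \<in> cauchy_seqs A p \<and> v \<in> cauchy_seqs A p \<and>
                           (\<lambda>n. norm_dist A p (u n) (v n)) \<longlonglongrightarrow> 0}"

definition completion ::
  "('a, 'z) star_algebra_scheme \<Rightarrow> ('a \<Rightarrow> real) \<Rightarrow> (nat \<Rightarrow> 'a) set normed_star_algebra" where
  "completion A p = \<lparr>
     carrier = cauchy_seqs A p // null_rel A p,
     mult = (\<lambda>X Y. \<Union>u\<in>X. \<Union>v\<in>Y. null_rel A p `` {\<lambda>n. u n \<otimes>\<^bsub>A\<^esub> v n}),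
     one = null_rel A p `` {\<lambda>n. \<one>\<^bsub>A\<^esub>},
     zero = null_rel A p `` {\<lambda>n. \<zero>\<^bsub>A\<^esub>},
     add = (\<lambda>X Y. \<Union>u\<in>X. \<Union>v\<in>Y. null_rel A p `` {\<lambda>n. u n \<oplus>\<^bsub>A\<^esub> v n}),
     smult = (\<lambda>c X. \<Union>u\<in>X. null_rel A p `` {\<lambda>n. c \<odot>\<^bsub>A\<^esub> u n}),
     star = (\<lambda>X. \<Union>u\<in>X. null_rel A p `` {\<lambda>n. star A (u n)}),
     alg_norm = (\<lambda>X. THE r. \<forall>u\<in>X. (\<lambda>n. p (u n)) \<longlonglongrightarrow> r)\<rparr>"

definition full_group_cstar ::
  "('g, 'm) monoid_scheme \<Rightarrow> (nat \<Rightarrow> 'g \<Rightarrow> complex) set normed_star_algebra" where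
  "full_group_cstar G = completion (group_algebra G) (max_cstar_norm (group_algebra G))"


subsection \<open>Just-infinite C*-algebras\<close>

definition norm_topology :: "('a, 'z) normed_star_algebra_scheme \<Rightarrow> 'a topology" where
  "norm_topology A = Metric_space.mtopology (carrier A) (norm_dist A (alg_norm A))"

text \<open>
  \<^const>\<open>FactRing\<close> with the scalar multiplication added. In a unital algebra, ring ideals are
  closed under scalars, so \<^const>\<open>ideal\<close> is the notion of a two-sided algebra ideal.
\<close>

definition quotient_algebra ::
  "(complex, 'a, 'z) module_scheme \<Rightarrow> 'a set \<Rightarrow> (complex, 'a set) module" where
  "quotient_algebra A I = \<lparr>
     carrier = carrier (A Quot I),
     mult = mult (A Quot I),
     one = one (A Quot I),
     zero = zero (A Quot I),
     add = add (A Quot I),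
     smult = (\<lambda>c X. \<Union>x\<in>X. I +>\<^bsub>A\<^esub> (c \<odot>\<^bsub>A\<^esub> x))\<rparr>"

definition just_infinite_cstar :: "('a, 'z) normed_star_algebra_scheme \<Rightarrow> bool" where
  "just_infinite_cstar A \<longleftrightarrow>
     \<not> finite_dimensional A \<and>
     (\<forall>I. ideal I A \<and> closedin (norm_topology A) I \<and> I \<noteq> {\<zero>\<^bsub>A\<^esub>} \<longrightarrow>
          finite_dimensional (quotient_algebra A I))"


subsection \<open>Representations on Hilbert spaces\<close>

record 'h inner_space = "(complex, 'h) module" +
  cinner :: "'h \<Rightarrow> 'h \<Rightarrow> complex"

definition inner_norm :: "('h, 'z) inner_space_scheme \<Rightarrow> 'h \<Rightarrow> real" where
  "inner_norm H x = sqrt (Re (cinner H x x))"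

locale complex_hilbert_space = vectorspace "class_ring :: complex ring" H
  for H :: "('h, 'z) inner_space_scheme" (structure) +
  assumes cinner_add_left: "\<lbrakk>x \<in> carrier H; y \<in> carrier H; z \<in> carrier H\<rbrakk> \<Longrightarrow>
      cinner H (x \<oplus> y) z = cinner H x z + cinner H y z"
    and cinner_smult_left: "\<lbrakk>x \<in> carrier H; y \<in> carrier H\<rbrakk> \<Longrightarrow>
      cinner H (c \<odot> x) y = c * cinner H x y"
    and cinner_commute: "\<lbrakk>x \<in> carrier H; y \<in> carrier H\<rbrakk> \<Longrightarrow>
      cinner H x y = cnj (cinner H y x)"
    and cinner_nonneg: "x \<in> carrier H \<Longrightarrow> 0 \<le> Re (cinner H x x)"
    and cinner_definite: "\<lbrakk>x \<in> carrier H; cinner H x x = 0\<rbrakk> \<Longrightarrow> x = \<zero>"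
    and complete: "Metric_space.mcomplete (carrier H) (norm_dist H (inner_norm H))"

definition bounded_operators ::
  "('h, 'z) inner_space_scheme \<Rightarrow> (complex, 'h \<Rightarrow> 'h) module" where
  "bounded_operators H = \<lparr>
     carrier = {T. T \<in> extensional (carrier H) \<and>
                   T \<in> module_hom (class_ring :: complex ring) H H \<and>
                   (\<exists>K. \<forall>x \<in> carrier H. inner_norm H (T x) \<le> K * inner_norm H x)},
     mult = compose (carrier H),
     one = (\<lambda>x \<in> carrier H. x),
     zero = (\<lambda>x \<in> carrier H. \<zero>\<^bsub>H\<^esub>),
     add = (\<lambda>S T. \<lambda>x \<in> carrier H. S x \<oplus>\<^bsub>H\<^esub> T x),
     smult = (\<lambda>c T. \<lambda>x \<in> carrier H. c \<odot>\<^bsub>H\<^esub> T x)\<rparr>"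

text \<open>
  The last conjunct says that \<open>\<pi> (a*)\<close> is the adjoint of \<open>\<pi> a\<close>; unitality is part of
  \<^const>\<open>Ring.ring_hom\<close>.
\<close>

definition star_representation ::
  "('a, 'y) star_algebra_scheme \<Rightarrow> ('h, 'z) inner_space_scheme \<Rightarrow> ('a \<Rightarrow> 'h \<Rightarrow> 'h) \<Rightarrow> bool" where
  "star_representation A H \<pi> \<longleftrightarrow>
     \<pi> \<in> Ring.ring_hom A (bounded_operators H) \<and>
     \<pi> \<in> module_hom (class_ring :: complex ring) A (bounded_operators H) \<and>
     (\<forall>a \<in> carrier A. \<forall>x \<in> carrier H. \<forall>y \<in> carrier H.
        cinner H (\<pi> (star A a) x) y = cinner H x (\<pi> a y))"

text \<open>
  HOL cannot quantify over types inside a formula, so the type \<^typ>\<open>'h\<close> from which the carriers of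
  the Hilbert spaces are taken is a parameter. For the group algebra of \<^term>\<open>G :: 'g monoid\<close>, the
  type \<^typ>\<open>'g \<Rightarrow> complex\<close> is already large enough to give the unrestricted notion: a
  representation which is not injective and has infinite dimensional image restricts to one with
  the same two properties on the closed invariant subspace generated by suitable countably many
  vectors, and that subspace is isomorphic to \<open>\<ell>\<^sup>2(X)\<close> for some \<open>X \<subseteq> carrier G\<close>.
\<close>

definition star_just_infinite :: "'h itself \<Rightarrow> ('a, 'z) star_algebra_scheme \<Rightarrow> bool" where
  "star_just_infinite TYPE('h) A \<longleftrightarrow>
     \<not> finite_dimensional A \<and>
     (\<forall>(H :: 'h inner_space) \<pi>. complex_hilbert_space H \<and> star_representation A H \<pi> \<longrightarrow>
        inj_on \<pi> (carrier A) \<or>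
        finite_dimensional ((bounded_operators H)\<lparr>carrier := \<pi> ` carrier A\<rparr>))"

end

(* Any *-representation pi of C[G] gives a C*-seminorm on C[G]; its maximum with the norm of the left
   regular representation is a C*-norm, so that the norm of pi is dominated by the maximal C*-norm.
   The classes of the Cauchy sequences which pi sends to null sequences therefore form a closed ideal I
   of C*(G), and the kernel of C[G] -> C*(G)/I is the kernel of pi. If pi is not injective, then I is
   non-zero, hence C*(G)/I is finite dimensional, and so is the image of pi.
   For a normal subgroup N of infinite index, the representation of C[G] on l^2(G/N) has an infinite
   dimensional image, and it is injective only if N is trivial. *)
theory Submission
  imports Defs
begin

text \<open>\<open>max_cstar_norm\<close> is a supremum over norms, so the seminorm of a
  non-faithful representation cannot be compared with it directly; this is why a faithful
  representation enters. The maximum of the two works because squaring is monotone on non-negative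
  reals, so that the C*-identity survives. The representation itself is not extended to the
  completion: only the numbers \<open>N (u n)\<close> are passed to the limit along Cauchy sequences
  \<open>u\<close>, which is enough to define the ideal and to see that it is closed. Finite
  dimension is expressed through linear dependence of all families of some fixed length; a relation
  found in C*(G)/I is pulled back to C[G] and pushed forward to the image of pi, with no isomorphism
  between the two. That C[G] is infinite dimensional is a separate point: for finite G the group
  algebra is already complete, so C*(G) would be finite dimensional. The product of C[G] and the
  permutation representations are given by one convolution formula for an action of G on a set, so
  that one computation yields both associativity and multiplicativity.\<close>

subsection \<open>Linear algebra\<close>

text \<open>\<open>module_hom\<close> makes sense between bare records, so the laws of
  \<open>W\<close> are carried over along \<open>h\<close> and need not be known beforehand. The
  condition on zero cannot be derived from additivity, since no cancellation is available in
  \<open>W\<close>.\<close>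

lemma vectorspace_surj_image:
  assumes V: "vectorspace K V" and h: "h \<in> module_hom K V W"
    and surj: "h ` carrier V = carrier W" and zero: "h \<zero>\<^bsub>V\<^esub> = \<zero>\<^bsub>W\<^esub>"
  shows "vectorspace K W"
proof -
  interpret V: vectorspace K V by fact
  have add: "h x \<oplus>\<^bsub>W\<^esub> h y = h (x \<oplus>\<^bsub>V\<^esub> y)" if "x \<in> carrier V" "y \<in> carrier V" for x y
    using module_hom_add[OF h that] by simp
  have smult: "c \<odot>\<^bsub>W\<^esub> h x = h (c \<odot>\<^bsub>V\<^esub> x)" if "c \<in> carrier K" "x \<in> carrier V" for c x
    using module_hom_smult[OF h that] by simp
  note W = surj[symmetric] zero[symmetric]
  show ?thesis
  proof (rule vs_criteria)
    show "field K" by (rule V.field_axioms)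
    show "\<forall>v\<in>carrier W. \<exists>neg_v\<in>carrier W. v \<oplus>\<^bsub>W\<^esub> neg_v = \<zero>\<^bsub>W\<^esub>"
    proof
      fix v assume "v \<in> carrier W"
      then obtain x where "x \<in> carrier V" "v = h x" unfolding W by auto
      then show "\<exists>neg_v\<in>carrier W. v \<oplus>\<^bsub>W\<^esub> neg_v = \<zero>\<^bsub>W\<^esub>"
        by (intro bexI[of _ "h (\<ominus>\<^bsub>V\<^esub> x)"]) (auto simp: W add V.M.r_neg)
    qed
    show "\<forall>v w. v \<in> carrier W \<and> w \<in> carrier W \<longrightarrow> v \<oplus>\<^bsub>W\<^esub> w = w \<oplus>\<^bsub>W\<^esub> v"
      by (auto simp: W add V.M.a_comm)
  qed (auto simp: W add smult V.M.a_assoc V.smult_assoc1 V.smult_l_distr V.smult_r_distr)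
qed

lemma (in module) module_hom_finsum:
  assumes "module R N" "f \<in> module_hom R M N" "finite I" "v \<in> I \<rightarrow> carrier M" "c \<in> I \<rightarrow> carrier R"
  shows "f (\<Oplus>\<^bsub>M\<^esub>i\<in>I. c i \<odot>\<^bsub>M\<^esub> v i) = (\<Oplus>\<^bsub>N\<^esub>i\<in>I. c i \<odot>\<^bsub>N\<^esub> f (v i))"
proof -
  interpret N: module R N by fact
  interpret f: mod_hom R M N f
    using assms(1,2) module_axioms by (simp add: mod_hom_def mod_hom_axioms_def)
  show ?thesis using assms(3-5)
  proof (induction rule: finite_induct)
    case (insert i I)
    then have "v i \<in> carrier M" "c i \<in> carrier R" "v \<in> I \<rightarrow> carrier M" "c \<in> I \<rightarrow> carrier R" by auto
    moreover have "(\<lambda>j. c j \<odot>\<^bsub>M\<^esub> v j) \<in> I \<rightarrow> carrier M"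
      "(\<lambda>j. c j \<odot>\<^bsub>N\<^esub> f (v j)) \<in> I \<rightarrow> carrier N" using insert.prems by auto
    moreover note insert
    ultimately show ?case by (simp add: N.M.finsum_insert finsum_insert)
  qed simp
qed

text \<open>Families replace sets so that the image under a non-injective linear map is again a
  family of the same length. For the converse, a bound on the size of independent sets yields a
  maximal one, which spans.\<close>

lemma (in vectorspace) fin_dim_iff_families_dependent:
  "fin_dim \<longleftrightarrow>
     (\<exists>n::nat. \<forall>v \<in> {..<n} \<rightarrow> carrier V. \<exists>c \<in> {..<n} \<rightarrow> carrier K.
        (\<exists>i<n. c i \<noteq> \<zero>\<^bsub>K\<^esub>) \<and> (\<Oplus>\<^bsub>V\<^esub>i\<in>{..<n}. c i \<odot>\<^bsub>V\<^esub> v i) = \<zero>\<^bsub>V\<^esub>)"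
proof
  assume fd: fin_dim
  show "\<exists>n::nat. \<forall>v \<in> {..<n} \<rightarrow> carrier V. \<exists>c \<in> {..<n} \<rightarrow> carrier K.
        (\<exists>i<n. c i \<noteq> \<zero>\<^bsub>K\<^esub>) \<and> (\<Oplus>\<^bsub>V\<^esub>i\<in>{..<n}. c i \<odot>\<^bsub>V\<^esub> v i) = \<zero>\<^bsub>V\<^esub>"
  proof (intro exI ballI)
    fix v assume v: "v \<in> {..<Suc dim} \<rightarrow> carrier V"
    let ?I = "{..<Suc dim}"
    show "\<exists>c \<in> ?I \<rightarrow> carrier K. (\<exists>i<Suc dim. c i \<noteq> \<zero>\<^bsub>K\<^esub>) \<and> (\<Oplus>\<^bsub>V\<^esub>i\<in>?I. c i \<odot>\<^bsub>V\<^esub> v i) = \<zero>\<^bsub>V\<^esub>"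
    proof (cases "inj_on v ?I")
      case True
      have vc: "v ` ?I \<subseteq> carrier V" using v by auto
      have "card (v ` ?I) = Suc dim" using card_image[OF True] by simp
      then have "lin_dep (v ` ?I)" using li_le_dim(2)[OF fd vc] by force
      from finite_lin_dep[OF _ this vc] obtain a w where a: "a \<in> v ` ?I \<rightarrow> carrier K"
        "lincomb a (v ` ?I) = \<zero>\<^bsub>V\<^esub>" "w \<in> v ` ?I" "a w \<noteq> \<zero>\<^bsub>K\<^esub>" by auto
      have fs: "(\<lambda>x. a x \<odot>\<^bsub>V\<^esub> x) \<in> v ` ?I \<rightarrow> carrier V" using a(1) v by auto
      have "lincomb a (v ` ?I) = (\<Oplus>\<^bsub>V\<^esub>i\<in>?I. a (v i) \<odot>\<^bsub>V\<^esub> v i)"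
        unfolding lincomb_def by (rule M.add.finprod_reindex[OF fs True])
      then show ?thesis using a by (intro bexI[of _ "\<lambda>i. a (v i)"]) auto
    next
      case False
      then obtain i j where ij: "i \<in> ?I" "j \<in> ?I" "i \<noteq> j" "v i = v j" by (auto simp: inj_on_def)
      \<comment> \<open>A repeated vector gives the relation \<open>v i - v j = 0\<close>.\<close>
      define c where "c = (\<lambda>k. if k = i then \<one>\<^bsub>K\<^esub> else if k = j then \<ominus>\<^bsub>K\<^esub> \<one>\<^bsub>K\<^esub> else \<zero>\<^bsub>K\<^esub>)"
      have vj: "v j \<in> carrier V" using ij(2) v by blast
      have c: "c \<in> ?I \<rightarrow> carrier K" by (auto simp: c_def)
      have "(\<Oplus>\<^bsub>V\<^esub>k\<in>?I. c k \<odot>\<^bsub>V\<^esub> v k) = (\<Oplus>\<^bsub>V\<^esub>k\<in>{i, j}. c k \<odot>\<^bsub>V\<^esub> v k)"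
      proof (rule M.add.finprod_mono_neutral_cong_right)
        show "{i, j} \<subseteq> ?I" using ij by blast
        show "\<And>k. k \<in> ?I - {i, j} \<Longrightarrow> c k \<odot>\<^bsub>V\<^esub> v k = \<zero>\<^bsub>V\<^esub>" using v by (auto simp: c_def Pi_iff)
        show "(\<lambda>k. c k \<odot>\<^bsub>V\<^esub> v k) \<in> ?I \<rightarrow> carrier V" using v c by auto
      qed auto
      also have "\<dots> = c i \<odot>\<^bsub>V\<^esub> v i \<oplus>\<^bsub>V\<^esub> c j \<odot>\<^bsub>V\<^esub> v j"
        using ij vj by (simp add: c_def)
      also have "\<dots> = \<zero>\<^bsub>V\<^esub>"
        using ij vj by (simp add: c_def smult_minus_1 M.r_neg)
      finally have "(\<Oplus>\<^bsub>V\<^esub>k\<in>?I. c k \<odot>\<^bsub>V\<^esub> v k) = \<zero>\<^bsub>V\<^esub>" .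
      moreover have "\<exists>k<Suc dim. c k \<noteq> \<zero>\<^bsub>K\<^esub>" using ij(1) by (intro exI[of _ i]) (auto simp: c_def)
      ultimately show ?thesis using c by blast
    qed
  qed
next
  assume "\<exists>n::nat. \<forall>v \<in> {..<n} \<rightarrow> carrier V. \<exists>c \<in> {..<n} \<rightarrow> carrier K.
        (\<exists>i<n. c i \<noteq> \<zero>\<^bsub>K\<^esub>) \<and> (\<Oplus>\<^bsub>V\<^esub>i\<in>{..<n}. c i \<odot>\<^bsub>V\<^esub> v i) = \<zero>\<^bsub>V\<^esub>"
  then obtain n :: nat where n: "\<And>v. v \<in> {..<n} \<rightarrow> carrier V \<Longrightarrow> \<exists>c \<in> {..<n} \<rightarrow> carrier K.
        (\<exists>i<n. c i \<noteq> \<zero>\<^bsub>K\<^esub>) \<and> (\<Oplus>\<^bsub>V\<^esub>i\<in>{..<n}. c i \<odot>\<^bsub>V\<^esub> v i) = \<zero>\<^bsub>V\<^esub>" by blast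
  have dep: "lin_dep A" if A: "A \<subseteq> carrier V" "finite A" "card A = n" for A
  proof -
    obtain v where v: "bij_betw v {..<n} A"
      using ex_bij_betw_nat_finite[OF A(2)] A(3) by (auto simp: atLeast0LessThan)
    then have inj: "inj_on v {..<n}" and im: "v ` {..<n} = A" by (auto simp: bij_betw_def)
    then obtain c i where c: "c \<in> {..<n} \<rightarrow> carrier K" "i < n" "c i \<noteq> \<zero>\<^bsub>K\<^esub>"
      "(\<Oplus>\<^bsub>V\<^esub>i\<in>{..<n}. c i \<odot>\<^bsub>V\<^esub> v i) = \<zero>\<^bsub>V\<^esub>" using n[of v] A(1) by blast
    define a where "a = c \<circ> the_inv_into {..<n} v"
    have vn: "v \<in> {..<n} \<rightarrow> carrier V" using A(1) im by auto
    have av: "a (v k) = c k" if "k < n" for k using the_inv_into_f_f[OF inj] that by (simp add: a_def)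
    have a: "a \<in> A \<rightarrow> carrier K" using c(1) av by (auto simp flip: im)
    have fs: "(\<lambda>x. a x \<odot>\<^bsub>V\<^esub> x) \<in> v ` {..<n} \<rightarrow> carrier V" using a A im by auto
    have "lincomb a A = (\<Oplus>\<^bsub>V\<^esub>i\<in>{..<n}. a (v i) \<odot>\<^bsub>V\<^esub> v i)"
      unfolding lincomb_def im[symmetric] by (rule M.add.finprod_reindex[OF fs inj])
    also have "\<dots> = (\<Oplus>\<^bsub>V\<^esub>i\<in>{..<n}. c i \<odot>\<^bsub>V\<^esub> v i)"
      using av c(1) vn by (intro M.add.finprod_cong') auto
    finally have "lincomb a A = \<zero>\<^bsub>V\<^esub>" using c(4) by simp
    then show ?thesis unfolding lin_dep_def
      using A a c(2,3) av im by (intro exI[of _ A] exI[of _ a] exI[of _ "v i"]) auto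
  qed
  have "\<exists>A. finite A \<and> maximal A (\<lambda>S. S \<subseteq> carrier V \<and> lin_indpt S)"
  proof (rule maximal_exists)
    fix A assume A: "A \<subseteq> carrier V \<and> lin_indpt A"
    \<comment> \<open>An independent set that is infinite or has at least \<open>n\<close> elements
      would contain a dependent subset of size \<open>n\<close>.\<close>
    have "\<not> (\<exists>B \<subseteq> A. finite B \<and> card B = n)"
      using dep A supset_ld_is_ld by blast
    then show "finite A \<and> card A \<le> n"
      by (metis infinite_arbitrarily_large linorder_le_cases obtain_subset_with_card_n finite_subset)
    next show "{} \<subseteq> carrier V \<and> lin_indpt {}" by (auto simp: lin_dep_def)
  qed
  then show fin_dim unfolding fin_dim_def using max_li_is_gen by (auto simp: maximal_def)
qed

text \<open>\<open>W\<close> is a quotient of the image of \<open>g\<close>, hence no larger than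
  \<open>U\<close>: lift \<open>n\<close> vectors of \<open>W\<close> to \<open>V\<close>, find a
  relation between their images in \<open>U\<close>, and note that the resulting combination in
  \<open>V\<close> lies in the kernel of \<open>g\<close>, so in that of \<open>f\<close>.\<close>

lemma fin_dim_transfer:
  assumes V: "vectorspace K V" and W: "vectorspace K W" and U: "vectorspace K U"
    and f: "f \<in> module_hom K V W" and g: "g \<in> module_hom K V U"
    and surj: "f ` carrier V = carrier W"
    and ker: "\<And>x. \<lbrakk>x \<in> carrier V; g x = \<zero>\<^bsub>U\<^esub>\<rbrakk> \<Longrightarrow> f x = \<zero>\<^bsub>W\<^esub>"
    and fd: "vectorspace.fin_dim K U"
  shows "vectorspace.fin_dim K W"
proof -
  interpret V: vectorspace K V by fact
  interpret W: vectorspace K W by fact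
  interpret U: vectorspace K U by fact
  obtain n :: nat where n: "\<And>v. v \<in> {..<n} \<rightarrow> carrier U \<Longrightarrow> \<exists>c \<in> {..<n} \<rightarrow> carrier K.
        (\<exists>i<n. c i \<noteq> \<zero>\<^bsub>K\<^esub>) \<and> (\<Oplus>\<^bsub>U\<^esub>i\<in>{..<n}. c i \<odot>\<^bsub>U\<^esub> v i) = \<zero>\<^bsub>U\<^esub>"
    using fd U.fin_dim_iff_families_dependent by blast
  show ?thesis unfolding W.fin_dim_iff_families_dependent
  proof (intro exI ballI)
    fix w assume w: "w \<in> {..<n} \<rightarrow> carrier W"
    then have "\<exists>x\<in>carrier V. f x = w i" if "i < n" for i
      using that surj by (metis Pi_mem imageE lessThan_iff)
    then obtain v where v: "\<And>i. i < n \<Longrightarrow> v i \<in> carrier V" "\<And>i. i < n \<Longrightarrow> f (v i) = w i"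
      by metis
    have "(\<lambda>i. g (v i)) \<in> {..<n} \<rightarrow> carrier U" using module_hom_closed[OF g] v(1) by auto
    from n[OF this] obtain c where c: "c \<in> {..<n} \<rightarrow> carrier K" "\<exists>i<n. c i \<noteq> \<zero>\<^bsub>K\<^esub>"
      "(\<Oplus>\<^bsub>U\<^esub>i\<in>{..<n}. c i \<odot>\<^bsub>U\<^esub> g (v i)) = \<zero>\<^bsub>U\<^esub>" by blast
    have vn: "v \<in> {..<n} \<rightarrow> carrier V" using v(1) by auto
    let ?x = "\<Oplus>\<^bsub>V\<^esub>i\<in>{..<n}. c i \<odot>\<^bsub>V\<^esub> v i"
    have "g ?x = \<zero>\<^bsub>U\<^esub>"
      using V.module_hom_finsum[OF U.module_axioms g _ vn c(1)] c(3) by simp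
    moreover have "?x \<in> carrier V" using c(1) vn by (intro V.M.finsum_closed) auto
    ultimately have "f ?x = \<zero>\<^bsub>W\<^esub>" by (rule ker[rotated])
    then have "(\<Oplus>\<^bsub>W\<^esub>i\<in>{..<n}. c i \<odot>\<^bsub>W\<^esub> f (v i)) = \<zero>\<^bsub>W\<^esub>"
      using V.module_hom_finsum[OF W.module_axioms f _ vn c(1)] by simp
    also have "(\<Oplus>\<^bsub>W\<^esub>i\<in>{..<n}. c i \<odot>\<^bsub>W\<^esub> f (v i)) = (\<Oplus>\<^bsub>W\<^esub>i\<in>{..<n}. c i \<odot>\<^bsub>W\<^esub> w i)"
      using v c(1) w by (intro W.M.add.finprod_cong') auto
    finally show "\<exists>c \<in> {..<n} \<rightarrow> carrier K.
        (\<exists>i<n. c i \<noteq> \<zero>\<^bsub>K\<^esub>) \<and> (\<Oplus>\<^bsub>W\<^esub>i\<in>{..<n}. c i \<odot>\<^bsub>W\<^esub> w i) = \<zero>\<^bsub>W\<^esub>" using c by blast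
  qed
qed

lemma fin_dim_surj_image:
  assumes V: "vectorspace K V" and h: "h \<in> module_hom K V W"
    and surj: "h ` carrier V = carrier W" and zero: "h \<zero>\<^bsub>V\<^esub> = \<zero>\<^bsub>W\<^esub>"
    and fd: "vectorspace.fin_dim K V"
  shows "vectorspace.fin_dim K W"
proof (rule fin_dim_transfer[OF V vectorspace_surj_image[OF V h surj zero] V h _ surj _ fd])
  show "(\<lambda>x. x) \<in> module_hom K V V" by (simp add: module_hom_def)
qed (use zero in auto)

text \<open>Each \<open>\<phi> s\<close> reads off the coefficient of \<open>e s\<close>, so
  applying it to a linear relation between the \<open>e t\<close> makes that coefficient
  vanish.\<close>

lemma infinite_dim_if_biorthogonal:
  assumes V: "vectorspace (class_ring :: 'k::field ring) V" and S: "infinite S"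
    and e: "\<And>s. s \<in> S \<Longrightarrow> e s \<in> carrier V"
    and add: "\<And>s x y. \<lbrakk>s \<in> S; x \<in> carrier V; y \<in> carrier V\<rbrakk> \<Longrightarrow> \<phi> s (x \<oplus>\<^bsub>V\<^esub> y) = \<phi> s x + \<phi> s y"
    and smult: "\<And>s c x. \<lbrakk>s \<in> S; x \<in> carrier V\<rbrakk> \<Longrightarrow> \<phi> s (c \<odot>\<^bsub>V\<^esub> x) = c * \<phi> s x"
    and dual: "\<And>s t. \<lbrakk>s \<in> S; t \<in> S\<rbrakk> \<Longrightarrow> \<phi> s (e t) = (if s = t then 1 else 0 :: 'k)"
  shows "\<not> vectorspace.fin_dim (class_ring :: 'k ring) V"
proof
  interpret V: vectorspace class_ring V by fact
  assume "vectorspace.fin_dim (class_ring :: 'k ring) V"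
  then obtain n :: nat where n: "\<And>v. v \<in> {..<n} \<rightarrow> carrier V \<Longrightarrow> \<exists>c::nat \<Rightarrow> 'k.
        (\<exists>i<n. c i \<noteq> 0) \<and> (\<Oplus>\<^bsub>V\<^esub>i\<in>{..<n}. c i \<odot>\<^bsub>V\<^esub> v i) = \<zero>\<^bsub>V\<^esub>"
    unfolding V.fin_dim_iff_families_dependent by simp blast
  obtain B where B: "B \<subseteq> S" "finite B" "card B = n" using infinite_arbitrarily_large[OF S] by metis
  then obtain s where s: "bij_betw s {..<n} B"
    using ex_bij_betw_nat_finite[of B] by (auto simp: atLeast0LessThan)
  have sS: "s i \<in> S" if "i < n" for i using s that B(1) by (auto simp: bij_betw_def)
  have inj: "s i = s j \<longleftrightarrow> i = j" if "i < n" "j < n" for i j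
    using s that by (auto simp: bij_betw_def inj_on_def)
  obtain c i where c: "i < n" "c i \<noteq> 0" "(\<Oplus>\<^bsub>V\<^esub>i\<in>{..<n}. c i \<odot>\<^bsub>V\<^esub> e (s i)) = \<zero>\<^bsub>V\<^esub>"
    using n[of "e \<circ> s"] sS e by fastforce
  have zero: "\<phi> (s i) \<zero>\<^bsub>V\<^esub> = 0" using smult[OF sS[OF c(1)], of "\<zero>\<^bsub>V\<^esub>" 0] by simp
  have "\<phi> (s i) (\<Oplus>\<^bsub>V\<^esub>j\<in>I. c j \<odot>\<^bsub>V\<^esub> e (s j)) = (\<Sum>j\<in>I. c j * \<phi> (s i) (e (s j)))"
    if "finite I" "I \<subseteq> {..<n}" for I
    using that
  proof (induction rule: finite_induct)
    case (insert j I)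
    then have "(\<lambda>k. c k \<odot>\<^bsub>V\<^esub> e (s k)) \<in> I \<rightarrow> carrier V" "c j \<odot>\<^bsub>V\<^esub> e (s j) \<in> carrier V"
      "e (s j) \<in> carrier V" using sS e by auto
    with insert show ?case using sS[OF c(1)]
      by (simp add: V.M.finsum_insert add smult V.M.finsum_closed)
  qed (simp add: zero)
  from this[of "{..<n}"] have "(\<Sum>j<n. c j * \<phi> (s i) (e (s j))) = 0" using c(3) zero by simp
  also have "(\<Sum>j<n. c j * \<phi> (s i) (e (s j))) = (\<Sum>j<n. if j = i then c i else 0)"
    using c(1) by (intro sum.cong) (auto simp: dual sS inj)
  finally show False using c(1,2) by simp
qed

subsection \<open>Group algebras and group actions\<close>

text \<open>Used for \<open>G\<close> acting on itself by left translation, which gives the group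
  algebra and its regular representation, and for \<open>G\<close> acting on a transversal of a
  normal subgroup.\<close>

locale set_action = group G for G (structure) +
  fixes X :: "'x set" and act :: "'a \<Rightarrow> 'x \<Rightarrow> 'x"
  assumes act_closed: "\<lbrakk>g \<in> carrier G; x \<in> X\<rbrakk> \<Longrightarrow> act g x \<in> X"
    and act_one: "x \<in> X \<Longrightarrow> act \<one> x = x"
    and act_mult: "\<lbrakk>g \<in> carrier G; h \<in> carrier G; x \<in> X\<rbrakk> \<Longrightarrow> act (g \<otimes> h) x = act g (act h x)"
begin

lemma act_inv_act: "\<lbrakk>g \<in> carrier G; x \<in> X\<rbrakk> \<Longrightarrow> act (inv g) (act g x) = x"
  using act_mult[of "inv g" g x] by (simp add: act_one)

lemma act_act_inv: "\<lbrakk>g \<in> carrier G; x \<in> X\<rbrakk> \<Longrightarrow> act g (act (inv g) x) = x"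
  using act_mult[of g "inv g" x] by (simp add: act_one)

lemma bij_betw_act: "g \<in> carrier G \<Longrightarrow> bij_betw (act g) X X"
  by (rule bij_betwI[where g = "act (inv g)"]) (auto simp: act_closed act_inv_act act_act_inv)

text \<open>The operator of \<open>f\<close> in the permutation representation, where
  \<open>g\<close> sends \<open>\<xi>\<close> to the function with value
  \<open>\<xi> (act (inv g) x)\<close> at \<open>x\<close>. For left translation it is the product
  of the group algebra, whose index set is copied here.\<close>

definition conv :: "('a \<Rightarrow> complex) \<Rightarrow> ('x \<Rightarrow> complex) \<Rightarrow> 'x \<Rightarrow> complex" where
  "conv f \<xi> x = (if x \<in> X then \<Sum>y \<in> {y \<in> carrier G. f y \<noteq> 0}. f y * \<xi> (act (inv y) x) else 0)"

lemma conv_outside: "x \<notin> X \<Longrightarrow> conv f \<xi> x = 0"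
  by (simp add: conv_def)

text \<open>A common finite index set allows convolutions by different functions to be added
  termwise.\<close>

lemma conv_eq_sum:
  assumes "x \<in> X" "finite S" "S \<subseteq> carrier G" "\<And>y. f y \<noteq> 0 \<Longrightarrow> y \<in> S"
  shows "conv f \<xi> x = (\<Sum>y\<in>S. f y * \<xi> (act (inv y) x))"
  unfolding conv_def using assms by (simp, intro sum.mono_neutral_left) auto

end

section \<open>The group algebra as a convolution algebra\<close>

lemma group_set_action: "group G \<Longrightarrow> set_action G (carrier G) (mult G)"
  by (simp add: set_action_def set_action_axioms_def group.is_monoid monoid.m_assoc monoid.l_one
      monoid.m_closed)

definition delta :: "'a \<Rightarrow> 'a \<Rightarrow> complex" where
  "delta g x = (if x = g then 1 else 0)"

lemma group_algebra_simps:
  "carrier (group_algebra G) = {f. finite {g. f g \<noteq> 0} \<and> {g. f g \<noteq> 0} \<subseteq> carrier G}"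
  "\<one>\<^bsub>group_algebra G\<^esub> = delta \<one>\<^bsub>G\<^esub>"
  "\<zero>\<^bsub>group_algebra G\<^esub> = (\<lambda>x. 0)"
  "f \<oplus>\<^bsub>group_algebra G\<^esub> h = (\<lambda>x. f x + h x)"
  "c \<odot>\<^bsub>group_algebra G\<^esub> f = (\<lambda>x. c * f x)"
  "star (group_algebra G) f = (\<lambda>x. if x \<in> carrier G then cnj (f (inv\<^bsub>G\<^esub> x)) else 0)"
  by (auto simp: group_algebra_def delta_def)

lemma group_algebra_mult:
  "group G \<Longrightarrow> f \<otimes>\<^bsub>group_algebra G\<^esub> h = set_action.conv G (carrier G) (mult G) f h"
  by (auto simp: group_algebra_def set_action.conv_def[OF group_set_action])

lemma group_algebra_memD:
  assumes "f \<in> carrier (group_algebra G)"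
  shows "finite {g. f g \<noteq> 0}" "{g. f g \<noteq> 0} \<subseteq> carrier G" "f g \<noteq> 0 \<Longrightarrow> g \<in> carrier G"
  using assms by (auto simp: group_algebra_simps)

lemma group_algebra_memI:
  "\<lbrakk>finite S; S \<subseteq> carrier G; \<And>g. f g \<noteq> 0 \<Longrightarrow> g \<in> S\<rbrakk> \<Longrightarrow> f \<in> carrier (group_algebra G)"
  unfolding group_algebra_simps by (blast intro: finite_subset)

lemma delta_closed: "g \<in> carrier G \<Longrightarrow> delta g \<in> carrier (group_algebra G)"
  by (rule group_algebra_memI[of "{g}"]) (auto simp: delta_def split: if_splits)

lemma group_algebra_add_closed:
  "\<lbrakk>f \<in> carrier (group_algebra G); h \<in> carrier (group_algebra G)\<rbrakk>
     \<Longrightarrow> (\<lambda>x. f x + h x) \<in> carrier (group_algebra G)"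
  by (rule group_algebra_memI[of "{g. f g \<noteq> 0} \<union> {g. h g \<noteq> 0}"]) (auto dest: group_algebra_memD)

lemma group_algebra_smult_closed:
  "f \<in> carrier (group_algebra G) \<Longrightarrow> (\<lambda>x. c * f x) \<in> carrier (group_algebra G)"
  by (rule group_algebra_memI[of "{g. f g \<noteq> 0}"]) (auto dest: group_algebra_memD)

context group
begin

lemma group_algebra_mult_support:
  assumes "f \<in> carrier (group_algebra G)" "h \<in> carrier (group_algebra G)"
    "(f \<otimes>\<^bsub>group_algebra G\<^esub> h) x \<noteq> 0"
  shows "x \<in> (\<lambda>(y, z). y \<otimes> z) ` ({g. f g \<noteq> 0} \<times> {g. h g \<noteq> 0})"
proof -
  interpret L: set_action G "carrier G" "mult G" by (rule group_set_action) (rule is_group)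
  have "L.conv f h x \<noteq> 0" using assms(3) group_algebra_mult[OF is_group] by metis
  then have x: "x \<in> carrier G" and "(\<Sum>y \<in> {y \<in> carrier G. f y \<noteq> 0}. f y * h (inv y \<otimes> x)) \<noteq> 0"
    by (auto simp: L.conv_def split: if_splits)
  then obtain y where "y \<in> carrier G" "f y \<noteq> 0" "h (inv y \<otimes> x) \<noteq> 0"
    by (smt (verit) mem_Collect_eq mult_eq_0_iff sum.neutral)
  then show ?thesis using x by (intro image_eqI[of _ _ "(y, inv y \<otimes> x)"]) (auto simp flip: m_assoc)
qed

lemma group_algebra_mult_closed:
  assumes "f \<in> carrier (group_algebra G)" "h \<in> carrier (group_algebra G)"
  shows "f \<otimes>\<^bsub>group_algebra G\<^esub> h \<in> carrier (group_algebra G)"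
  by (rule group_algebra_memI[of "(\<lambda>(y, z). y \<otimes> z) ` ({g. f g \<noteq> 0} \<times> {g. h g \<noteq> 0})"])
    (use assms in \<open>auto dest: group_algebra_memD intro: group_algebra_mult_support\<close>)

lemma group_algebra_star_closed:
  assumes "f \<in> carrier (group_algebra G)"
  shows "star (group_algebra G) f \<in> carrier (group_algebra G)"
proof (rule group_algebra_memI)
  show "finite (m_inv G ` {g. f g \<noteq> 0})" "m_inv G ` {g. f g \<noteq> 0} \<subseteq> carrier G"
    using assms by (auto dest: group_algebra_memD)
  show "g \<in> m_inv G ` {g. f g \<noteq> 0}" if "star (group_algebra G) f g \<noteq> 0" for g
    using that by (intro image_eqI[of _ _ "inv g"]) (auto simp: group_algebra_simps split: if_splits)
qed

end

context set_action
begin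

lemma conv_supp:
  "\<lbrakk>x \<in> X; f \<in> carrier (group_algebra G)\<rbrakk>
     \<Longrightarrow> conv f \<xi> x = (\<Sum>y | f y \<noteq> 0. f y * \<xi> (act (inv y) x))"
  by (intro conv_eq_sum) (auto dest: group_algebra_memD)

lemma conv_add_left:
  assumes "f \<in> carrier (group_algebra G)" "h \<in> carrier (group_algebra G)"
  shows "conv (\<lambda>x. f x + h x) \<xi> = (\<lambda>x. conv f \<xi> x + conv h \<xi> x)"
proof
  fix x
  let ?S = "{g. f g \<noteq> 0} \<union> {g. h g \<noteq> 0}"
  show "conv (\<lambda>x. f x + h x) \<xi> x = conv f \<xi> x + conv h \<xi> x"
  proof (cases "x \<in> X")
    case True
    have S: "finite ?S" "?S \<subseteq> carrier G" using assms by (auto dest: group_algebra_memD)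
    show ?thesis using conv_eq_sum[OF True S, of "\<lambda>x. f x + h x"] conv_eq_sum[OF True S, of f]
        conv_eq_sum[OF True S, of h] by (simp add: algebra_simps sum.distrib) force
  qed (simp add: conv_outside)
qed

lemma conv_smult_left: "conv (\<lambda>x. c * f x) \<xi> = (\<lambda>x. c * conv f \<xi> x)"
  \<comment> \<open>The index set is the support of the left factor: unchanged for \<open>c\<close>
    nonzero, empty for \<open>c = 0\<close>.\<close>
  by (cases "c = 0") (auto simp: conv_def sum_distrib_left mult.assoc)

lemma conv_add_right: "conv f (\<lambda>x. \<xi> x + \<eta> x) = (\<lambda>x. conv f \<xi> x + conv f \<eta> x)"
  by (auto simp: conv_def algebra_simps sum.distrib)

lemma conv_smult_right: "conv f (\<lambda>x. c * \<xi> x) = (\<lambda>x. c * conv f \<xi> x)"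
  by (auto simp: conv_def sum_distrib_left algebra_simps)

lemma conv_delta: "\<lbrakk>g \<in> carrier G; x \<in> X\<rbrakk> \<Longrightarrow> conv (delta g) \<xi> x = \<xi> (act (inv g) x)"
  by (subst conv_eq_sum[of x "{g}"]) (auto simp: delta_def split: if_splits)

text \<open>Reordering of the double sum by \<open>u = y \<otimes> z\<close>. For left translation
  this is associativity of the group algebra; for other actions it makes the permutation
  representation multiplicative.\<close>

lemma conv_mult:
  assumes f: "f \<in> carrier (group_algebra G)" and h: "h \<in> carrier (group_algebra G)"
  shows "conv (f \<otimes>\<^bsub>group_algebra G\<^esub> h) \<xi> = conv f (conv h \<xi>)"
proof
  fix x
  interpret L: set_action G "carrier G" "mult G" by (rule group_set_action) (rule is_group)
  let ?S = "{g. f g \<noteq> 0}" and ?T = "{g. h g \<noteq> 0}"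
  \<comment> \<open>\<open>?U\<close> contains the support of the product but may be larger, since
    coefficients can cancel.\<close>
  let ?U = "(\<lambda>(y, z). y \<otimes> z) ` (?S \<times> ?T)"
  note fin = group_algebra_memD(1)[OF f] group_algebra_memD(1)[OF h]
  note sub = group_algebra_memD(3)[OF f] group_algebra_memD(3)[OF h]
  show "conv (f \<otimes>\<^bsub>group_algebra G\<^esub> h) \<xi> x = conv f (conv h \<xi>) x"
  proof (cases "x \<in> X")
    case True
    have U: "finite ?U" "?U \<subseteq> carrier G" using fin sub by auto
    have "conv (f \<otimes>\<^bsub>group_algebra G\<^esub> h) \<xi> x
        = (\<Sum>u\<in>?U. (f \<otimes>\<^bsub>group_algebra G\<^esub> h) u * \<xi> (act (inv u) x))"
      by (rule conv_eq_sum[OF True U]) (rule group_algebra_mult_support[OF f h])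
    also have "\<dots> = (\<Sum>u\<in>?U. \<Sum>y\<in>?S. f y * (h (inv y \<otimes> u) * \<xi> (act (inv u) x)))"
      using U(2) by (intro sum.cong)
        (auto simp: group_algebra_mult[OF is_group] L.conv_supp[OF _ f] sum_distrib_right mult.assoc)
    also have "\<dots> = (\<Sum>y\<in>?S. f y * (\<Sum>u\<in>?U. h (inv y \<otimes> u) * \<xi> (act (inv u) x)))"
      by (subst sum.swap) (simp add: sum_distrib_left)
    also have "\<dots> = (\<Sum>y\<in>?S. f y * conv h \<xi> (act (inv y) x))"
    proof (intro sum.cong refl arg_cong2[where f = "(*)"])
      fix y assume y: "y \<in> ?S"
      then have yG: "y \<in> carrier G" using sub by auto
      then have "conv h \<xi> (act (inv y) x) = (\<Sum>z\<in>?T. h z * \<xi> (act (inv z) (act (inv y) x)))"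
        using True by (intro conv_supp h act_closed) auto
      also have "\<dots> = (\<Sum>u\<in>?U. h (inv y \<otimes> u) * \<xi> (act (inv u) x))"
      \<comment> \<open>Multiplication by \<open>y\<close> maps the support of \<open>h\<close>
        bijectively onto the part of \<open>?U\<close> where \<open>h (inv y \<otimes> u)\<close> is
        nonzero; the rest of \<open>?U\<close> is the neutral set \<open>T'\<close>.\<close>
      proof (rule sum.reindex_bij_witness_not_neutral[where S' = "{}"
            and T' = "{u \<in> ?U. h (inv y \<otimes> u) = 0}"
            and i = "\<lambda>u. inv y \<otimes> u" and j = "\<lambda>z. y \<otimes> z"])
        have cancel: "inv y \<otimes> (y \<otimes> z) = z" if "z \<in> ?T" for z
          using that yG sub by (simp flip: m_assoc)
        then show "inv y \<otimes> (y \<otimes> z) = z" if "z \<in> ?T - {}" for z using that by blast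
        show "y \<otimes> z \<in> ?U - {u \<in> ?U. h (inv y \<otimes> u) = 0}" if "z \<in> ?T - {}" for z
        proof -
          have "y \<otimes> z \<in> ?U" using that y by blast
          then show ?thesis using cancel[of z] that by simp
        qed
        show "y \<otimes> (inv y \<otimes> u) = u" if "u \<in> ?U - {u \<in> ?U. h (inv y \<otimes> u) = 0}" for u
        proof -
          have "u \<in> carrier G" using that U(2) by blast
          then show ?thesis using yG by (simp flip: m_assoc)
        qed
        show "inv y \<otimes> u \<in> ?T - {}" if "u \<in> ?U - {u \<in> ?U. h (inv y \<otimes> u) = 0}" for u
          using that by blast
        show "h (inv y \<otimes> u) * \<xi> (act (inv u) x) = 0" if "u \<in> {u \<in> ?U. h (inv y \<otimes> u) = 0}" for u
          using that by simp
        show "finite {u \<in> ?U. h (inv y \<otimes> u) = 0}" using U(1) by simp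
        fix z assume z: "z \<in> ?T"
        show "h (inv y \<otimes> (y \<otimes> z)) * \<xi> (act (inv (y \<otimes> z)) x)
            = h z * \<xi> (act (inv z) (act (inv y) x))"
          using cancel[OF z] yG z sub True by (simp add: inv_mult_group act_mult)
      qed simp_all
      finally show "(\<Sum>u\<in>?U. h (inv y \<otimes> u) * \<xi> (act (inv u) x)) = conv h \<xi> (act (inv y) x)" ..
    qed
    also have "\<dots> = conv f (conv h \<xi>) x" by (rule conv_supp[OF True f, symmetric])
    finally show ?thesis .
  qed (simp add: conv_outside)
qed

lemma conv_one: "(\<And>x. x \<notin> X \<Longrightarrow> \<xi> x = 0) \<Longrightarrow> conv \<one>\<^bsub>group_algebra G\<^esub> \<xi> = \<xi>"
  by (rule ext) (metis act_one conv_delta conv_outside group_algebra_simps(2) inv_one one_closed)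

end

section \<open>Ring and vector space laws of the group algebra\<close>

context group
begin

lemma ring_group_algebra: "ring (group_algebra G)"
proof (rule ringI)
  interpret L: set_action G "carrier G" "mult G" by (rule group_set_action) (rule is_group)
  note simps = group_algebra_simps(2-) group_algebra_mult[OF is_group]
  note mc = group_algebra_mult_closed[unfolded simps]
  show "abelian_group (group_algebra G)"
  proof (rule abelian_groupI)
    fix f assume "f \<in> carrier (group_algebra G)"
    then show "\<exists>h\<in>carrier (group_algebra G). h \<oplus>\<^bsub>group_algebra G\<^esub> f = \<zero>\<^bsub>group_algebra G\<^esub>"
      by (intro bexI[of _ "\<lambda>x. (-1) * f x"] group_algebra_smult_closed) (auto simp: simps)
  qed (auto simp: simps algebra_simps intro!: group_algebra_add_closed intro: group_algebra_memI[of "{}"])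
  show "monoid (group_algebra G)"
  proof (rule monoidI)
    fix f assume f: "f \<in> carrier (group_algebra G)"
    show "\<one>\<^bsub>group_algebra G\<^esub> \<otimes>\<^bsub>group_algebra G\<^esub> f = f"
      unfolding group_algebra_mult[OF is_group] by (rule L.conv_one) (use f group_algebra_memD in blast)
    \<comment> \<open>\<open>conv\<close> describes multiplication from the left, so the right unit
      law is not an instance of \<open>conv_one\<close> and is computed directly.\<close>
    show "f \<otimes>\<^bsub>group_algebra G\<^esub> \<one>\<^bsub>group_algebra G\<^esub> = f"
    proof
      fix x
      show "(f \<otimes>\<^bsub>group_algebra G\<^esub> \<one>\<^bsub>group_algebra G\<^esub>) x = f x"
      proof (cases "x \<in> carrier G")
        case True
        have "(f \<otimes>\<^bsub>group_algebra G\<^esub> \<one>\<^bsub>group_algebra G\<^esub>) x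
            = (\<Sum>y | f y \<noteq> 0. f y * delta \<one> (inv y \<otimes> x))"
          using True f by (simp add: simps L.conv_supp)
        also have "\<dots> = (\<Sum>y | f y \<noteq> 0. if y = x then f x else 0)"
        proof (rule sum.cong[OF refl])
          fix y assume "y \<in> {y. f y \<noteq> 0}"
          then have "y \<in> carrier G" using group_algebra_memD[OF f] by auto
          then have "inv y \<otimes> x = \<one> \<longleftrightarrow> y = x" using True
            by (metis inv_closed inv_inv inv_equality l_inv)
          then show "f y * delta \<one> (inv y \<otimes> x) = (if y = x then f x else 0)"
            by (simp add: delta_def)
        qed
        also have "\<dots> = f x" using group_algebra_memD(1)[OF f] by auto
        finally show ?thesis .
      next
        case False
        then show ?thesis using group_algebra_memD(3)[OF f, of x]
          by (auto simp: simps L.conv_outside)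
      qed
    qed
  next
    fix f h k assume "f \<in> carrier (group_algebra G)" "h \<in> carrier (group_algebra G)"
    then show "(f \<otimes>\<^bsub>group_algebra G\<^esub> h) \<otimes>\<^bsub>group_algebra G\<^esub> k
        = f \<otimes>\<^bsub>group_algebra G\<^esub> (h \<otimes>\<^bsub>group_algebra G\<^esub> k)"
      using L.conv_mult by (simp add: group_algebra_mult[OF is_group])
  qed (auto simp: simps mc delta_closed)
qed (auto simp: group_algebra_simps(2-) group_algebra_mult[OF is_group]
    set_action.conv_add_left[OF group_set_action[OF is_group]]
    set_action.conv_add_right[OF group_set_action[OF is_group]])

lemma vectorspace_group_algebra: "vectorspace class_ring (group_algebra G)"
proof -
  interpret A: ring "group_algebra G" by (rule ring_group_algebra)
  have "module class_ring (group_algebra G)"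
    by (rule moduleI) (auto simp: group_algebra_simps(2-) algebra_simps A.abelian_group_axioms
        class_cring.cring_axioms intro: group_algebra_smult_closed)
  then show ?thesis by (simp add: vectorspace_def class_field)
qed

end

subsection \<open>Hilbert spaces\<close>

text \<open>Common core of inner product spaces, normed algebras and completions, from which each
  gets its \<open>Metric_space\<close>. There are no scalars in a \<open>ring_scheme\<close>, so
  invariance under negation takes the place of homogeneity.\<close>

locale normed_module = abelian_group A for A :: "('a, 'z) ring_scheme" (structure) +
  fixes p :: "'a \<Rightarrow> real"
  assumes norm_nonneg: "x \<in> carrier A \<Longrightarrow> 0 \<le> p x"
    and norm_zero_iff: "x \<in> carrier A \<Longrightarrow> p x = 0 \<longleftrightarrow> x = \<zero>"
    and norm_uminus: "x \<in> carrier A \<Longrightarrow> p (\<ominus> x) = p x"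
    and norm_add: "\<lbrakk>x \<in> carrier A; y \<in> carrier A\<rbrakk> \<Longrightarrow> p (x \<oplus> y) \<le> p x + p y"
begin

lemma minus_eq_zero_iff: "\<lbrakk>x \<in> carrier A; y \<in> carrier A\<rbrakk> \<Longrightarrow> x \<ominus> y = \<zero> \<longleftrightarrow> x = y"
  by (metis a_minus_def add.inv_closed minus_equality minus_minus r_neg)

lemma norm_minus_commute: "\<lbrakk>x \<in> carrier A; y \<in> carrier A\<rbrakk> \<Longrightarrow> p (x \<ominus> y) = p (y \<ominus> x)"
  using norm_uminus[of "x \<ominus> y"] by (simp add: a_minus_def minus_add a_comm)

lemma minus_add_minus:
  "\<lbrakk>x \<in> carrier A; y \<in> carrier A; z \<in> carrier A\<rbrakk> \<Longrightarrow> (x \<ominus> y) \<oplus> (y \<ominus> z) = x \<ominus> z"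
  by (simp add: a_minus_def a_assoc r_neg1)

lemma Metric_space_norm_dist: "Metric_space (carrier A) (norm_dist A p)"
proof
  fix x y z assume "x \<in> carrier A" "y \<in> carrier A" "z \<in> carrier A"
  then show "norm_dist A p x z \<le> norm_dist A p x y + norm_dist A p y z"
    using norm_add[of "x \<ominus> y" "y \<ominus> z"] by (simp add: norm_dist_def minus_add_minus)
qed (auto simp: norm_dist_def norm_nonneg norm_minus_commute norm_zero_iff minus_eq_zero_iff)

end

text \<open>Completeness is split off because the metric in which it is stated needs the triangle
  inequality, which is derived from these axioms.\<close>

locale pre_hilbert_space = vectorspace "class_ring :: complex ring" H
  for H :: "('h, 'z) inner_space_scheme" (structure) +
  assumes cinner_add_left: "\<lbrakk>x \<in> carrier H; y \<in> carrier H; z \<in> carrier H\<rbrakk> \<Longrightarrow>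
      cinner H (x \<oplus> y) z = cinner H x z + cinner H y z"
    and cinner_smult_left: "\<lbrakk>x \<in> carrier H; y \<in> carrier H\<rbrakk> \<Longrightarrow>
      cinner H (c \<odot> x) y = c * cinner H x y"
    and cinner_commute: "\<lbrakk>x \<in> carrier H; y \<in> carrier H\<rbrakk> \<Longrightarrow>
      cinner H x y = cnj (cinner H y x)"
    and cinner_nonneg: "x \<in> carrier H \<Longrightarrow> 0 \<le> Re (cinner H x x)"
    and cinner_definite: "\<lbrakk>x \<in> carrier H; cinner H x x = 0\<rbrakk> \<Longrightarrow> x = \<zero>"

lemma (in complex_hilbert_space) pre_hilbert_space: "pre_hilbert_space H"
  by unfold_locales
    (fact cinner_add_left cinner_smult_left cinner_commute cinner_nonneg cinner_definite)+

context pre_hilbert_space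
begin

lemma cinner_add_right:
  "\<lbrakk>x \<in> carrier H; y \<in> carrier H; z \<in> carrier H\<rbrakk> \<Longrightarrow> cinner H x (y \<oplus> z) = cinner H x y + cinner H x z"
  by (subst (1 2 3) cinner_commute) (auto simp: cinner_add_left)

lemma cinner_smult_right:
  "\<lbrakk>x \<in> carrier H; y \<in> carrier H\<rbrakk> \<Longrightarrow> cinner H x (c \<odot> y) = cnj c * cinner H x y"
  by (subst (1 2) cinner_commute) (auto simp: cinner_smult_left)

lemma cinner_self: "x \<in> carrier H \<Longrightarrow> cinner H x x = of_real ((inner_norm H x)\<^sup>2)"
  using cinner_commute[of x x] cinner_nonneg[of x]
  by (simp add: inner_norm_def complex_eq_iff)

lemma inner_norm_nonneg: "x \<in> carrier H \<Longrightarrow> 0 \<le> inner_norm H x"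
  by (simp add: inner_norm_def cinner_nonneg)

lemma inner_norm_zero_iff: "x \<in> carrier H \<Longrightarrow> inner_norm H x = 0 \<longleftrightarrow> x = \<zero>"
  using cinner_definite[of x] cinner_self[of x] cinner_smult_left[of x x 0] by auto

lemma inner_norm_smult: "x \<in> carrier H \<Longrightarrow> inner_norm H (c \<odot> x) = cmod c * inner_norm H x"
proof -
  assume x: "x \<in> carrier H"
  have "cinner H (c \<odot> x) (c \<odot> x) = of_real ((cmod c)\<^sup>2) * cinner H x x"
    unfolding complex_norm_square using x by (simp add: cinner_smult_left cinner_smult_right)
  then have "of_real ((inner_norm H (c \<odot> x))\<^sup>2) = (of_real ((cmod c * inner_norm H x)\<^sup>2) :: complex)"
    using x cinner_self[of "c \<odot> x"] by (simp add: cinner_self power_mult_distrib)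
  then have "(inner_norm H (c \<odot> x))\<^sup>2 = (cmod c * inner_norm H x)\<^sup>2"
    unfolding of_real_eq_iff .
  then show ?thesis using x by - (rule power2_eq_imp_eq, simp_all add: inner_norm_nonneg)
qed

lemma inner_norm_add_power2:
  assumes "x \<in> carrier H" "y \<in> carrier H"
  shows "(inner_norm H (x \<oplus> y))\<^sup>2 = (inner_norm H x)\<^sup>2 + (inner_norm H y)\<^sup>2 + 2 * Re (cinner H x y)"
proof -
  have "cinner H (x \<oplus> y) (x \<oplus> y)
      = cinner H x x + cinner H y y + (cinner H x y + cnj (cinner H x y))"
    using assms cinner_commute[of y x] by (simp add: cinner_add_left cinner_add_right)
  then have "Re (cinner H (x \<oplus> y) (x \<oplus> y))
      = Re (cinner H x x) + Re (cinner H y y) + 2 * Re (cinner H x y)" by simp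
  then show ?thesis using assms by (simp add: cinner_self)
qed

lemma cauchy_schwarz:
  assumes x: "x \<in> carrier H" and y: "y \<in> carrier H"
  shows "cmod (cinner H x y) \<le> inner_norm H x * inner_norm H y"
proof (cases "y = \<zero>")
  case True
  then show ?thesis using x cinner_smult_right[of x y 0] y inner_norm_zero_iff[of y] by simp
next
  case False
  let ?b = "(inner_norm H y)\<^sup>2" and ?z = "cinner H x y"
  have b: "?b > 0" using False y inner_norm_zero_iff by (simp add: less_le)
  \<comment> \<open>This \<open>c\<close> makes \<open>x \<oplus> c \<odot> y\<close> orthogonal to
    \<open>y\<close>, which gives the sharpest inequality.\<close>
  define c where "c = - ?z / of_real ?b"
  have "cinner H x (c \<odot> y) = - (cnj ?z * ?z) / of_real ?b"
    using x y by (simp add: cinner_smult_right c_def)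
  also have "\<dots> = of_real (- ((cmod ?z)\<^sup>2 / ?b))"
    by (metis complex_norm_square mult.commute of_real_divide of_real_minus minus_divide_left)
  finally have *: "Re (cinner H x (c \<odot> y)) = - ((cmod ?z)\<^sup>2 / ?b)" by simp
  have "0 \<le> (inner_norm H (x \<oplus> c \<odot> y))\<^sup>2" by simp
  also have "\<dots> = (inner_norm H x)\<^sup>2 + (cmod c * inner_norm H y)\<^sup>2 - 2 * ((cmod ?z)\<^sup>2 / ?b)"
    using x y by (simp add: inner_norm_add_power2 inner_norm_smult *)
  also have "(cmod c * inner_norm H y)\<^sup>2 = (cmod ?z)\<^sup>2 / ?b"
  proof -
    have "cmod c = cmod ?z / ?b" by (simp add: c_def norm_divide norm_power)
    then show ?thesis using b by (simp add: field_simps power2_eq_square)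
  qed
  finally have "(cmod ?z)\<^sup>2 \<le> (inner_norm H x * inner_norm H y)\<^sup>2"
    using b by (simp add: field_simps power_mult_distrib)
  then show ?thesis using x y by - (rule power2_le_imp_le, simp_all add: inner_norm_nonneg)
qed

lemma inner_norm_add:
  assumes "x \<in> carrier H" "y \<in> carrier H"
  shows "inner_norm H (x \<oplus> y) \<le> inner_norm H x + inner_norm H y"
proof (rule power2_le_imp_le)
  have "Re (cinner H x y) \<le> inner_norm H x * inner_norm H y"
    using cauchy_schwarz[OF assms] complex_Re_le_cmod[of "cinner H x y"] by linarith
  then show "(inner_norm H (x \<oplus> y))\<^sup>2 \<le> (inner_norm H x + inner_norm H y)\<^sup>2"
    by (simp add: inner_norm_add_power2[OF assms] power2_sum)
qed (simp add: assms inner_norm_nonneg)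

sublocale normed_module H "inner_norm H"
proof
  show "inner_norm H (\<ominus> x) = inner_norm H x" if "x \<in> carrier H" for x
    using inner_norm_smult[OF that, of "-1"] smult_minus_1[OF that] by (simp add: class_ring_simps)
qed (auto simp: inner_norm_nonneg inner_norm_zero_iff inner_norm_add)

end

section \<open>The Hilbert space of square-summable functions on a set\<close>

definition ell2 :: "'x set \<Rightarrow> ('x \<Rightarrow> complex) inner_space" where
  "ell2 X = \<lparr>
     carrier = {\<xi>. (\<forall>x. x \<notin> X \<longrightarrow> \<xi> x = 0) \<and> (\<lambda>x. (cmod (\<xi> x))\<^sup>2) summable_on X},
     mult = undefined, one = undefined, zero = (\<lambda>x. 0),
     add = (\<lambda>\<xi> \<eta> x. \<xi> x + \<eta> x),
     smult = (\<lambda>c \<xi> x. c * \<xi> x),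
     cinner = (\<lambda>\<xi> \<eta>. \<Sum>\<^sub>\<infinity>x\<in>X. \<xi> x * cnj (\<eta> x))\<rparr>"

lemma ell2_simps:
  "\<zero>\<^bsub>ell2 X\<^esub> = (\<lambda>x. 0)"
  "\<xi> \<oplus>\<^bsub>ell2 X\<^esub> \<eta> = (\<lambda>x. \<xi> x + \<eta> x)"
  "c \<odot>\<^bsub>ell2 X\<^esub> \<xi> = (\<lambda>x. c * \<xi> x)"
  "cinner (ell2 X) \<xi> \<eta> = (\<Sum>\<^sub>\<infinity>x\<in>X. \<xi> x * cnj (\<eta> x))"
  by (simp_all add: ell2_def)

lemma ell2_memI:
  "\<lbrakk>\<And>x. x \<notin> X \<Longrightarrow> \<xi> x = 0; (\<lambda>x. (cmod (\<xi> x))\<^sup>2) summable_on X\<rbrakk> \<Longrightarrow> \<xi> \<in> carrier (ell2 X)"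
  by (simp add: ell2_def)

lemma ell2_memD:
  assumes "\<xi> \<in> carrier (ell2 X)"
  shows "x \<notin> X \<Longrightarrow> \<xi> x = 0" "(\<lambda>x. (cmod (\<xi> x))\<^sup>2) summable_on X"
  using assms by (simp_all add: ell2_def)

lemma cmod_add_power2_le: "(cmod (a + b))\<^sup>2 \<le> 2 * (cmod a)\<^sup>2 + 2 * (cmod b)\<^sup>2"
proof -
  have "(cmod (a + b))\<^sup>2 \<le> (cmod a + cmod b)\<^sup>2" by (simp add: norm_triangle_ineq power_mono)
  also have "\<dots> \<le> 2 * (cmod a)\<^sup>2 + 2 * (cmod b)\<^sup>2"
    using zero_le_power2[of "cmod a - cmod b"] by (simp add: power2_eq_square algebra_simps)
  finally show ?thesis .
qed

lemma ell2_add_closed: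
  assumes "\<xi> \<in> carrier (ell2 X)" "\<eta> \<in> carrier (ell2 X)"
  shows "(\<lambda>x. \<xi> x + \<eta> x) \<in> carrier (ell2 X)"
proof (rule ell2_memI)
  have "(\<lambda>x. 2 * (cmod (\<xi> x))\<^sup>2 + 2 * (cmod (\<eta> x))\<^sup>2) summable_on X"
    by (intro summable_on_add summable_on_cmult_right ell2_memD assms)
  then show "(\<lambda>x. (cmod (\<xi> x + \<eta> x))\<^sup>2) summable_on X"
    by (rule summable_on_comparison_test) (simp_all add: cmod_add_power2_le)
qed (use assms in \<open>simp add: ell2_memD\<close>)

lemma ell2_smult_closed:
  assumes "\<xi> \<in> carrier (ell2 X)"
  shows "(\<lambda>x. c * \<xi> x) \<in> carrier (ell2 X)"
  by (rule ell2_memI)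
    (use assms in \<open>auto simp: ell2_memD norm_mult power_mult_distrib intro!: summable_on_cmult_right\<close>)

lemma ell2_abs_summable:
  assumes "\<xi> \<in> carrier (ell2 X)" "\<eta> \<in> carrier (ell2 X)"
  shows "(\<lambda>x. cmod (\<xi> x * cnj (\<eta> x))) summable_on X"
proof (rule abs_summable_product[where y = "\<lambda>x. cnj (\<eta> x)"])
  show "(\<lambda>x. cmod (\<xi> x * \<xi> x)) summable_on X" "(\<lambda>x. cmod (cnj (\<eta> x) * cnj (\<eta> x))) summable_on X"
    using assms[THEN ell2_memD(2)] by (simp_all add: norm_mult power2_eq_square)
qed

lemma ell2_summable:
  "\<lbrakk>\<xi> \<in> carrier (ell2 X); \<eta> \<in> carrier (ell2 X)\<rbrakk> \<Longrightarrow> (\<lambda>x. \<xi> x * cnj (\<eta> x)) summable_on X"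
  by (rule abs_summable_summable) (rule ell2_abs_summable)

lemma Re_cinner_ell2:
  assumes "\<xi> \<in> carrier (ell2 X)"
  shows "Re (cinner (ell2 X) \<xi> \<xi>) = (\<Sum>\<^sub>\<infinity>x\<in>X. (cmod (\<xi> x))\<^sup>2)"
  using infsum_Re[OF ell2_summable[OF assms assms]]
  by (simp add: ell2_simps complex_mult_cnj cmod_power2 flip: cmod_power2)

lemma inner_norm_ell2_power2:
  assumes "\<xi> \<in> carrier (ell2 X)"
  shows "(inner_norm (ell2 X) \<xi>)\<^sup>2 = (\<Sum>\<^sub>\<infinity>x\<in>X. (cmod (\<xi> x))\<^sup>2)"
  by (simp add: inner_norm_def Re_cinner_ell2[OF assms] infsum_nonneg)

lemma vectorspace_ell2: "vectorspace class_ring (ell2 X)"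
proof -
  have "abelian_group (ell2 X)"
  proof (rule abelian_groupI)
    fix f assume "f \<in> carrier (ell2 X)"
    then show "\<exists>h\<in>carrier (ell2 X). h \<oplus>\<^bsub>ell2 X\<^esub> f = \<zero>\<^bsub>ell2 X\<^esub>"
      by (intro bexI[of _ "\<lambda>x. (-1) * f x"] ell2_smult_closed) (auto simp: ell2_simps)
  qed (auto simp: ell2_simps algebra_simps intro!: ell2_add_closed intro: ell2_memI)
  then have "module class_ring (ell2 X)"
    by (intro moduleI) (auto simp: ell2_simps algebra_simps
        class_cring.cring_axioms intro: ell2_smult_closed)
  then show ?thesis by (simp add: vectorspace_def class_field)
qed

lemma ell2_minus:
  assumes "\<xi> \<in> carrier (ell2 X)" "\<eta> \<in> carrier (ell2 X)"
  shows "\<xi> \<ominus>\<^bsub>ell2 X\<^esub> \<eta> = (\<lambda>x. \<xi> x - \<eta> x)"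
proof -
  interpret vectorspace class_ring "ell2 X" by (rule vectorspace_ell2)
  have "\<ominus>\<^bsub>ell2 X\<^esub> \<eta> = (\<lambda>x. (-1) * \<eta> x)"
    by (rule M.minus_equality) (use assms ell2_smult_closed[OF assms(2), of "-1"] in \<open>auto simp: ell2_simps\<close>)
  then show ?thesis by (simp add: a_minus_def ell2_simps)
qed

lemma ell2_minus_closed:
  "\<lbrakk>\<xi> \<in> carrier (ell2 X); \<eta> \<in> carrier (ell2 X)\<rbrakk> \<Longrightarrow> (\<lambda>x. \<xi> x - \<eta> x) \<in> carrier (ell2 X)"
  using ell2_add_closed[of \<xi> X "\<lambda>x. (-1) * \<eta> x"] ell2_smult_closed[of \<eta> X "-1"] by simp

lemma sum_cmod_le_inner_norm_ell2:
  assumes "\<xi> \<in> carrier (ell2 X)" "finite F" "F \<subseteq> X"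
  shows "(\<Sum>x\<in>F. (cmod (\<xi> x))\<^sup>2) \<le> (inner_norm (ell2 X) \<xi>)\<^sup>2"
  unfolding inner_norm_ell2_power2[OF assms(1)]
  by (rule finite_sum_le_infsum[OF ell2_memD(2)[OF assms(1)] assms(2,3)]) simp

text \<open>Reduces membership and norm estimates to finite partial sums. Both the completeness
  proof and the boundedness of convolution operators rest on it, since finite sums can be exchanged
  with limits and reindexed freely.\<close>

lemma inner_norm_ell2_le:
  assumes "\<And>x. x \<notin> X \<Longrightarrow> \<xi> x = 0" "0 \<le> K"
    and bound: "\<And>F. \<lbrakk>finite F; F \<subseteq> X\<rbrakk> \<Longrightarrow> (\<Sum>x\<in>F. (cmod (\<xi> x))\<^sup>2) \<le> K\<^sup>2"
  shows "\<xi> \<in> carrier (ell2 X)" "inner_norm (ell2 X) \<xi> \<le> K"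
proof -
  have s: "(\<lambda>x. (cmod (\<xi> x))\<^sup>2) summable_on X"
    by (rule nonneg_bdd_above_summable_on) (auto intro!: bdd_aboveI2[where M = "K\<^sup>2"] bound)
  then show \<xi>: "\<xi> \<in> carrier (ell2 X)" using assms(1) by (rule ell2_memI[rotated])
  have "(inner_norm (ell2 X) \<xi>)\<^sup>2 \<le> K\<^sup>2"
    unfolding inner_norm_ell2_power2[OF \<xi>] by (rule infsum_le_finite_sums[OF s bound])
  then show "inner_norm (ell2 X) \<xi> \<le> K" using assms(2) by (rule power2_le_imp_le)
qed

text \<open>Completeness is restated with norms of differences, so that a concrete space can be
  treated without the case distinction in \<open>norm_dist\<close>.\<close>

lemma complex_hilbert_spaceI:
  fixes H :: "('h, 'z) inner_space_scheme"
  assumes "vectorspace class_ring H"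
    and "\<And>x y z. \<lbrakk>x \<in> carrier H; y \<in> carrier H; z \<in> carrier H\<rbrakk> \<Longrightarrow>
      cinner H (x \<oplus>\<^bsub>H\<^esub> y) z = cinner H x z + cinner H y z"
    and "\<And>c x y. \<lbrakk>x \<in> carrier H; y \<in> carrier H\<rbrakk> \<Longrightarrow>
      cinner H (c \<odot>\<^bsub>H\<^esub> x) y = c * cinner H x y"
    and "\<And>x y. \<lbrakk>x \<in> carrier H; y \<in> carrier H\<rbrakk> \<Longrightarrow> cinner H x y = cnj (cinner H y x)"
    and "\<And>x. x \<in> carrier H \<Longrightarrow> 0 \<le> Re (cinner H x x)"
    and "\<And>x. \<lbrakk>x \<in> carrier H; cinner H x x = 0\<rbrakk> \<Longrightarrow> x = \<zero>\<^bsub>H\<^esub>"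
    and "\<And>u. \<lbrakk>range u \<subseteq> carrier H;
         \<And>\<epsilon>. \<epsilon> > 0 \<Longrightarrow> \<exists>N. \<forall>m\<ge>N. \<forall>n\<ge>N. inner_norm H (u m \<ominus>\<^bsub>H\<^esub> u n) < \<epsilon>\<rbrakk> \<Longrightarrow>
       \<exists>x\<in>carrier H. (\<lambda>n. inner_norm H (u n \<ominus>\<^bsub>H\<^esub> x)) \<longlonglongrightarrow> 0"
  shows "complex_hilbert_space H"
proof -
  interpret pre_hilbert_space H using assms(1-6)
    by (intro pre_hilbert_space.intro pre_hilbert_space_axioms.intro)
  interpret Metric_space "carrier H" "norm_dist H (inner_norm H)" by (rule Metric_space_norm_dist)
  have "mcomplete"
    unfolding mcomplete_def
  proof (intro allI impI)
    fix u assume u: "MCauchy u"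
    then have uc: "range u \<subseteq> carrier H" by (simp add: MCauchy_def)
    then have un: "u n \<in> carrier H" for n by blast
    have "\<exists>N. \<forall>m\<ge>N. \<forall>n\<ge>N. inner_norm H (u m \<ominus>\<^bsub>H\<^esub> u n) < \<epsilon>" if eps: "\<epsilon> > 0" for \<epsilon>
    proof -
      obtain N where N: "\<forall>n n'. N \<le> n \<longrightarrow> N \<le> n' \<longrightarrow> norm_dist H (inner_norm H) (u n) (u n') < \<epsilon>"
        using u eps unfolding MCauchy_def by blast
      then show ?thesis using un by (intro exI[of _ N]) (simp add: norm_dist_def)
    qed
    from assms(7)[OF uc this] obtain x where x: "x \<in> carrier H"
      "(\<lambda>n. inner_norm H (u n \<ominus>\<^bsub>H\<^esub> x)) \<longlonglongrightarrow> 0" by blast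
    then have "limitin mtopology u x sequentially"
      using un by (simp add: limitin_metric_dist_null norm_dist_def)
    then show "\<exists>x. limitin mtopology u x sequentially" ..
  qed
  then show ?thesis
    by (intro complex_hilbert_space.intro complex_hilbert_space_axioms.intro vectorspace_axioms assms(2-6))
qed

lemma complex_hilbert_space_ell2: "complex_hilbert_space (ell2 X)"
proof (rule complex_hilbert_spaceI)
  show "vectorspace class_ring (ell2 X)" by (rule vectorspace_ell2)
next
  fix \<xi> \<eta> \<zeta> assume *: "\<xi> \<in> carrier (ell2 X)" "\<eta> \<in> carrier (ell2 X)" "\<zeta> \<in> carrier (ell2 X)"
  show "cinner (ell2 X) (\<xi> \<oplus>\<^bsub>ell2 X\<^esub> \<eta>) \<zeta> = cinner (ell2 X) \<xi> \<zeta> + cinner (ell2 X) \<eta> \<zeta>"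
    by (simp add: ell2_simps algebra_simps infsum_add[OF ell2_summable ell2_summable] *)
next
  fix \<xi> \<eta> c assume *: "\<xi> \<in> carrier (ell2 X)" "\<eta> \<in> carrier (ell2 X)"
  show "cinner (ell2 X) (c \<odot>\<^bsub>ell2 X\<^esub> \<xi>) \<eta> = c * cinner (ell2 X) \<xi> \<eta>"
    by (simp add: ell2_simps mult.assoc infsum_cmult_right[OF ell2_summable] *)
  show "cinner (ell2 X) \<xi> \<eta> = cnj (cinner (ell2 X) \<eta> \<xi>)"
    unfolding ell2_simps infsum_cnj[symmetric] by (simp add: mult.commute)
next
  fix \<xi> assume *: "\<xi> \<in> carrier (ell2 X)"
  show "0 \<le> Re (cinner (ell2 X) \<xi> \<xi>)" by (simp add: Re_cinner_ell2 * infsum_nonneg)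
  assume "cinner (ell2 X) \<xi> \<xi> = 0"
  then have "(\<Sum>\<^sub>\<infinity>x\<in>X. (cmod (\<xi> x))\<^sup>2) \<le> 0" using Re_cinner_ell2[OF *] by simp
  from nonneg_infsum_le_0D[OF this ell2_memD(2)[OF *]]
  have "\<xi> x = 0" if "x \<in> X" for x using that by simp
  then show "\<xi> = \<zero>\<^bsub>ell2 X\<^esub>" using ell2_memD(1)[OF *] by (auto simp: ell2_simps)
next
  fix u :: "nat \<Rightarrow> 'a \<Rightarrow> complex"
  assume "range u \<subseteq> carrier (ell2 X)"
    and cauchy: "\<And>\<epsilon>. \<epsilon> > 0 \<Longrightarrow> \<exists>N. \<forall>m\<ge>N. \<forall>n\<ge>N. inner_norm (ell2 X) (u m \<ominus>\<^bsub>ell2 X\<^esub> u n) < \<epsilon>"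
  then have u: "u n \<in> carrier (ell2 X)" for n by auto
  have bound: "(\<Sum>x\<in>F. (cmod (u m x - u n x))\<^sup>2) \<le> \<epsilon>\<^sup>2"
    if "inner_norm (ell2 X) (u m \<ominus>\<^bsub>ell2 X\<^esub> u n) < \<epsilon>" "finite F" "F \<subseteq> X" for m n F \<epsilon>
  proof -
    have "(\<Sum>x\<in>F. (cmod (u m x - u n x))\<^sup>2) \<le> (inner_norm (ell2 X) (u m \<ominus>\<^bsub>ell2 X\<^esub> u n))\<^sup>2"
      using sum_cmod_le_inner_norm_ell2[OF ell2_minus_closed[OF u u] that(2,3)]
      by (simp add: ell2_minus u)
    also have "\<dots> \<le> \<epsilon>\<^sup>2" using that(1) 
      by (intro power_mono) (auto simp: inner_norm_def ell2_minus u Re_cinner_ell2 ell2_minus_closed infsum_nonneg)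
    finally show ?thesis .
  qed
  have "convergent (\<lambda>n. u n x)" for x
  proof (cases "x \<in> X")
    case True
    have "Cauchy (\<lambda>n. u n x)"
    proof (rule CauchyI)
      fix e :: real assume "0 < e"
      then obtain N where N: "\<And>m n. \<lbrakk>m \<ge> N; n \<ge> N\<rbrakk> \<Longrightarrow> inner_norm (ell2 X) (u m \<ominus>\<^bsub>ell2 X\<^esub> u n) < e / 2"
        using cauchy[of "e / 2"] by auto
      have "cmod (u m x - u n x) < e" if "m \<ge> N" "n \<ge> N" for m n
      proof -
        have "(cmod (u m x - u n x))\<^sup>2 \<le> (e / 2)\<^sup>2" using bound[OF N[OF that], of "{x}"] True by simp
        then have "cmod (u m x - u n x) \<le> e / 2" using \<open>0 < e\<close> by (auto intro: power2_le_imp_le)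
        then show ?thesis using \<open>0 < e\<close> by simp
      qed
      then show "\<exists>M. \<forall>m\<ge>M. \<forall>n\<ge>M. norm (u m x - u n x) < e" by blast
    qed
    then show ?thesis by (rule Cauchy_convergent)
  next
    case False
    then have "(\<lambda>n. u n x) = (\<lambda>n. 0)" using ell2_memD(1)[OF u] by simp
    then show ?thesis by (simp add: convergent_const)
  qed
  then obtain \<xi> where \<xi>: "(\<lambda>n. u n x) \<longlonglongrightarrow> \<xi> x" for x unfolding convergent_def by metis
  have outside: "\<xi> x = 0" if "x \<notin> X" for x
    using \<xi>[of x] ell2_memD(1)[OF u that] by (simp add: LIMSEQ_const_iff)
  \<comment> \<open>For a fixed finite set the bound on partial sums survives the limit in
    \<open>m\<close>, because a finite sum of continuous terms is continuous. Only then is the set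
    allowed to vary.\<close>
  have close: "(\<lambda>x. u n x - \<xi> x) \<in> carrier (ell2 X) \<and> inner_norm (ell2 X) (\<lambda>x. u n x - \<xi> x) \<le> \<epsilon>"
    if "\<epsilon> > 0" and N: "\<And>m. m \<ge> N \<Longrightarrow> inner_norm (ell2 X) (u n \<ominus>\<^bsub>ell2 X\<^esub> u m) < \<epsilon>" for n N \<epsilon>
  proof -
    have "(\<Sum>x\<in>F. (cmod (u n x - \<xi> x))\<^sup>2) \<le> \<epsilon>\<^sup>2" if F: "finite F" "F \<subseteq> X" for F
    proof (rule tendsto_upperbound)
      show "(\<lambda>m. \<Sum>x\<in>F. (cmod (u n x - u m x))\<^sup>2) \<longlonglongrightarrow> (\<Sum>x\<in>F. (cmod (u n x - \<xi> x))\<^sup>2)"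
        by (intro tendsto_intros \<xi>)
      show "\<forall>\<^sub>F m in sequentially. (\<Sum>x\<in>F. (cmod (u n x - u m x))\<^sup>2) \<le> \<epsilon>\<^sup>2"
        using bound[OF N F] by (auto simp: eventually_sequentially)
    qed simp
    moreover have "u n x - \<xi> x = 0" if "x \<notin> X" for x
      using ell2_memD(1)[OF u that] outside[OF that] by simp
    ultimately show ?thesis
      using \<open>\<epsilon> > 0\<close> inner_norm_ell2_le[of X "\<lambda>x. u n x - \<xi> x" \<epsilon>] by simp
  qed
  have \<xi>c: "\<xi> \<in> carrier (ell2 X)"
  proof -
    obtain N where "\<forall>m\<ge>N. \<forall>n\<ge>N. inner_norm (ell2 X) (u m \<ominus>\<^bsub>ell2 X\<^esub> u n) < 1"
      using cauchy[of 1] by auto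
    then have "(\<lambda>x. u N x - \<xi> x) \<in> carrier (ell2 X)" using close[of 1 N N] by auto
    from ell2_minus_closed[OF u[of N] this] show ?thesis by simp
  qed
  have "(\<lambda>n. inner_norm (ell2 X) (u n \<ominus>\<^bsub>ell2 X\<^esub> \<xi>)) \<longlonglongrightarrow> 0"
  proof (rule LIMSEQ_I)
    fix r :: real assume r: "0 < r"
    \<comment> \<open>\<open>r / 2\<close> compensates for \<open>close\<close> giving only a weak
      inequality.\<close>
    then obtain N where N: "\<forall>m\<ge>N. \<forall>n\<ge>N. inner_norm (ell2 X) (u m \<ominus>\<^bsub>ell2 X\<^esub> u n) < r / 2"
      using cauchy[of "r / 2"] by auto
    have "norm (inner_norm (ell2 X) (u n \<ominus>\<^bsub>ell2 X\<^esub> \<xi>) - 0) < r" if "n \<ge> N" for n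
    proof -
      have "inner_norm (ell2 X) (\<lambda>x. u n x - \<xi> x) \<le> r / 2" using close[of "r / 2" N n] r N that by auto
      moreover have "0 \<le> inner_norm (ell2 X) (\<lambda>x. u n x - \<xi> x)"
        using ell2_minus_closed[OF u \<xi>c] by (simp add: inner_norm_def Re_cinner_ell2 infsum_nonneg)
      ultimately show ?thesis using r by (simp add: ell2_minus u \<xi>c)
    qed
    then show "\<exists>no. \<forall>n\<ge>no. norm (inner_norm (ell2 X) (u n \<ominus>\<^bsub>ell2 X\<^esub> \<xi>) - 0) < r" by blast
  qed
  then show "\<exists>x\<in>carrier (ell2 X). (\<lambda>n. inner_norm (ell2 X) (u n \<ominus>\<^bsub>ell2 X\<^esub> x)) \<longlonglongrightarrow> 0"
    using \<xi>c by blast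
qed

subsection \<open>C*-seminorms of representations\<close>

text \<open>The condition \<open>0 \<le> K\<close> keeps the infimum at 0 on the zero space, where
  every real \<open>K\<close> is a bound.\<close>

definition op_norm :: "('h, 'z) inner_space_scheme \<Rightarrow> ('h \<Rightarrow> 'h) \<Rightarrow> real" where
  "op_norm H T = Inf {K. 0 \<le> K \<and> (\<forall>x \<in> carrier H. inner_norm H (T x) \<le> K * inner_norm H x)}"

lemma bounded_operators_simps:
  "\<zero>\<^bsub>bounded_operators H\<^esub> = (\<lambda>x \<in> carrier H. \<zero>\<^bsub>H\<^esub>)"
  "\<one>\<^bsub>bounded_operators H\<^esub> = (\<lambda>x \<in> carrier H. x)"
  "S \<oplus>\<^bsub>bounded_operators H\<^esub> T = (\<lambda>x \<in> carrier H. S x \<oplus>\<^bsub>H\<^esub> T x)"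
  "S \<otimes>\<^bsub>bounded_operators H\<^esub> T = compose (carrier H) S T"
  "c \<odot>\<^bsub>bounded_operators H\<^esub> T = (\<lambda>x \<in> carrier H. c \<odot>\<^bsub>H\<^esub> T x)"
  by (simp_all add: bounded_operators_def)

context pre_hilbert_space
begin

lemma bounded_operatorsD:
  assumes "T \<in> carrier (bounded_operators H)"
  shows "T \<in> extensional (carrier H)" "x \<in> carrier H \<Longrightarrow> T x \<in> carrier H"
  using assms by (auto simp: bounded_operators_def module_hom_def)

lemma op_norm_le:
  "\<lbrakk>0 \<le> K; \<And>x. x \<in> carrier H \<Longrightarrow> inner_norm H (T x) \<le> K * inner_norm H x\<rbrakk> \<Longrightarrow> op_norm H T \<le> K"
  unfolding op_norm_def by (intro cInf_lower) (auto intro: bdd_belowI[of _ 0])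

lemma op_norm_bounds:
  assumes T: "T \<in> carrier (bounded_operators H)"
  shows op_norm_nonneg: "0 \<le> op_norm H T"
    and inner_norm_apply_le: "x \<in> carrier H \<Longrightarrow> inner_norm H (T x) \<le> op_norm H T * inner_norm H x"
proof -
  let ?B = "{K. 0 \<le> K \<and> (\<forall>x \<in> carrier H. inner_norm H (T x) \<le> K * inner_norm H x)}"
  obtain K where K: "\<And>x. x \<in> carrier H \<Longrightarrow> inner_norm H (T x) \<le> K * inner_norm H x"
    using T by (auto simp: bounded_operators_def)
  \<comment> \<open>The bound supplied by \<open>bounded_operators\<close> may be negative on the
    zero space, hence the absolute value.\<close>
  have "inner_norm H (T x) \<le> \<bar>K\<bar> * inner_norm H x" if "x \<in> carrier H" for x
    using K[OF that] inner_norm_nonneg[OF that] by (meson abs_ge_self mult_right_mono order_trans)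
  then have ne: "?B \<noteq> {}" by (auto intro: exI[of _ "\<bar>K\<bar>"])
  then show "0 \<le> op_norm H T" unfolding op_norm_def by (rule cInf_greatest) auto
  show "inner_norm H (T x) \<le> op_norm H T * inner_norm H x" if x: "x \<in> carrier H"
  proof (cases "inner_norm H x = 0")
    case True
    with K[OF x] show ?thesis by simp
  next
    case False
    then have pos: "inner_norm H x > 0" using inner_norm_nonneg[OF x] by simp
    have "inner_norm H (T x) / inner_norm H x \<le> op_norm H T"
      unfolding op_norm_def using ne
      by (rule cInf_greatest) (use x pos in \<open>auto simp: divide_le_eq\<close>)
    then show ?thesis using pos by (simp add: divide_le_eq)
  qed
qed

lemma op_norm_zero_iff:
  assumes T: "T \<in> carrier (bounded_operators H)"
  shows "op_norm H T = 0 \<longleftrightarrow> T = \<zero>\<^bsub>bounded_operators H\<^esub>"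
proof
  assume 0: "op_norm H T = 0"
  have "T x = \<zero>" if "x \<in> carrier H" for x
    using inner_norm_apply_le[OF T that] inner_norm_nonneg[of "T x"] inner_norm_zero_iff[of "T x"]
      bounded_operatorsD(2)[OF T that] by (simp add: 0)
  then show "T = \<zero>\<^bsub>bounded_operators H\<^esub>"
    using bounded_operatorsD(1)[OF T] by (auto simp: bounded_operators_simps intro: extensionalityI)
next
  assume "T = \<zero>\<^bsub>bounded_operators H\<^esub>"
  then have "op_norm H T \<le> 0"
    using inner_norm_zero_iff[of \<zero>] by (intro op_norm_le) (auto simp: bounded_operators_simps)
  then show "op_norm H T = 0" using op_norm_nonneg[OF T] by simp
qed

end

section \<open>Seminorms satisfying the C*-identity\<close>

definition cstar_seminorm :: "('a, 'z) star_algebra_scheme \<Rightarrow> ('a \<Rightarrow> real) \<Rightarrow> bool" where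
  "cstar_seminorm A p \<longleftrightarrow>
     (\<forall>x \<in> carrier A. 0 \<le> p x) \<and>
     (\<forall>c. \<forall>x \<in> carrier A. p (c \<odot>\<^bsub>A\<^esub> x) = cmod c * p x) \<and>
     (\<forall>x \<in> carrier A. \<forall>y \<in> carrier A. p (x \<oplus>\<^bsub>A\<^esub> y) \<le> p x + p y) \<and>
     (\<forall>x \<in> carrier A. \<forall>y \<in> carrier A. p (x \<otimes>\<^bsub>A\<^esub> y) \<le> p x * p y) \<and>
     (\<forall>x \<in> carrier A. p (star A x \<otimes>\<^bsub>A\<^esub> x) = (p x)\<^sup>2)"

lemma cstar_norm_iff_seminorm:
  "cstar_norm A p \<longleftrightarrow> cstar_seminorm A p \<and> (\<forall>x \<in> carrier A. p x = 0 \<longleftrightarrow> x = \<zero>\<^bsub>A\<^esub>)"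
  unfolding cstar_norm_def cstar_seminorm_def by blast

text \<open>The C*-identity passes to the maximum because \<open>max\<close> commutes with squaring
  of non-negative numbers. This lets a seminorm be completed to a norm without being
  decreased.\<close>

lemma cstar_seminorm_max:
  assumes "cstar_seminorm A p" "cstar_seminorm A q"
    and "\<And>x. x \<in> carrier A \<Longrightarrow> star A x \<in> carrier A"
  shows "cstar_seminorm A (\<lambda>x. max (p x) (q x))"
  unfolding cstar_seminorm_def
proof (intro conjI ballI allI)
  note p = assms(1)[unfolded cstar_seminorm_def] and q = assms(2)[unfolded cstar_seminorm_def]
  show "0 \<le> max (p x) (q x)" if "x \<in> carrier A" for x using p that by (auto simp: le_max_iff_disj)
  show "max (p (c \<odot>\<^bsub>A\<^esub> x)) (q (c \<odot>\<^bsub>A\<^esub> x)) = cmod c * max (p x) (q x)" if "x \<in> carrier A" for x c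
    using p q that by (simp add: max_mult_distrib_left)
  show "max (p (x \<oplus>\<^bsub>A\<^esub> y)) (q (x \<oplus>\<^bsub>A\<^esub> y)) \<le> max (p x) (q x) + max (p y) (q y)"
    if "x \<in> carrier A" "y \<in> carrier A" for x y
  proof -
    have "p (x \<oplus>\<^bsub>A\<^esub> y) \<le> p x + p y" "q (x \<oplus>\<^bsub>A\<^esub> y) \<le> q x + q y" using p q that by blast+
    then show ?thesis by (auto simp: max_def)
  qed
  show "max (p (x \<otimes>\<^bsub>A\<^esub> y)) (q (x \<otimes>\<^bsub>A\<^esub> y)) \<le> max (p x) (q x) * max (p y) (q y)"
    if "x \<in> carrier A" "y \<in> carrier A" for x y
  proof -
    have *: "p (x \<otimes>\<^bsub>A\<^esub> y) \<le> p x * p y" "q (x \<otimes>\<^bsub>A\<^esub> y) \<le> q x * q y"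
      "0 \<le> p x" "0 \<le> p y" "0 \<le> q x" "0 \<le> q y" using p q that by blast+
    have "p x * p y \<le> max (p x) (q x) * max (p y) (q y)"
      "q x * q y \<le> max (p x) (q x) * max (p y) (q y)"
      using * by (intro mult_mono; simp add: le_max_iff_disj)+
    then show ?thesis using * by simp
  qed
  show "max (p (star A x \<otimes>\<^bsub>A\<^esub> x)) (q (star A x \<otimes>\<^bsub>A\<^esub> x)) = (max (p x) (q x))\<^sup>2" if "x \<in> carrier A" for x
  proof -
    have "p (star A x \<otimes>\<^bsub>A\<^esub> x) = (p x)\<^sup>2" "q (star A x \<otimes>\<^bsub>A\<^esub> x) = (q x)\<^sup>2" "0 \<le> p x" "0 \<le> q x"
      using p q that by blast+
    then show ?thesis by (simp add: max_def)
  qed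
qed

lemma star_representationD:
  assumes "star_representation A H \<pi>"
  shows "a \<in> carrier A \<Longrightarrow> \<pi> a \<in> carrier (bounded_operators H)"
    and "\<lbrakk>a \<in> carrier A; b \<in> carrier A\<rbrakk> \<Longrightarrow> \<pi> (a \<oplus>\<^bsub>A\<^esub> b) = \<pi> a \<oplus>\<^bsub>bounded_operators H\<^esub> \<pi> b"
    and "\<lbrakk>a \<in> carrier A; b \<in> carrier A\<rbrakk> \<Longrightarrow> \<pi> (a \<otimes>\<^bsub>A\<^esub> b) = \<pi> a \<otimes>\<^bsub>bounded_operators H\<^esub> \<pi> b"
    and "a \<in> carrier A \<Longrightarrow> \<pi> (c \<odot>\<^bsub>A\<^esub> a) = c \<odot>\<^bsub>bounded_operators H\<^esub> \<pi> a"
    and "\<lbrakk>a \<in> carrier A; x \<in> carrier H; y \<in> carrier H\<rbrakk>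
      \<Longrightarrow> cinner H (\<pi> (star A a) x) y = cinner H x (\<pi> a y)"
  using assms unfolding star_representation_def
  by (auto simp: module_hom_def ring_hom_closed ring_hom_add ring_hom_mult)

text \<open>The operators are a bare record with no group laws at hand, so zero is reached through
  the scalar 0 instead of by cancellation.\<close>

lemma star_representation_zero:
  assumes "vectorspace class_ring A" "pre_hilbert_space H" "star_representation A H \<pi>"
  shows "\<pi> \<zero>\<^bsub>A\<^esub> = \<zero>\<^bsub>bounded_operators H\<^esub>"
proof -
  interpret A: vectorspace class_ring A by fact
  interpret H: pre_hilbert_space H by fact
  have "\<pi> \<zero>\<^bsub>A\<^esub> = 0 \<odot>\<^bsub>bounded_operators H\<^esub> \<pi> \<zero>\<^bsub>A\<^esub>"
    using star_representationD(4)[OF assms(3), of "\<zero>\<^bsub>A\<^esub>" 0] A.smult_r_null[of 0] by simp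
  also have "\<dots> = \<zero>\<^bsub>bounded_operators H\<^esub>"
    using H.bounded_operatorsD(2)[OF star_representationD(1)[OF assms(3), of "\<zero>\<^bsub>A\<^esub>"]] H.lmult_0
    by (auto simp: bounded_operators_simps intro!: restrict_ext)
  finally show ?thesis .
qed

text \<open>The C*-identity follows from Cauchy-Schwarz and the adjoint relation, used once to bound
  the norm of the adjoint and once to bound the square of the norm.\<close>

lemma cstar_seminorm_op_norm:
  assumes A: "vectorspace class_ring A" and H: "pre_hilbert_space H"
    and \<pi>: "star_representation A H \<pi>"
    and mult: "\<And>a b. \<lbrakk>a \<in> carrier A; b \<in> carrier A\<rbrakk> \<Longrightarrow> a \<otimes>\<^bsub>A\<^esub> b \<in> carrier A"
    and star: "\<And>a. a \<in> carrier A \<Longrightarrow> star A a \<in> carrier A"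
  shows "cstar_seminorm A (\<lambda>a. op_norm H (\<pi> a))"
proof -
  interpret A: vectorspace class_ring A by fact
  interpret H: pre_hilbert_space H by fact
  note closed = star_representationD(1)[OF \<pi>]
  note app = H.bounded_operatorsD(2)[OF closed]
  note N_nonneg = H.op_norm_nonneg[OF closed]
  note le = H.inner_norm_apply_le[OF closed]
  define N where "N = (\<lambda>a. op_norm H (\<pi> a))"
  note N_nonneg = N_nonneg[folded N_def[THEN fun_cong]] and le = le[folded N_def[THEN fun_cong]]
  have smult_le: "N (c \<odot>\<^bsub>A\<^esub> a) \<le> cmod c * N a" if a: "a \<in> carrier A" for a c
    unfolding N_def
  proof (rule H.op_norm_le)
    fix x assume x: "x \<in> carrier H"
    have "inner_norm H (\<pi> (c \<odot>\<^bsub>A\<^esub> a) x) = cmod c * inner_norm H (\<pi> a x)"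
      using a x by (simp add: star_representationD(4)[OF \<pi>] bounded_operators_simps H.inner_norm_smult app)
    also have "\<dots> \<le> cmod c * (N a * inner_norm H x)" by (intro mult_left_mono le a x) simp
    finally show "inner_norm H (\<pi> (c \<odot>\<^bsub>A\<^esub> a) x) \<le> cmod c * op_norm H (\<pi> a) * inner_norm H x"
      by (simp add: N_def mult.assoc)
  qed (use N_nonneg[OF a] in \<open>simp add: N_def\<close>)
  have smult: "N (c \<odot>\<^bsub>A\<^esub> a) = cmod c * N a" if a: "a \<in> carrier A" for a c
  proof (cases "c = 0")
    case True
    then show ?thesis using smult_le[OF a, of c] N_nonneg[of "c \<odot>\<^bsub>A\<^esub> a"] a by simp
  next
    case False
    \<comment> \<open>The reverse inequality comes from \<open>smult_le\<close> applied to the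
      inverse scalar.\<close>
    have "N a = N (inverse c \<odot>\<^bsub>A\<^esub> (c \<odot>\<^bsub>A\<^esub> a))"
      using a False A.smult_assoc1[of "inverse c" c a] A.smult_one[of a] by simp
    also have "\<dots> \<le> cmod (inverse c) * N (c \<odot>\<^bsub>A\<^esub> a)" using a by (intro smult_le) simp
    also have "\<dots> = N (c \<odot>\<^bsub>A\<^esub> a) / cmod c" by (simp add: norm_inverse divide_inverse)
    finally have "cmod c * N a \<le> N (c \<odot>\<^bsub>A\<^esub> a)"
      using False by (simp add: field_simps)
    then show ?thesis using smult_le[OF a, of c] by simp
  qed
  have add: "N (a \<oplus>\<^bsub>A\<^esub> b) \<le> N a + N b" if "a \<in> carrier A" "b \<in> carrier A" for a b
    unfolding N_def
  proof (rule H.op_norm_le)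
    fix x assume x: "x \<in> carrier H"
    have "inner_norm H (\<pi> (a \<oplus>\<^bsub>A\<^esub> b) x) \<le> inner_norm H (\<pi> a x) + inner_norm H (\<pi> b x)"
      using that x by (simp add: star_representationD(2)[OF \<pi>] bounded_operators_simps H.inner_norm_add app)
    also have "\<dots> \<le> N a * inner_norm H x + N b * inner_norm H x" by (intro add_mono le that x)
    finally show "inner_norm H (\<pi> (a \<oplus>\<^bsub>A\<^esub> b) x) \<le> (op_norm H (\<pi> a) + op_norm H (\<pi> b)) * inner_norm H x"
      by (simp add: N_def algebra_simps)
  qed (use N_nonneg that in \<open>simp add: N_def\<close>)
  have mult_le: "N (a \<otimes>\<^bsub>A\<^esub> b) \<le> N a * N b" if "a \<in> carrier A" "b \<in> carrier A" for a b
    unfolding N_def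
  proof (rule H.op_norm_le)
    fix x assume x: "x \<in> carrier H"
    have "inner_norm H (\<pi> (a \<otimes>\<^bsub>A\<^esub> b) x) = inner_norm H (\<pi> a (\<pi> b x))"
      using that x by (simp add: star_representationD(3)[OF \<pi>] bounded_operators_simps compose_def)
    also have "\<dots> \<le> N a * inner_norm H (\<pi> b x)" by (intro le that x app)
    also have "\<dots> \<le> N a * (N b * inner_norm H x)" by (intro mult_left_mono le that x N_nonneg)
    finally show "inner_norm H (\<pi> (a \<otimes>\<^bsub>A\<^esub> b) x) \<le> op_norm H (\<pi> a) * op_norm H (\<pi> b) * inner_norm H x"
      by (simp add: N_def mult.assoc)
  qed (use N_nonneg that in \<open>simp add: N_def\<close>)
  \<comment> \<open>For the image \<open>y\<close> of \<open>x\<close> under the adjoint, norm(y)^2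
    = <x, a y> is at most norm(x) N(a) norm(y); one factor norm(y) is cancelled unless it is
    zero.\<close>
  have star_le: "N (star A a) \<le> N a" if a: "a \<in> carrier A" for a
    unfolding N_def
  proof (rule H.op_norm_le)
    fix x assume x: "x \<in> carrier H"
    let ?y = "\<pi> (star A a) x"
    have y: "?y \<in> carrier H" using a x star app by blast
    have "(inner_norm H ?y)\<^sup>2 = cmod (cinner H ?y ?y)" by (simp add: H.cinner_self[OF y] norm_power)
    also have "\<dots> = cmod (cinner H x (\<pi> a ?y))"
      using star_representationD(5)[OF \<pi> a x y] by simp
    also have "\<dots> \<le> inner_norm H x * inner_norm H (\<pi> a ?y)" by (intro H.cauchy_schwarz x app a y)
    also have "\<dots> \<le> inner_norm H x * (N a * inner_norm H ?y)"
      by (intro mult_left_mono le a y H.inner_norm_nonneg x)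
    finally have "inner_norm H ?y * inner_norm H ?y \<le> (N a * inner_norm H x) * inner_norm H ?y"
      by (simp add: power2_eq_square mult_ac)
    then show "inner_norm H ?y \<le> op_norm H (\<pi> a) * inner_norm H x"
      using H.inner_norm_nonneg[OF y] H.inner_norm_nonneg[OF x] N_nonneg[OF a]
      by (cases "inner_norm H ?y = 0") (auto simp: N_def)
  qed (use N_nonneg[OF a] in \<open>simp add: N_def\<close>)
  have cstar: "N (star A a \<otimes>\<^bsub>A\<^esub> a) = (N a)\<^sup>2" if a: "a \<in> carrier A" for a
  proof (rule antisym)
    show "N (star A a \<otimes>\<^bsub>A\<^esub> a) \<le> (N a)\<^sup>2"
      using mult_le[OF star[OF a] a] mult_right_mono[OF star_le[OF a] N_nonneg[OF a]]
      by (simp add: power2_eq_square)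
    have c: "star A a \<otimes>\<^bsub>A\<^esub> a \<in> carrier A" using a by (intro mult star)
    \<comment> \<open>Here norm(a x)^2 = <a* a x, x>, which Cauchy-Schwarz bounds by N(a* a)
      norm(x)^2.\<close>
    have "N a \<le> sqrt (N (star A a \<otimes>\<^bsub>A\<^esub> a))"
      unfolding N_def
    proof (rule H.op_norm_le)
      fix x assume x: "x \<in> carrier H"
      let ?y = "\<pi> (star A a \<otimes>\<^bsub>A\<^esub> a) x"
      have y: "?y \<in> carrier H" using c x app by blast
      have "(inner_norm H (\<pi> a x))\<^sup>2 = cmod (cinner H (\<pi> a x) (\<pi> a x))"
        by (simp add: H.cinner_self app a x norm_power)
      also have "cinner H (\<pi> a x) (\<pi> a x) = cinner H (\<pi> (star A a) (\<pi> a x)) x"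
        using star_representationD(5)[OF \<pi> a app[OF a x] x] by simp
      also have "\<pi> (star A a) (\<pi> a x) = ?y"
        using a x star by (simp add: star_representationD(3)[OF \<pi>] bounded_operators_simps compose_def)
      also have "cmod (cinner H ?y x) \<le> inner_norm H ?y * inner_norm H x" by (intro H.cauchy_schwarz y x)
      also have "\<dots> \<le> (N (star A a \<otimes>\<^bsub>A\<^esub> a) * inner_norm H x) * inner_norm H x"
        by (intro mult_right_mono le c x H.inner_norm_nonneg)
      also have "\<dots> = (sqrt (N (star A a \<otimes>\<^bsub>A\<^esub> a)) * inner_norm H x)\<^sup>2"
        using N_nonneg[OF c] by (simp add: power_mult_distrib power2_eq_square)
      finally show "inner_norm H (\<pi> a x) \<le> sqrt (op_norm H (\<pi> (star A a \<otimes>\<^bsub>A\<^esub> a))) * inner_norm H x"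
        unfolding N_def
        by (rule power2_le_imp_le) (use N_nonneg[OF c] H.inner_norm_nonneg[OF x] in \<open>simp add: N_def\<close>)
    qed (use N_nonneg[OF c] in \<open>simp add: N_def\<close>)
    then have "(N a)\<^sup>2 \<le> (sqrt (N (star A a \<otimes>\<^bsub>A\<^esub> a)))\<^sup>2"
      using N_nonneg[OF a] by (intro power_mono)
    then show "(N a)\<^sup>2 \<le> N (star A a \<otimes>\<^bsub>A\<^esub> a)" using N_nonneg[OF c] by simp
  qed
  show ?thesis
    unfolding cstar_seminorm_def using N_nonneg smult add mult_le cstar by (auto simp: N_def)
qed

subsection \<open>Completions\<close>

lemma LIMSEQ_null_comparison:
  fixes f g :: "nat \<Rightarrow> real"
  assumes "g \<longlonglongrightarrow> 0" "\<And>n. 0 \<le> f n" "\<And>n. f n \<le> g n"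
  shows "f \<longlonglongrightarrow> 0"
  by (rule tendsto_sandwich[of "\<lambda>_. 0" f sequentially g]) (simp_all add: assms)

locale normed_algebra = vectorspace "class_ring :: complex ring" A + ring A
  for A :: "('a, 'z) star_algebra_scheme" (structure) +
  fixes p :: "'a \<Rightarrow> real"
  assumes p_nonneg: "x \<in> carrier A \<Longrightarrow> 0 \<le> p x"
    and p_zero_iff: "x \<in> carrier A \<Longrightarrow> p x = 0 \<longleftrightarrow> x = \<zero>"
    and p_smult: "x \<in> carrier A \<Longrightarrow> p (c \<odot> x) = cmod c * p x"
    and p_add: "\<lbrakk>x \<in> carrier A; y \<in> carrier A\<rbrakk> \<Longrightarrow> p (x \<oplus> y) \<le> p x + p y"
    and p_mult: "\<lbrakk>x \<in> carrier A; y \<in> carrier A\<rbrakk> \<Longrightarrow> p (x \<otimes> y) \<le> p x * p y"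
begin

sublocale normed_module A p
proof
  show "p (\<ominus> x) = p x" if "x \<in> carrier A" for x
    using p_smult[OF that, of "-1"] smult_minus_1[OF that] by (simp add: class_ring_simps)
qed (auto simp: p_nonneg p_zero_iff p_add)

sublocale Metric_space "carrier A" "norm_dist A p" by (rule Metric_space_norm_dist)

section \<open>Cauchy sequences modulo null sequences\<close>

lemma cauchy_seqs_iff:
  "u \<in> cauchy_seqs A p \<longleftrightarrow> (\<forall>n. u n \<in> carrier A) \<and>
     (\<forall>\<epsilon>>0. \<exists>N. \<forall>m\<ge>N. \<forall>n\<ge>N. p (u m \<ominus> u n) < \<epsilon>)"
  (is "?L \<longleftrightarrow> ?R")
proof -
  have "?L \<longleftrightarrow> (\<forall>n. u n \<in> carrier A) \<and>
     (\<forall>\<epsilon>>0. \<exists>N. \<forall>m\<ge>N. \<forall>n\<ge>N. norm_dist A p (u m) (u n) < \<epsilon>)"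
    by (simp add: cauchy_seqs_def MCauchy_def image_subset_iff all_simps)
  also have "\<dots> \<longleftrightarrow> ?R" by (rule conj_cong[OF refl]) (simp add: norm_dist_def)
  finally show ?thesis .
qed

lemma cauchy_seqs_carrier: "u \<in> cauchy_seqs A p \<Longrightarrow> u n \<in> carrier A"
  by (simp add: cauchy_seqs_iff)

lemma cauchy_seqsI:
  assumes "\<And>n. w n \<in> carrier A"
    and "\<And>\<epsilon>. \<epsilon> > 0 \<Longrightarrow> \<exists>N. \<forall>m\<ge>N. \<forall>n\<ge>N. p (w m \<ominus> w n) < \<epsilon>"
  shows "w \<in> cauchy_seqs A p"
  using assms by (simp add: cauchy_seqs_iff)

lemma cauchy_seqsD:
  assumes "u \<in> cauchy_seqs A p" "\<epsilon> > 0"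
  shows "\<exists>N. \<forall>m\<ge>N. \<forall>n\<ge>N. p (u m \<ominus> u n) < \<epsilon>"
  using assms by (simp add: cauchy_seqs_iff)

lemma null_rel_iff:
  "(u, v) \<in> null_rel A p \<longleftrightarrow> u \<in> cauchy_seqs A p \<and> v \<in> cauchy_seqs A p \<and> (\<lambda>n. p (u n \<ominus> v n)) \<longlonglongrightarrow> 0"
proof -
  have "(\<lambda>n. norm_dist A p (u n) (v n)) = (\<lambda>n. p (u n \<ominus> v n))"
    if "u \<in> cauchy_seqs A p" "v \<in> cauchy_seqs A p"
    using that by (simp add: norm_dist_def cauchy_seqs_carrier)
  then show ?thesis by (auto simp: null_rel_def)
qed

lemma minus_add_distrib_minus:
  "\<lbrakk>x \<in> carrier A; y \<in> carrier A; x' \<in> carrier A; y' \<in> carrier A\<rbrakk>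
     \<Longrightarrow> (x \<oplus> y) \<ominus> (x' \<oplus> y') = (x \<ominus> x') \<oplus> (y \<ominus> y')"
  by (simp add: a_minus_def minus_add a_ac)

lemma p_add_minus_le:
  "\<lbrakk>x \<in> carrier A; y \<in> carrier A; x' \<in> carrier A; y' \<in> carrier A\<rbrakk>
     \<Longrightarrow> p ((x \<oplus> y) \<ominus> (x' \<oplus> y')) \<le> p (x \<ominus> x') + p (y \<ominus> y')"
  by (simp add: minus_add_distrib_minus p_add)

lemma mult_minus_mult:
  assumes "x \<in> carrier A" "y \<in> carrier A" "x' \<in> carrier A" "y' \<in> carrier A"
  shows "(x \<otimes> y) \<ominus> (x' \<otimes> y') = ((x \<ominus> x') \<otimes> y) \<oplus> (x' \<otimes> (y \<ominus> y'))"
proof -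
  have "((x \<ominus> x') \<otimes> y) \<oplus> (x' \<otimes> (y \<ominus> y')) = ((x \<otimes> y) \<ominus> (x' \<otimes> y)) \<oplus> ((x' \<otimes> y) \<ominus> (x' \<otimes> y'))"
    using assms by (simp add: a_minus_def l_distr r_distr l_minus r_minus)
  also have "\<dots> = (x \<otimes> y) \<ominus> (x' \<otimes> y')" using assms by (intro minus_add_minus) simp_all
  finally show ?thesis ..
qed

lemma p_mult_minus_le:
  assumes "x \<in> carrier A" "y \<in> carrier A" "x' \<in> carrier A" "y' \<in> carrier A"
  shows "p ((x \<otimes> y) \<ominus> (x' \<otimes> y')) \<le> p (x \<ominus> x') * p y + p x' * p (y \<ominus> y')"
proof -
  have "p ((x \<otimes> y) \<ominus> (x' \<otimes> y')) \<le> p ((x \<ominus> x') \<otimes> y) + p (x' \<otimes> (y \<ominus> y'))"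
    unfolding mult_minus_mult[OF assms] using assms by (intro p_add) simp_all
  also have "\<dots> \<le> p (x \<ominus> x') * p y + p x' * p (y \<ominus> y')"
    using assms by (intro add_mono p_mult) simp_all
  finally show ?thesis .
qed

lemma p_smult_minus:
  assumes "x \<in> carrier A" "x' \<in> carrier A"
  shows "p ((c \<odot> x) \<ominus> (c \<odot> x')) = cmod c * p (x \<ominus> x')"
proof -
  have "(c \<odot> x) \<ominus> (c \<odot> x') = c \<odot> (x \<ominus> x')"
    using assms smult_r_distr[of c x "\<ominus> x'"] smult_r_minus[of c x'] by (simp add: a_minus_def)
  then show ?thesis using assms by (simp add: p_smult)
qed

lemma cauchy_seqs_bounded:
  assumes u: "u \<in> cauchy_seqs A p"
  shows "\<exists>K>0. \<forall>n. p (u n) \<le> K"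
proof -
  have one: "0 < (1::real)" by simp
  obtain N where N: "\<And>m n. \<lbrakk>m \<ge> N; n \<ge> N\<rbrakk> \<Longrightarrow> p (u m \<ominus> u n) < 1"
    using cauchy_seqsD[OF u one] by blast
  \<comment> \<open>The sum over the initial segment dominates each of its terms; the added 1 covers
    the tail and makes \<open>K\<close> positive.\<close>
  define K where "K = (\<Sum>i\<le>N. p (u i)) + 1"
  note c = cauchy_seqs_carrier[OF u]
  have nn: "0 \<le> p (u i)" for i by (rule p_nonneg) (rule c)
  have le: "p (u i) \<le> K - 1" if "i \<le> N" for i
    using member_le_sum[of i "{..N}" "\<lambda>i. p (u i)"] that nn by (simp add: K_def)
  have "p (u n) \<le> K" for n
  proof (cases "n \<le> N")
    case True
    then show ?thesis using le[of n] by simp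
  next
    case False
    have "u n = (u n \<ominus> u N) \<oplus> u N" using c by (simp add: a_minus_def a_assoc l_neg)
    then have "p (u n) \<le> p (u n \<ominus> u N) + p (u N)" using p_add[of "u n \<ominus> u N" "u N"] c by simp
    then show ?thesis using N[of n N] le[of N] False by simp
  qed
  moreover have "0 < K" using sum_nonneg[of "{..N}" "\<lambda>i. p (u i)"] nn by (simp add: K_def)
  ultimately show ?thesis by blast
qed

lemma cauchy_seqs_const: "x \<in> carrier A \<Longrightarrow> (\<lambda>n. x) \<in> cauchy_seqs A p"
  by (intro cauchy_seqsI) (auto simp: minus_eq_zero_iff[THEN iffD2] p_zero_iff[THEN iffD2])

lemma cauchy_seqs_add:
  assumes "u \<in> cauchy_seqs A p" "v \<in> cauchy_seqs A p"
  shows "(\<lambda>n. u n \<oplus> v n) \<in> cauchy_seqs A p"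
proof (rule cauchy_seqsI)
  note c = assms[THEN cauchy_seqs_carrier]
  fix \<epsilon> :: real assume "0 < \<epsilon>"
  then have e: "0 < \<epsilon> / 2" by simp
  obtain M where M: "\<And>m n. \<lbrakk>m \<ge> M; n \<ge> M\<rbrakk> \<Longrightarrow> p (u m \<ominus> u n) < \<epsilon> / 2"
    using cauchy_seqsD[OF assms(1) e] by blast
  obtain N where N: "\<And>m n. \<lbrakk>m \<ge> N; n \<ge> N\<rbrakk> \<Longrightarrow> p (v m \<ominus> v n) < \<epsilon> / 2"
    using cauchy_seqsD[OF assms(2) e] by blast
  have "p ((u m \<oplus> v m) \<ominus> (u n \<oplus> v n)) < \<epsilon>" if "m \<ge> max M N" "n \<ge> max M N" for m n
    using p_add_minus_le[of "u m" "v m" "u n" "v n"] M[of m n] N[of m n] that c by simp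
  then show "\<exists>N. \<forall>m\<ge>N. \<forall>n\<ge>N. p ((u m \<oplus> v m) \<ominus> (u n \<oplus> v n)) < \<epsilon>" by blast
qed (use assms cauchy_seqs_carrier in simp)

lemma cauchy_seqs_mult:
  assumes "u \<in> cauchy_seqs A p" "v \<in> cauchy_seqs A p"
  shows "(\<lambda>n. u n \<otimes> v n) \<in> cauchy_seqs A p"
proof (rule cauchy_seqsI)
  note c = assms[THEN cauchy_seqs_carrier]
  fix \<epsilon> :: real assume e: "0 < \<epsilon>"
  obtain K where K: "0 < K" "\<And>n. p (u n) \<le> K" using cauchy_seqs_bounded[OF assms(1)] by blast
  obtain L where L: "0 < L" "\<And>n. p (v n) \<le> L" using cauchy_seqs_bounded[OF assms(2)] by blast
  \<comment> \<open>Each half of the estimate is a small difference times a bound of the other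
    factor, whence \<open>L\<close> for the differences of \<open>u\<close> and \<open>K\<close> for
    those of \<open>v\<close>.\<close>
  have e': "0 < \<epsilon> / (2 * L)" "0 < \<epsilon> / (2 * K)" using e K L by simp_all
  obtain M where M: "\<And>m n. \<lbrakk>m \<ge> M; n \<ge> M\<rbrakk> \<Longrightarrow> p (u m \<ominus> u n) < \<epsilon> / (2 * L)"
    using cauchy_seqsD[OF assms(1) e'(1)] by blast
  obtain N where N: "\<And>m n. \<lbrakk>m \<ge> N; n \<ge> N\<rbrakk> \<Longrightarrow> p (v m \<ominus> v n) < \<epsilon> / (2 * K)"
    using cauchy_seqsD[OF assms(2) e'(2)] by blast
  have "p ((u m \<otimes> v m) \<ominus> (u n \<otimes> v n)) < \<epsilon>" if mn: "m \<ge> max M N" "n \<ge> max M N" for m n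
  proof -
    have nn: "0 \<le> p (u m \<ominus> u n)" "0 \<le> p (v m \<ominus> v n)" using c by (simp_all add: p_nonneg)
    have "p ((u m \<otimes> v m) \<ominus> (u n \<otimes> v n)) \<le> p (u m \<ominus> u n) * p (v m) + p (u n) * p (v m \<ominus> v n)"
      using c by (intro p_mult_minus_le)
    also have "\<dots> \<le> p (u m \<ominus> u n) * L + K * p (v m \<ominus> v n)"
      using nn K L by (intro add_mono mult_left_mono mult_right_mono)
    also have "\<dots> < \<epsilon> / (2 * L) * L + K * (\<epsilon> / (2 * K))"
      using M[of m n] N[of m n] mn K L by (intro add_strict_mono mult_strict_right_mono mult_strict_left_mono) auto
    also have "\<dots> = \<epsilon>" using K L by simp
    finally show ?thesis .
  qed
  then show "\<exists>N. \<forall>m\<ge>N. \<forall>n\<ge>N. p ((u m \<otimes> v m) \<ominus> (u n \<otimes> v n)) < \<epsilon>" by blast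
qed (use assms cauchy_seqs_carrier in simp)

lemma cauchy_seqs_smult:
  assumes "u \<in> cauchy_seqs A p"
  shows "(\<lambda>n. c \<odot> u n) \<in> cauchy_seqs A p"
proof (rule cauchy_seqsI)
  fix \<epsilon> :: real assume e: "0 < \<epsilon>"
  \<comment> \<open>\<open>cmod c + 1\<close> can be divided by even when
    \<open>c = 0\<close>.\<close>
  have pos: "0 < cmod c + 1" using norm_ge_zero[of c] by linarith
  have e': "0 < \<epsilon> / (cmod c + 1)" using e pos by simp
  obtain N where N: "\<And>m n. \<lbrakk>m \<ge> N; n \<ge> N\<rbrakk> \<Longrightarrow> p (u m \<ominus> u n) < \<epsilon> / (cmod c + 1)"
    using cauchy_seqsD[OF assms e'] by blast
  have "p ((c \<odot> u m) \<ominus> (c \<odot> u n)) < \<epsilon>" if "m \<ge> N" "n \<ge> N" for m n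
  proof -
    have "p ((c \<odot> u m) \<ominus> (c \<odot> u n)) = cmod c * p (u m \<ominus> u n)"
      using cauchy_seqs_carrier[OF assms] by (intro p_smult_minus)
    also have "\<dots> \<le> (cmod c + 1) * p (u m \<ominus> u n)"
      using p_nonneg[of "u m \<ominus> u n"] cauchy_seqs_carrier[OF assms] by (intro mult_right_mono) simp_all
    also have "\<dots> < \<epsilon>" using N[OF that] pos by (simp add: field_simps)
    finally show ?thesis .
  qed
  then show "\<exists>N. \<forall>m\<ge>N. \<forall>n\<ge>N. p ((c \<odot> u m) \<ominus> (c \<odot> u n)) < \<epsilon>" by blast
qed (use assms cauchy_seqs_carrier in simp)

lemma null_rel_equiv: "equiv (cauchy_seqs A p) (null_rel A p)"
proof (rule equivI)
  show "null_rel A p \<subseteq> cauchy_seqs A p \<times> cauchy_seqs A p" by (auto simp: null_rel_iff)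
  show "refl_on (cauchy_seqs A p) (null_rel A p)"
  proof (rule refl_onI)
    fix u assume u: "u \<in> cauchy_seqs A p"
    have "(\<lambda>n. p (u n \<ominus> u n)) = (\<lambda>n. 0)"
      using cauchy_seqs_carrier[OF u] by (simp add: minus_eq_zero_iff[THEN iffD2] p_zero_iff[THEN iffD2])
    then show "(u, u) \<in> null_rel A p" using u by (simp add: null_rel_iff)
  qed
  show "sym (null_rel A p)"
  proof (rule symI)
    fix u v assume uv: "(u, v) \<in> null_rel A p"
    then have c: "u n \<in> carrier A" "v n \<in> carrier A" for n
      using cauchy_seqs_carrier by (auto simp: null_rel_iff)
    then have "(\<lambda>n. p (v n \<ominus> u n)) = (\<lambda>n. p (u n \<ominus> v n))"
      by (intro ext norm_minus_commute)
    then show "(v, u) \<in> null_rel A p" using uv by (simp add: null_rel_iff)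
  qed
  show "trans (null_rel A p)"
  proof (rule transI)
    fix u v w assume uv: "(u, v) \<in> null_rel A p" and vw: "(v, w) \<in> null_rel A p"
    then have c: "u n \<in> carrier A" "v n \<in> carrier A" "w n \<in> carrier A" for n
      using cauchy_seqs_carrier by (auto simp: null_rel_iff)
    have "(\<lambda>n. p (u n \<ominus> v n) + p (v n \<ominus> w n)) \<longlonglongrightarrow> 0 + 0"
      using uv vw by (intro tendsto_add) (auto simp: null_rel_iff)
    then have "(\<lambda>n. p (u n \<ominus> v n) + p (v n \<ominus> w n)) \<longlonglongrightarrow> 0" by simp
    moreover have "p (u n \<ominus> w n) \<le> p (u n \<ominus> v n) + p (v n \<ominus> w n)" for n
      using p_add[of "u n \<ominus> v n" "v n \<ominus> w n"] c[of n] by (simp add: minus_add_minus)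
    moreover have "0 \<le> p (u n \<ominus> w n)" for n using c[of n] by (simp add: p_nonneg)
    ultimately have "(\<lambda>n. p (u n \<ominus> w n)) \<longlonglongrightarrow> 0" by - (rule LIMSEQ_null_comparison)
    then show "(u, w) \<in> null_rel A p" using uv vw by (simp add: null_rel_iff)
  qed
qed

lemma null_rel_add:
  assumes "(u, u') \<in> null_rel A p" "(v, v') \<in> null_rel A p"
  shows "(\<lambda>n. u n \<oplus> v n, \<lambda>n. u' n \<oplus> v' n) \<in> null_rel A p"
proof -
  note uv = assms[unfolded null_rel_iff]
  have c: "u n \<in> carrier A" "v n \<in> carrier A" "u' n \<in> carrier A" "v' n \<in> carrier A" for n
    using uv cauchy_seqs_carrier by auto
  have "(\<lambda>n. p (u n \<ominus> u' n) + p (v n \<ominus> v' n)) \<longlonglongrightarrow> 0 + 0"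
    using uv by (intro tendsto_add) auto
  then have "(\<lambda>n. p ((u n \<oplus> v n) \<ominus> (u' n \<oplus> v' n))) \<longlonglongrightarrow> 0"
    by - (rule LIMSEQ_null_comparison[of "\<lambda>n. p (u n \<ominus> u' n) + p (v n \<ominus> v' n)"],
      simp_all add: p_add_minus_le p_nonneg c)
  then show ?thesis using uv by (simp add: null_rel_iff cauchy_seqs_add)
qed

lemma null_rel_mult:
  assumes "(u, u') \<in> null_rel A p" "(v, v') \<in> null_rel A p"
  shows "(\<lambda>n. u n \<otimes> v n, \<lambda>n. u' n \<otimes> v' n) \<in> null_rel A p"
proof -
  note uv = assms[unfolded null_rel_iff]
  have c: "u n \<in> carrier A" "v n \<in> carrier A" "u' n \<in> carrier A" "v' n \<in> carrier A" for n
    using uv cauchy_seqs_carrier by auto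
  obtain K where K: "\<And>n. p (u' n) \<le> K" using cauchy_seqs_bounded uv by blast
  obtain L where L: "\<And>n. p (v n) \<le> L" using cauchy_seqs_bounded uv by blast
  have "(\<lambda>n. p (u n \<ominus> u' n) * L + K * p (v n \<ominus> v' n)) \<longlonglongrightarrow> 0 * L + K * 0"
    using uv by (intro tendsto_add tendsto_mult tendsto_const) auto
  moreover have "p ((u n \<otimes> v n) \<ominus> (u' n \<otimes> v' n)) \<le> p (u n \<ominus> u' n) * L + K * p (v n \<ominus> v' n)" for n
  proof -
    have "p ((u n \<otimes> v n) \<ominus> (u' n \<otimes> v' n)) \<le> p (u n \<ominus> u' n) * p (v n) + p (u' n) * p (v n \<ominus> v' n)"
      using c by (intro p_mult_minus_le)
    also have "\<dots> \<le> p (u n \<ominus> u' n) * L + K * p (v n \<ominus> v' n)"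
      using K L c by (intro add_mono mult_left_mono mult_right_mono) (simp_all add: p_nonneg)
    finally show ?thesis .
  qed
  ultimately have "(\<lambda>n. p ((u n \<otimes> v n) \<ominus> (u' n \<otimes> v' n))) \<longlonglongrightarrow> 0"
    by - (rule LIMSEQ_null_comparison[of "\<lambda>n. p (u n \<ominus> u' n) * L + K * p (v n \<ominus> v' n)"],
      simp_all add: p_nonneg c)
  then show ?thesis using uv by (simp add: null_rel_iff cauchy_seqs_mult)
qed

lemma null_rel_smult:
  assumes "(u, u') \<in> null_rel A p"
  shows "(\<lambda>n. c \<odot> u n, \<lambda>n. c \<odot> u' n) \<in> null_rel A p"
proof -
  note uv = assms[unfolded null_rel_iff]
  have c: "u n \<in> carrier A" "u' n \<in> carrier A" for n
    using uv cauchy_seqs_carrier by auto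
  have "(\<lambda>n. cmod c * p (u n \<ominus> u' n)) \<longlonglongrightarrow> cmod c * 0"
    using uv by (intro tendsto_mult tendsto_const) auto
  then show ?thesis using uv c by (simp add: null_rel_iff cauchy_seqs_smult p_smult_minus)
qed

text \<open>An algebra before passing to classes. The completion is its image under
  \<open>cls\<close>, so the ring and vector space laws are checked pointwise here and transported
  along a surjective homomorphism.\<close>

definition seq_algebra :: "(complex, nat \<Rightarrow> 'a) module" where
  "seq_algebra = \<lparr>
     carrier = cauchy_seqs A p,
     mult = (\<lambda>u v n. u n \<otimes> v n), one = (\<lambda>n. \<one>), zero = (\<lambda>n. \<zero>),
     add = (\<lambda>u v n. u n \<oplus> v n), smult = (\<lambda>c u n. c \<odot> u n)\<rparr>"

lemma seq_algebra_simps: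
  "carrier seq_algebra = cauchy_seqs A p"
  "u \<otimes>\<^bsub>seq_algebra\<^esub> v = (\<lambda>n. u n \<otimes> v n)" "\<one>\<^bsub>seq_algebra\<^esub> = (\<lambda>n. \<one>)"
  "u \<oplus>\<^bsub>seq_algebra\<^esub> v = (\<lambda>n. u n \<oplus> v n)" "\<zero>\<^bsub>seq_algebra\<^esub> = (\<lambda>n. \<zero>)"
  "c \<odot>\<^bsub>seq_algebra\<^esub> u = (\<lambda>n. c \<odot> u n)"
  by (simp_all add: seq_algebra_def)

lemma abelian_group_seq_algebra: "abelian_group seq_algebra"
proof (rule abelian_groupI)
  fix u assume u: "u \<in> carrier seq_algebra"
  then have "(\<lambda>n. (-1) \<odot> u n) \<in> carrier seq_algebra" by (simp add: seq_algebra_simps cauchy_seqs_smult)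
  moreover have "(-1) \<odot> u n \<oplus> u n = \<zero>" for n
    using u smult_minus_1[of "u n"] by (simp add: seq_algebra_simps cauchy_seqs_carrier class_ring_simps l_neg)
  ultimately show "\<exists>v\<in>carrier seq_algebra. v \<oplus>\<^bsub>seq_algebra\<^esub> u = \<zero>\<^bsub>seq_algebra\<^esub>"
    by (intro bexI[of _ "\<lambda>n. (-1) \<odot> u n"]) (simp_all add: seq_algebra_simps)
qed (simp_all add: seq_algebra_simps cauchy_seqs_add cauchy_seqs_const cauchy_seqs_carrier a_ac)

lemma ring_seq_algebra: "ring seq_algebra"
  by (rule ringI[OF abelian_group_seq_algebra monoidI])
    (simp_all add: seq_algebra_simps cauchy_seqs_mult cauchy_seqs_const cauchy_seqs_carrier m_assoc l_distr r_distr)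

lemma vectorspace_seq_algebra: "vectorspace class_ring seq_algebra"
proof -
  have "module class_ring seq_algebra"
    by (rule moduleI[OF _ abelian_group_seq_algebra])
      (simp_all add: seq_algebra_simps cauchy_seqs_smult cauchy_seqs_carrier class_cring.cring_axioms
        smult_l_distr[simplified] smult_r_distr smult_assoc1[simplified] smult_one[simplified])
  then show ?thesis by (simp add: vectorspace_def class_field)
qed

definition cls :: "(nat \<Rightarrow> 'a) \<Rightarrow> (nat \<Rightarrow> 'a) set" where
  "cls u = null_rel A p `` {u}"

lemma cls_eq_iff:
  "\<lbrakk>u \<in> cauchy_seqs A p; v \<in> cauchy_seqs A p\<rbrakk> \<Longrightarrow> cls u = cls v \<longleftrightarrow> (u, v) \<in> null_rel A p"
  unfolding cls_def by (rule eq_equiv_class_iff[OF null_rel_equiv])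

lemma mem_cls_iff: "v \<in> cls u \<longleftrightarrow> (u, v) \<in> null_rel A p"
  by (simp add: cls_def)

lemma cls_self: "u \<in> cauchy_seqs A p \<Longrightarrow> u \<in> cls u"
  unfolding cls_def by (rule equiv_class_self[OF null_rel_equiv])

lemma completion_carrier: "carrier (completion A p) = cls ` cauchy_seqs A p"
  by (auto simp: completion_def quotient_def cls_def)

lemma cls_eqI: "(u, v) \<in> null_rel A p \<Longrightarrow> cls u = cls v"
  unfolding cls_def by (rule equiv_class_eq[OF null_rel_equiv])

lemma cls_nonempty: "u \<in> cauchy_seqs A p \<Longrightarrow> cls u \<noteq> {}"
  using cls_self by blast

text \<open>The operations of \<open>completion\<close> are unions over all representatives;
  compatibility with \<open>null_rel\<close> makes the sets in the union coincide.\<close>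

lemma UN_cls2:
  assumes "u \<in> cauchy_seqs A p" "v \<in> cauchy_seqs A p"
    and F: "\<And>u' v'. \<lbrakk>(u, u') \<in> null_rel A p; (v, v') \<in> null_rel A p\<rbrakk> \<Longrightarrow> (F u v, F u' v') \<in> null_rel A p"
  shows "(\<Union>u'\<in>cls u. \<Union>v'\<in>cls v. cls (F u' v')) = cls (F u v)"
proof -
  have "cls (F u' v') = cls (F u v)" if "u' \<in> cls u" "v' \<in> cls v" for u' v'
    using cls_eqI[OF F] that by (simp add: mem_cls_iff)
  then show ?thesis using cls_nonempty[OF assms(1)] cls_nonempty[OF assms(2)] by simp
qed

lemma completion_mult:
  assumes "u \<in> cauchy_seqs A p" "v \<in> cauchy_seqs A p"
  shows "cls u \<otimes>\<^bsub>completion A p\<^esub> cls v = cls (\<lambda>n. u n \<otimes> v n)"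
  using UN_cls2[OF assms, of "\<lambda>u v n. u n \<otimes> v n", OF null_rel_mult]
  by (simp add: completion_def flip: cls_def)

lemma completion_add:
  assumes "u \<in> cauchy_seqs A p" "v \<in> cauchy_seqs A p"
  shows "cls u \<oplus>\<^bsub>completion A p\<^esub> cls v = cls (\<lambda>n. u n \<oplus> v n)"
  using UN_cls2[OF assms, of "\<lambda>u v n. u n \<oplus> v n", OF null_rel_add]
  by (simp add: completion_def flip: cls_def)

lemma completion_smult:
  assumes "u \<in> cauchy_seqs A p"
  shows "c \<odot>\<^bsub>completion A p\<^esub> cls u = cls (\<lambda>n. c \<odot> u n)"
  \<comment> \<open>The unary operation is treated as a binary one that ignores its second
    argument.\<close>
  using UN_cls2[OF assms assms, of "\<lambda>u v n. c \<odot> u n", OF null_rel_smult] cls_nonempty[OF assms]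
  by (simp add: completion_def flip: cls_def)

lemma completion_zero_one:
  "\<zero>\<^bsub>completion A p\<^esub> = cls (\<lambda>n. \<zero>)" "\<one>\<^bsub>completion A p\<^esub> = cls (\<lambda>n. \<one>)"
  by (simp_all add: completion_def cls_def)

lemma cls_ring_hom: "cls \<in> Ring.ring_hom seq_algebra (completion A p)"
  by (rule ring_hom_memI)
    (auto simp: seq_algebra_simps completion_carrier completion_mult completion_add completion_zero_one)

lemma cls_module_hom: "cls \<in> module_hom class_ring seq_algebra (completion A p)"
  by (auto simp: module_hom_def seq_algebra_simps completion_carrier completion_add completion_smult)

lemma ring_completion: "ring (completion A p)"
  using ring.ring_hom_imp_img_ring[OF ring_seq_algebra cls_ring_hom]
  by (simp add: seq_algebra_simps completion_carrier[symmetric] completion_zero_one(1)[symmetric])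

end

subsection \<open>Permutation representations\<close>

lemma infsum_sum:
  fixes g :: "'i \<Rightarrow> 'x \<Rightarrow> complex"
  assumes "finite S" "\<And>y. y \<in> S \<Longrightarrow> g y summable_on X"
  shows "(\<Sum>\<^sub>\<infinity>x\<in>X. \<Sum>y\<in>S. g y x) = (\<Sum>y\<in>S. \<Sum>\<^sub>\<infinity>x\<in>X. g y x)"
proof -
  have "((\<lambda>x. \<Sum>y\<in>S. g y x) has_sum (\<Sum>y\<in>S. \<Sum>\<^sub>\<infinity>x\<in>X. g y x)) X"
    using assms
  proof (induction rule: finite_induct)
    case (insert y S)
    then show ?case by (simp add: has_sum_add)
  qed simp
  then show ?thesis by (rule infsumI)
qed

context set_action
begin

text \<open>Any finite bound will do. Cauchy-Schwarz over the finite support of \<open>f\<close>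
  gives \<open>C\<close>, once each translate of \<open>\<xi>\<close> is seen to have partial sums
  bounded by the norm of \<open>\<xi>\<close>: a group element permutes \<open>X\<close> and so
  carries a finite subset to another one.\<close>

lemma conv_ell2:
  assumes f: "f \<in> carrier (group_algebra G)" and \<xi>: "\<xi> \<in> carrier (ell2 X)"
  defines "C \<equiv> sqrt (\<Sum>y | f y \<noteq> 0. (cmod (f y))\<^sup>2) * sqrt (card {y. f y \<noteq> 0})"
  shows "conv f \<xi> \<in> carrier (ell2 X)"
    and "inner_norm (ell2 X) (conv f \<xi>) \<le> C * inner_norm (ell2 X) \<xi>"
proof -
  let ?S = "{y. f y \<noteq> 0}"
  interpret H: pre_hilbert_space "ell2 X"
    by (rule complex_hilbert_space.pre_hilbert_space[OF complex_hilbert_space_ell2])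
  have nonneg: "0 \<le> C * inner_norm (ell2 X) \<xi>"
    unfolding C_def by (intro mult_nonneg_nonneg H.inner_norm_nonneg \<xi>) (simp_all add: sum_nonneg)
  have bound: "(\<Sum>x\<in>F. (cmod (conv f \<xi> x))\<^sup>2) \<le> (C * inner_norm (ell2 X) \<xi>)\<^sup>2"
    if F: "finite F" "F \<subseteq> X" for F
  proof -
    let ?A = "\<Sum>y\<in>?S. (cmod (f y))\<^sup>2"
    have "(cmod (conv f \<xi> x))\<^sup>2 \<le> ?A * (\<Sum>y\<in>?S. (cmod (\<xi> (act (inv y) x)))\<^sup>2)" if "x \<in> F" for x
    proof -
      have x: "x \<in> X" using that F by blast
      have "cmod (conv f \<xi> x) \<le> (\<Sum>y\<in>?S. cmod (f y) * cmod (\<xi> (act (inv y) x)))"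
        unfolding conv_supp[OF x f] by (rule order_trans[OF norm_sum]) (simp add: norm_mult)
      then have "(cmod (conv f \<xi> x))\<^sup>2 \<le> (\<Sum>y\<in>?S. cmod (f y) * cmod (\<xi> (act (inv y) x)))\<^sup>2"
        by (rule power_mono) simp
      also have "\<dots> \<le> ?A * (\<Sum>y\<in>?S. (cmod (\<xi> (act (inv y) x)))\<^sup>2)" by (rule Cauchy_Schwarz_ineq_sum)
      finally show ?thesis .
    qed
    then have "(\<Sum>x\<in>F. (cmod (conv f \<xi> x))\<^sup>2)
        \<le> (\<Sum>x\<in>F. ?A * (\<Sum>y\<in>?S. (cmod (\<xi> (act (inv y) x)))\<^sup>2))" by (rule sum_mono)
    also have "\<dots> = ?A * (\<Sum>y\<in>?S. \<Sum>x\<in>F. (cmod (\<xi> (act (inv y) x)))\<^sup>2)"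
      by (subst sum.swap) (simp add: sum_distrib_left)
    also have "\<dots> \<le> ?A * (\<Sum>y\<in>?S. (inner_norm (ell2 X) \<xi>)\<^sup>2)"
    proof (intro mult_left_mono sum_mono sum_nonneg zero_le_power2)
      fix y assume "y \<in> ?S"
      then have y: "inv y \<in> carrier G" using group_algebra_memD[OF f] by auto
      have inj: "inj_on (act (inv y)) F"
        using bij_betw_act[OF y] F(2) by (meson bij_betw_imp_inj_on inj_on_subset)
      have "(\<Sum>x\<in>F. (cmod (\<xi> (act (inv y) x)))\<^sup>2) = (\<Sum>z\<in>act (inv y) ` F. (cmod (\<xi> z))\<^sup>2)"
        by (simp add: sum.reindex[OF inj])
      also have "\<dots> \<le> (inner_norm (ell2 X) \<xi>)\<^sup>2"
        using F act_closed[OF y] by (intro sum_cmod_le_inner_norm_ell2 \<xi>) auto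
      finally show "(\<Sum>x\<in>F. (cmod (\<xi> (act (inv y) x)))\<^sup>2) \<le> (inner_norm (ell2 X) \<xi>)\<^sup>2" .
    qed
    also have "\<dots> = (C * inner_norm (ell2 X) \<xi>)\<^sup>2"
      by (simp add: C_def power_mult_distrib sum_nonneg)
    finally show ?thesis .
  qed
  show "conv f \<xi> \<in> carrier (ell2 X)"
    "inner_norm (ell2 X) (conv f \<xi>) \<le> C * inner_norm (ell2 X) \<xi>"
    by (rule inner_norm_ell2_le[OF conv_outside nonneg bound]; assumption)+
qed

text \<open>Restricted to the carrier because \<open>bounded_operators\<close> consists of
  extensional functions.\<close>

definition perm_rep :: "('a \<Rightarrow> complex) \<Rightarrow> ('x \<Rightarrow> complex) \<Rightarrow> ('x \<Rightarrow> complex)" where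
  "perm_rep f = restrict (conv f) (carrier (ell2 X))"

lemma perm_rep_closed:
  assumes f: "f \<in> carrier (group_algebra G)"
  shows "perm_rep f \<in> carrier (bounded_operators (ell2 X))"
proof -
  have "perm_rep f \<in> module_hom class_ring (ell2 X) (ell2 X)"
    using conv_ell2(1)[OF f]
    by (auto simp: module_hom_def ell2_add_closed ell2_smult_closed perm_rep_def ell2_simps conv_add_right conv_smult_right)
  moreover have "\<exists>K. \<forall>\<xi>\<in>carrier (ell2 X).
      inner_norm (ell2 X) (perm_rep f \<xi>) \<le> K * inner_norm (ell2 X) \<xi>"
    using conv_ell2(2)[OF f] unfolding perm_rep_def by (intro exI ballI) (simp only: restrict_apply' if_True)
  ultimately show ?thesis by (simp add: bounded_operators_def perm_rep_def)
qed

lemma cinner_conv_star: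
  assumes f: "f \<in> carrier (group_algebra G)"
    and \<xi>: "\<xi> \<in> carrier (ell2 X)" and \<eta>: "\<eta> \<in> carrier (ell2 X)"
  shows "cinner (ell2 X) (conv (star (group_algebra G) f) \<xi>) \<eta> = cinner (ell2 X) \<xi> (conv f \<eta>)"
proof -
  let ?S = "{y. f y \<noteq> 0}"
  note S = group_algebra_memD[OF f]
  \<comment> \<open>\<open>g y\<close> is the summand of
    \<open>cinner (ell2 X) \<xi> (conv f \<eta>)\<close> that belongs to \<open>y\<close>.
    Substituting \<open>act y x\<close> for \<open>x\<close>, a permutation of \<open>X\<close>,
    turns it into the corresponding summand of the left-hand side.\<close>
  define g where "g y x = cnj (f y) * (\<xi> x * cnj (conv (delta y) \<eta> x))" for y x
  have g_summable: "g y summable_on X" if "y \<in> ?S" for y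
    unfolding g_def using that S
    by (intro summable_on_cmult_right ell2_summable \<xi> conv_ell2 \<eta> delta_closed) auto
  have bij: "bij_betw (act y) X X" if "y \<in> ?S" for y using S that bij_betw_act by auto
  have g_act: "g y (act y x) = cnj (f y) * \<xi> (act y x) * cnj (\<eta> x)" if "y \<in> ?S" "x \<in> X" for y x
    using that S(2) by (simp add: g_def conv_delta act_closed act_inv_act subset_iff)
  have star_eq: "conv (star (group_algebra G) f) \<xi> x = (\<Sum>y\<in>?S. cnj (f y) * \<xi> (act y x))"
    if x: "x \<in> X" for x
  proof -
    have "conv (star (group_algebra G) f) \<xi> x
        = (\<Sum>y\<in>m_inv G ` ?S. star (group_algebra G) f y * \<xi> (act (inv y) x))"
    proof (rule conv_eq_sum[OF x])
      show "finite (m_inv G ` ?S)" "m_inv G ` ?S \<subseteq> carrier G" using S by auto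
      show "y \<in> m_inv G ` ?S" if "star (group_algebra G) f y \<noteq> 0" for y
        using that by (intro image_eqI[of _ _ "inv y"]) (auto simp: group_algebra_simps split: if_splits)
    qed
    also have "\<dots> = (\<Sum>y\<in>?S. star (group_algebra G) f (inv y) * \<xi> (act (inv (inv y)) x))"
      using S(2) by (subst sum.reindex) (auto intro: inj_on_subset[OF inv_inj] simp: o_def)
    also have "\<dots> = (\<Sum>y\<in>?S. cnj (f y) * \<xi> (act y x))"
      using S(2) by (intro sum.cong) (auto simp: group_algebra_simps subset_iff)
    finally show ?thesis .
  qed
  have "cinner (ell2 X) (conv (star (group_algebra G) f) \<xi>) \<eta> = (\<Sum>\<^sub>\<infinity>x\<in>X. \<Sum>y\<in>?S. g y (act y x))"
    unfolding ell2_simps by (intro infsum_cong) (simp add: star_eq g_act sum_distrib_right)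
  also have "\<dots> = (\<Sum>y\<in>?S. \<Sum>\<^sub>\<infinity>x\<in>X. g y (act y x))"
    by (rule infsum_sum[OF S(1)]) (use g_summable in \<open>simp add: summable_on_reindex_bij_betw[OF bij]\<close>)
  also have "\<dots> = (\<Sum>y\<in>?S. \<Sum>\<^sub>\<infinity>x\<in>X. g y x)"
    by (intro sum.cong refl infsum_reindex_bij_betw bij)
  also have "\<dots> = (\<Sum>\<^sub>\<infinity>x\<in>X. \<Sum>y\<in>?S. g y x)"
    by (rule infsum_sum[OF S(1), symmetric]) (rule g_summable)
  also have "\<dots> = cinner (ell2 X) \<xi> (conv f \<eta>)"
    unfolding ell2_simps
  proof (intro infsum_cong)
    fix x assume x: "x \<in> X"
    have "conv (delta y) \<eta> x = \<eta> (act (inv y) x)" if "y \<in> ?S" for y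
      using that S(2) x by (intro conv_delta) auto
    then show "(\<Sum>y\<in>?S. g y x) = \<xi> x * cnj (conv f \<eta> x)"
      by (simp add: g_def conv_supp[OF x f] sum_distrib_left mult_ac)
  qed
  finally show ?thesis .
qed

lemma star_representation_perm_rep: "star_representation (group_algebra G) (ell2 X) perm_rep"
  unfolding star_representation_def
proof (intro conjI ballI)
  show "perm_rep \<in> Ring.ring_hom (group_algebra G) (bounded_operators (ell2 X))"
  proof (rule ring_hom_memI)
    fix f h assume fh: "f \<in> carrier (group_algebra G)" "h \<in> carrier (group_algebra G)"
    show "perm_rep (f \<otimes>\<^bsub>group_algebra G\<^esub> h) = perm_rep f \<otimes>\<^bsub>bounded_operators (ell2 X)\<^esub> perm_rep h"
      using conv_ell2(1)[OF fh(2)]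
      by (auto simp: perm_rep_def bounded_operators_simps compose_def conv_mult[OF fh])
    show "perm_rep (f \<oplus>\<^bsub>group_algebra G\<^esub> h) = perm_rep f \<oplus>\<^bsub>bounded_operators (ell2 X)\<^esub> perm_rep h"
      by (auto simp: perm_rep_def bounded_operators_simps group_algebra_simps(4) conv_add_left[OF fh] ell2_simps)
  next
    show "perm_rep \<one>\<^bsub>group_algebra G\<^esub> = \<one>\<^bsub>bounded_operators (ell2 X)\<^esub>"
      unfolding perm_rep_def bounded_operators_simps
      by (rule restrict_ext) (rule conv_one, rule ell2_memD(1))
  qed (rule perm_rep_closed)
  show "perm_rep \<in> module_hom class_ring (group_algebra G) (bounded_operators (ell2 X))"
    using perm_rep_closed
    by (auto simp: module_hom_def perm_rep_def bounded_operators_simps group_algebra_simps(4,5)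
        conv_add_left conv_smult_left ell2_simps)
next
  fix f \<xi> \<eta>
  assume "f \<in> carrier (group_algebra G)" "\<xi> \<in> carrier (ell2 X)" "\<eta> \<in> carrier (ell2 X)"
  then show "cinner (ell2 X) (perm_rep (star (group_algebra G) f) \<xi>) \<eta> = cinner (ell2 X) \<xi> (perm_rep f \<eta>)"
    by (simp add: perm_rep_def cinner_conv_star)
qed

lemma delta_ell2: "x \<in> X \<Longrightarrow> delta x \<in> carrier (ell2 X)"
  by (rule ell2_memI)
    (auto simp: delta_def if_distrib[of cmod] intro!: finite_nonzero_values_imp_summable_on)

lemma perm_rep_delta:
  assumes "g \<in> carrier G" "x \<in> X"
  shows "perm_rep (delta g) (delta x) = delta (act g x)"
proof
  fix z
  show "perm_rep (delta g) (delta x) z = delta (act g x) z"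
  proof (cases "z \<in> X")
    case True
    then have "act (inv g) z = x \<longleftrightarrow> z = act g x" using assms act_inv_act act_act_inv by metis
    with True show ?thesis using assms
      by (simp add: perm_rep_def delta_ell2 conv_delta) (simp add: delta_def)
  next
    case False
    then have "z \<noteq> act g x" using act_closed[OF assms] by blast
    with False show ?thesis using assms by (simp add: perm_rep_def delta_ell2 conv_outside delta_def)
  qed
qed

end

context group
begin

text \<open>The left regular representation applied to the unit vector \<open>delta \<one>\<close>
  returns \<open>f\<close> itself, so its norm dominates every coefficient of \<open>f\<close>. The
  coefficient bound gives definiteness, and later the convergence of coefficients along Cauchy
  sequences.\<close>

lemma cstar_norm_exists:
  "\<exists>p. cstar_norm (group_algebra G) p \<and> (\<forall>f\<in>carrier (group_algebra G). \<forall>g. cmod (f g) \<le> p f)"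
proof -
  interpret L: set_action G "carrier G" "mult G" by (rule group_set_action) (rule is_group)
  interpret A: vectorspace class_ring "group_algebra G" by (rule vectorspace_group_algebra)
  interpret R: ring "group_algebra G" by (rule ring_group_algebra)
  let ?H = "ell2 (carrier G)"
  interpret H: pre_hilbert_space ?H
    by (rule complex_hilbert_space.pre_hilbert_space[OF complex_hilbert_space_ell2])
  define p where "p = (\<lambda>f. op_norm ?H (L.perm_rep f))"
  have semi: "cstar_seminorm (group_algebra G) p"
    unfolding p_def
    by (rule cstar_seminorm_op_norm[OF vectorspace_group_algebra H.pre_hilbert_space_axioms
          L.star_representation_perm_rep])
      (simp_all add: group_algebra_star_closed)
  have bound: "cmod (f g) \<le> p f" if f: "f \<in> carrier (group_algebra G)" for f g
  proof (cases "g \<in> carrier G")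
    case True
    have d: "delta \<one> \<in> carrier ?H" by (rule L.delta_ell2) simp
    have norm_d: "inner_norm ?H (delta \<one>) = 1"
    proof -
      have "(inner_norm ?H (delta \<one>))\<^sup>2 = (\<Sum>\<^sub>\<infinity>x\<in>carrier G. (cmod (delta \<one> x))\<^sup>2)"
        by (rule inner_norm_ell2_power2[OF d])
      also have "\<dots> = (\<Sum>\<^sub>\<infinity>x\<in>{\<one>}. (cmod (delta \<one> x))\<^sup>2)"
        by (rule infsum_cong_neutral) (auto simp: delta_def)
      also have "\<dots> = 1" by (simp add: delta_def)
      finally show ?thesis using H.inner_norm_nonneg[OF d] by (simp add: power2_eq_1_iff)
    qed
    \<comment> \<open>The right unit law is read as the action of \<open>f\<close> on the vector
      \<open>delta \<one>\<close>.\<close>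
    have "f \<otimes>\<^bsub>group_algebra G\<^esub> \<one>\<^bsub>group_algebra G\<^esub> = f" using f by (rule R.r_one)
    then have "L.perm_rep f (delta \<one>) = f"
      using d by (simp add: L.perm_rep_def group_algebra_mult[OF is_group] group_algebra_simps(2))
    then have "(\<Sum>x\<in>{g}. (cmod (f x))\<^sup>2) \<le> (inner_norm ?H (L.perm_rep f (delta \<one>)))\<^sup>2"
      using sum_cmod_le_inner_norm_ell2[of f "carrier G" "{g}"] True
        H.bounded_operatorsD(2)[OF L.perm_rep_closed[OF f] d] by simp
    then have "cmod (f g) \<le> inner_norm ?H (L.perm_rep f (delta \<one>))"
      using H.inner_norm_nonneg[OF H.bounded_operatorsD(2)[OF L.perm_rep_closed[OF f] d]]
      by (simp add: abs_le_square_iff[symmetric])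
    also have "\<dots> \<le> p f"
      using H.inner_norm_apply_le[OF L.perm_rep_closed[OF f] d] by (simp add: p_def norm_d)
    finally show ?thesis .
  next
    case False
    then have "f g = 0" using group_algebra_memD(3)[OF f] by blast
    then show ?thesis using semi f by (simp add: cstar_seminorm_def)
  qed
  have "p f = 0 \<longleftrightarrow> f = \<zero>\<^bsub>group_algebra G\<^esub>" if f: "f \<in> carrier (group_algebra G)" for f
  proof
    assume "p f = 0"
    then show "f = \<zero>\<^bsub>group_algebra G\<^esub>" using bound[OF f] by (auto simp: group_algebra_simps)
  next
    assume "f = \<zero>\<^bsub>group_algebra G\<^esub>"
    then have "L.perm_rep f = \<zero>\<^bsub>bounded_operators ?H\<^esub>"
      using star_representation_zero[OF vectorspace_group_algebra H.pre_hilbert_space_axioms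
          L.star_representation_perm_rep] by simp
    then show "p f = 0" using H.op_norm_zero_iff[OF L.perm_rep_closed[OF f]] by (simp add: p_def)
  qed
  with semi have "cstar_norm (group_algebra G) p" by (simp add: cstar_norm_iff_seminorm)
  then show ?thesis using bound by blast
qed

end

subsection \<open>Ideals of the completion given by seminorms\<close>

context normed_algebra
begin

lemma vectorspace_completion: "vectorspace class_ring (completion A p)"
  by (rule vectorspace_surj_image[OF vectorspace_seq_algebra cls_module_hom])
    (simp_all add: seq_algebra_simps completion_carrier completion_zero_one)

lemma cauchy_seqs_minus:
  assumes "u \<in> cauchy_seqs A p" "v \<in> cauchy_seqs A p"
  shows "(\<lambda>n. u n \<ominus> v n) \<in> cauchy_seqs A p"
    and "cls u \<ominus>\<^bsub>completion A p\<^esub> cls v = cls (\<lambda>n. u n \<ominus> v n)"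
proof -
  interpret C: vectorspace class_ring "completion A p" by (rule vectorspace_completion)
  have v: "\<ominus> v n = (-1) \<odot> v n" for n
    using smult_minus_1[of "v n"] cauchy_seqs_carrier[OF assms(2)] by (simp add: class_ring_simps)
  have "(\<lambda>n. (-1) \<odot> v n) \<in> cauchy_seqs A p" by (rule cauchy_seqs_smult[OF assms(2)])
  then show "(\<lambda>n. u n \<ominus> v n) \<in> cauchy_seqs A p"
    using cauchy_seqs_add[OF assms(1)] by (simp add: a_minus_def v)
  have "cls v \<in> carrier (completion A p)" using assms(2) by (simp add: completion_carrier)
  then have "\<ominus>\<^bsub>completion A p\<^esub> cls v = cls (\<lambda>n. (-1) \<odot> v n)"
    using C.smult_minus_1[of "cls v"] completion_smult[OF assms(2), of "-1"] by (simp add: class_ring_simps)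
  then show "cls u \<ominus>\<^bsub>completion A p\<^esub> cls v = cls (\<lambda>n. u n \<ominus> v n)"
    using assms by (simp add: a_minus_def v completion_add cauchy_seqs_smult)
qed

end

text \<open>Domination by \<open>p\<close> makes \<open>N\<close> Lipschitz, so that
  \<open>N (u n)\<close> converges along every Cauchy sequence and the limit depends only on its
  class. It is instantiated with the seminorm of a representation and with \<open>p\<close>
  itself.\<close>

locale dominated_seminorm = normed_algebra A p for A :: "('a, 'z) star_algebra_scheme" (structure) and p +
  fixes N :: "'a \<Rightarrow> real"
  assumes N_nonneg: "x \<in> carrier A \<Longrightarrow> 0 \<le> N x"
    and N_smult: "x \<in> carrier A \<Longrightarrow> N (c \<odot> x) = cmod c * N x"
    and N_add: "\<lbrakk>x \<in> carrier A; y \<in> carrier A\<rbrakk> \<Longrightarrow> N (x \<oplus> y) \<le> N x + N y"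
    and N_mult: "\<lbrakk>x \<in> carrier A; y \<in> carrier A\<rbrakk> \<Longrightarrow> N (x \<otimes> y) \<le> N x * N y"
    and N_le: "x \<in> carrier A \<Longrightarrow> N x \<le> p x"
begin

lemma N_diff_le:
  assumes "x \<in> carrier A" "y \<in> carrier A"
  shows "\<bar>N x - N y\<bar> \<le> N (x \<ominus> y)"
proof -
  have *: "N x \<le> N (x \<ominus> y) + N y" if "x \<in> carrier A" "y \<in> carrier A" for x y
    using N_add[of "x \<ominus> y" y] that by (simp add: a_minus_def a_assoc l_neg)
  have "y \<ominus> x = (-1) \<odot> (x \<ominus> y)"
    using assms smult_minus_1[of "x \<ominus> y"] by (simp add: a_minus_def minus_add a_comm class_ring_simps)
  then have "N (y \<ominus> x) = N (x \<ominus> y)" using N_smult[of "x \<ominus> y" "-1"] assms by simp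
  then show ?thesis using *[OF assms] *[OF assms(2,1)] by linarith
qed

lemma convergent_N:
  assumes u: "u \<in> cauchy_seqs A p"
  shows "convergent (\<lambda>n. N (u n))"
proof -
  have "Cauchy (\<lambda>n. N (u n))"
  proof (rule CauchyI)
    fix e :: real assume "0 < e"
    then obtain M where M: "\<forall>m\<ge>M. \<forall>n\<ge>M. p (u m \<ominus> u n) < e" using cauchy_seqsD[OF u] by blast
    have "norm (N (u m) - N (u n)) < e" if "m \<ge> M" "n \<ge> M" for m n
    proof -
      have "u m \<in> carrier A" "u n \<in> carrier A" using cauchy_seqs_carrier[OF u] by auto
      then have "norm (N (u m) - N (u n)) \<le> p (u m \<ominus> u n)"
        using N_diff_le[of "u m" "u n"] N_le[of "u m \<ominus> u n"] by simp
      then show ?thesis using M that by fastforce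
    qed
    then show "\<exists>M. \<forall>m\<ge>M. \<forall>n\<ge>M. norm (N (u m) - N (u n)) < e" by blast
  qed
  then show ?thesis by (rule Cauchy_convergent)
qed

lemma null_rel_N_limit:
  assumes uv: "(u, v) \<in> null_rel A p" and lim: "(\<lambda>n. N (u n)) \<longlonglongrightarrow> r"
  shows "(\<lambda>n. N (v n)) \<longlonglongrightarrow> r"
proof -
  have c: "u n \<in> carrier A" "v n \<in> carrier A" for n
    using uv cauchy_seqs_carrier by (auto simp: null_rel_iff)
  have "(\<lambda>n. \<bar>N (u n) - N (v n)\<bar>) \<longlonglongrightarrow> 0"
  proof (rule LIMSEQ_null_comparison)
    show "(\<lambda>n. p (u n \<ominus> v n)) \<longlonglongrightarrow> 0" using uv by (simp add: null_rel_iff)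
    show "\<bar>N (u n) - N (v n)\<bar> \<le> p (u n \<ominus> v n)" for n
      using N_diff_le[OF c[of n]] N_le[of "u n \<ominus> v n"] c[of n] by simp
  qed simp
  then have "(\<lambda>n. N (u n) - N (v n)) \<longlonglongrightarrow> 0" by (simp add: tendsto_rabs_zero_iff)
  from tendsto_diff[OF lim this] show ?thesis by simp
qed

end

section \<open>The norm of the completion\<close>

context normed_algebra
begin

text \<open>As an instance of domination, the norm of a class exists as a limit and is independent
  of the representative.\<close>

sublocale norm: dominated_seminorm A p p
  by unfold_locales (simp_all add: p_nonneg p_smult p_add p_mult)

lemma completion_norm_eqI:
  assumes u: "u \<in> cauchy_seqs A p" and lim: "(\<lambda>n. p (u n)) \<longlonglongrightarrow> r"
  shows "alg_norm (completion A p) (cls u) = r"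
proof -
  have "(THE r. \<forall>v\<in>cls u. (\<lambda>n. p (v n)) \<longlonglongrightarrow> r) = r"
  proof (rule the_equality)
    show "\<forall>v\<in>cls u. (\<lambda>n. p (v n)) \<longlonglongrightarrow> r"
      using norm.null_rel_N_limit[OF _ lim] by (simp add: mem_cls_iff)
    show "r' = r" if "\<forall>v\<in>cls u. (\<lambda>n. p (v n)) \<longlonglongrightarrow> r'" for r'
      using that cls_self[OF u] lim LIMSEQ_unique by blast
  qed
  then show ?thesis by (simp add: completion_def)
qed

lemma completion_norm_limit:
  assumes u: "u \<in> cauchy_seqs A p"
  shows "(\<lambda>n. p (u n)) \<longlonglongrightarrow> alg_norm (completion A p) (cls u)"
  using norm.convergent_N[OF u] completion_norm_eqI[OF u] by (auto simp: convergent_def)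

lemma normed_module_completion: "normed_module (completion A p) (alg_norm (completion A p))"
proof -
  interpret C: vectorspace class_ring "completion A p" by (rule vectorspace_completion)
  let ?n = "alg_norm (completion A p)"
  show ?thesis
  proof
    fix X assume "X \<in> carrier (completion A p)"
    then obtain u where u: "u \<in> cauchy_seqs A p" "X = cls u" by (auto simp: completion_carrier)
    note c = cauchy_seqs_carrier[OF u(1)]
    show "0 \<le> ?n X"
      unfolding u(2) by (rule LIMSEQ_le_const[OF completion_norm_limit[OF u(1)]]) (simp add: p_nonneg c)
    have "?n X = 0 \<longleftrightarrow> (\<lambda>n. p (u n)) \<longlonglongrightarrow> 0"
      unfolding u(2) using completion_norm_limit[OF u(1)] completion_norm_eqI[OF u(1)] by metis
    also have "\<dots> \<longleftrightarrow> (u, \<lambda>n. \<zero>) \<in> null_rel A p"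
      using u(1) c by (simp add: null_rel_iff cauchy_seqs_const a_minus_def)
    also have "\<dots> \<longleftrightarrow> X = \<zero>\<^bsub>completion A p\<^esub>"
      using u by (simp add: completion_zero_one cls_eq_iff cauchy_seqs_const)
    finally show "?n X = 0 \<longleftrightarrow> X = \<zero>\<^bsub>completion A p\<^esub>" .
    have "\<ominus>\<^bsub>completion A p\<^esub> X = cls (\<lambda>n. (-1) \<odot> u n)"
      using C.smult_minus_1[of X] completion_smult[OF u(1), of "-1"] u
      by (simp add: class_ring_simps completion_carrier)
    moreover have "(\<lambda>n. p ((-1) \<odot> u n)) \<longlonglongrightarrow> ?n X"
      using completion_norm_limit[OF u(1)] c u(2) by (simp add: p_smult)
    ultimately show "?n (\<ominus>\<^bsub>completion A p\<^esub> X) = ?n X"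
      using completion_norm_eqI[OF cauchy_seqs_smult[OF u(1)]] by simp
  next
    fix X Y assume "X \<in> carrier (completion A p)" "Y \<in> carrier (completion A p)"
    then obtain u v where u: "u \<in> cauchy_seqs A p" "X = cls u" and v: "v \<in> cauchy_seqs A p" "Y = cls v"
      by (auto simp: completion_carrier)
    have lim: "(\<lambda>n. p (u n \<oplus> v n)) \<longlonglongrightarrow> ?n (X \<oplus>\<^bsub>completion A p\<^esub> Y)"
      using completion_norm_limit[OF cauchy_seqs_add[OF u(1) v(1)]] u v by (simp add: completion_add)
    have lim': "(\<lambda>n. p (u n) + p (v n)) \<longlonglongrightarrow> ?n X + ?n Y"
      using completion_norm_limit[OF u(1)] completion_norm_limit[OF v(1)] u(2) v(2) by (simp add: tendsto_add)
    have "p (u n \<oplus> v n) \<le> p (u n) + p (v n)" for n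
      using u v cauchy_seqs_carrier by (intro p_add)
    then show "?n (X \<oplus>\<^bsub>completion A p\<^esub> Y) \<le> ?n X + ?n Y" using LIMSEQ_le[OF lim lim'] by blast
  qed
qed

lemma norm_dist_completion:
  assumes "u \<in> cauchy_seqs A p" "v \<in> cauchy_seqs A p"
  shows "(\<lambda>n. p (u n \<ominus> v n)) \<longlonglongrightarrow>
    norm_dist (completion A p) (alg_norm (completion A p)) (cls u) (cls v)"
  using completion_norm_limit[OF cauchy_seqs_minus(1)[OF assms]] assms
  by (simp add: norm_dist_def completion_carrier cauchy_seqs_minus)

end

section \<open>The closed ideal of a dominated seminorm\<close>

context dominated_seminorm
begin

text \<open>The kernel of the continuous extension of \<open>N\<close> to the completion.\<close>

definition null_ideal :: "(nat \<Rightarrow> 'a) set set" where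
  "null_ideal = cls ` {u \<in> cauchy_seqs A p. (\<lambda>n. N (u n)) \<longlonglongrightarrow> 0}"

lemma cls_mem_null_ideal_iff:
  "u \<in> cauchy_seqs A p \<Longrightarrow> cls u \<in> null_ideal \<longleftrightarrow> (\<lambda>n. N (u n)) \<longlonglongrightarrow> 0"
proof
  assume u: "u \<in> cauchy_seqs A p" and "cls u \<in> null_ideal"
  then obtain v where v: "v \<in> cauchy_seqs A p" "(\<lambda>n. N (v n)) \<longlonglongrightarrow> 0" "cls v = cls u"
    by (auto simp: null_ideal_def)
  then have "(v, u) \<in> null_rel A p" using u cls_eq_iff by blast
  then show "(\<lambda>n. N (u n)) \<longlonglongrightarrow> 0" using v(2) by (rule null_rel_N_limit)
qed (auto simp: null_ideal_def)

lemma N_bounded: "u \<in> cauchy_seqs A p \<Longrightarrow> \<exists>K>0. \<forall>n. N (u n) \<le> K"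
  using cauchy_seqs_bounded N_le cauchy_seqs_carrier by (meson order_trans)

lemma null_ideal_cases:
  assumes "X \<in> null_ideal"
  obtains u where "u \<in> cauchy_seqs A p" "X = cls u" "(\<lambda>n. N (u n)) \<longlonglongrightarrow> 0"
  using assms by (auto simp: null_ideal_def)

lemma null_ideal_smult:
  assumes "X \<in> null_ideal"
  shows "c \<odot>\<^bsub>completion A p\<^esub> X \<in> null_ideal"
proof -
  obtain u where u: "u \<in> cauchy_seqs A p" "X = cls u" "(\<lambda>n. N (u n)) \<longlonglongrightarrow> 0"
    using assms by (rule null_ideal_cases)
  have "(\<lambda>n. cmod c * N (u n)) \<longlonglongrightarrow> cmod c * 0" by (intro tendsto_intros u)
  then show ?thesis using u cauchy_seqs_carrier[OF u(1)]
    by (simp add: completion_smult cls_mem_null_ideal_iff cauchy_seqs_smult N_smult)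
qed

text \<open>Absorption holds because \<open>N\<close> is submultiplicative and bounded along Cauchy
  sequences: a null sequence times a bounded one is null, on either side.\<close>

lemma ideal_null_ideal: "ideal null_ideal (completion A p)"
proof (rule idealI)
  interpret C: vectorspace class_ring "completion A p" by (rule vectorspace_completion)
  show "ring (completion A p)" by (rule ring_completion)
  have sub: "null_ideal \<subseteq> carrier (completion A p)" by (auto simp: null_ideal_def completion_carrier)
  show "subgroup null_ideal (add_monoid (completion A p))"
  proof (rule subgroup.intro)
    show "null_ideal \<subseteq> carrier (add_monoid (completion A p))" using sub by simp
  next
    fix X Y assume "X \<in> null_ideal" "Y \<in> null_ideal"
    then obtain u v where u: "u \<in> cauchy_seqs A p" "X = cls u" "(\<lambda>n. N (u n)) \<longlonglongrightarrow> 0"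
      and v: "v \<in> cauchy_seqs A p" "Y = cls v" "(\<lambda>n. N (v n)) \<longlonglongrightarrow> 0"
      by (auto simp: null_ideal_def)
    have "(\<lambda>n. N (u n) + N (v n)) \<longlonglongrightarrow> 0" using tendsto_add[OF u(3) v(3)] by simp
    then have "(\<lambda>n. N (u n \<oplus> v n)) \<longlonglongrightarrow> 0"
    proof (rule LIMSEQ_null_comparison)
      fix n
      have "u n \<in> carrier A" "v n \<in> carrier A" using u v cauchy_seqs_carrier by auto
      then show "N (u n \<oplus> v n) \<le> N (u n) + N (v n)" "0 \<le> N (u n \<oplus> v n)"
        by (simp_all add: N_add N_nonneg)
    qed
    then show "X \<otimes>\<^bsub>add_monoid (completion A p)\<^esub> Y \<in> null_ideal"
      using u v by (simp add: completion_add cls_mem_null_ideal_iff cauchy_seqs_add)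
  next
    have "N \<zero> = 0" using N_smult[of \<zero> 0] smult_r_null[of 0] by simp
    then show "\<one>\<^bsub>add_monoid (completion A p)\<^esub> \<in> null_ideal"
      by (simp add: completion_zero_one cls_mem_null_ideal_iff cauchy_seqs_const)
  next
    fix X assume X: "X \<in> null_ideal"
    then have "\<ominus>\<^bsub>completion A p\<^esub> X \<in> null_ideal"
      using null_ideal_smult[OF X, of "-1"] C.smult_minus_1[of X] sub by (auto simp: class_ring_simps)
    then show "inv\<^bsub>add_monoid (completion A p)\<^esub> X \<in> null_ideal" by (simp add: a_inv_def)
  qed
  fix X Y assume "X \<in> null_ideal" "Y \<in> carrier (completion A p)"
  then obtain u v where u: "u \<in> cauchy_seqs A p" "X = cls u" "(\<lambda>n. N (u n)) \<longlonglongrightarrow> 0"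
    and v: "v \<in> cauchy_seqs A p" "Y = cls v"
    by (auto simp: null_ideal_def completion_carrier)
  note c = cauchy_seqs_carrier[OF u(1)] cauchy_seqs_carrier[OF v(1)]
  obtain K where K: "\<And>n. N (v n) \<le> K" using N_bounded[OF v(1)] by blast
  have lim: "(\<lambda>n. K * N (u n)) \<longlonglongrightarrow> 0" using tendsto_mult_right_zero[OF u(3)] by simp
  have le: "N (v n) * N (u n) \<le> K * N (u n)" for n
    using K c by (intro mult_right_mono) (simp_all add: N_nonneg)
  have bound: "N (v n \<otimes> u n) \<le> K * N (u n)" "N (u n \<otimes> v n) \<le> K * N (u n)" for n
    using N_mult[of "v n" "u n"] N_mult[of "u n" "v n"] le[of n] c by (simp_all add: mult.commute)
  have "(\<lambda>n. N (v n \<otimes> u n)) \<longlonglongrightarrow> 0"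
    by (rule LIMSEQ_null_comparison[OF lim]) (simp_all add: bound N_nonneg c)
  moreover have "(\<lambda>n. N (u n \<otimes> v n)) \<longlonglongrightarrow> 0"
    by (rule LIMSEQ_null_comparison[OF lim]) (simp_all add: bound N_nonneg c)
  ultimately show "Y \<otimes>\<^bsub>completion A p\<^esub> X \<in> null_ideal" "X \<otimes>\<^bsub>completion A p\<^esub> Y \<in> null_ideal"
    using u v by (simp_all add: completion_mult cls_mem_null_ideal_iff cauchy_seqs_mult)
qed

text \<open>If \<open>N\<close> tends to \<open>r > 0\<close> along a representative of
  \<open>X\<close>, the ball of radius \<open>r\<close> about \<open>X\<close> misses the ideal: the
  extension of \<open>N\<close> is 1-Lipschitz and vanishes on the ideal.\<close>

lemma closedin_null_ideal: "closedin (norm_topology (completion A p)) null_ideal"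
proof -
  let ?C = "completion A p"
  interpret C: normed_module ?C "alg_norm ?C" by (rule normed_module_completion)
  interpret M: Metric_space "carrier ?C" "norm_dist ?C (alg_norm ?C)" by (rule C.Metric_space_norm_dist)
  have "openin M.mtopology (carrier ?C - null_ideal)"
    unfolding M.openin_mtopology
  proof (intro conjI allI impI)
    fix X assume X: "X \<in> carrier ?C - null_ideal"
    then obtain u where u: "u \<in> cauchy_seqs A p" "X = cls u" by (auto simp: completion_carrier)
    obtain r where r: "(\<lambda>n. N (u n)) \<longlonglongrightarrow> r" using convergent_N[OF u(1)] by (auto simp: convergent_def)
    have "r \<noteq> 0" using X u r cls_mem_null_ideal_iff by blast
    moreover have "0 \<le> r"
      by (rule LIMSEQ_le_const[OF r]) (simp add: N_nonneg cauchy_seqs_carrier[OF u(1)])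
    ultimately have "0 < r" by simp
    moreover have "M.mball X r \<subseteq> carrier ?C - null_ideal"
    proof
      fix Y assume Y: "Y \<in> M.mball X r"
      have "Y \<notin> null_ideal"
      proof
        assume "Y \<in> null_ideal"
        then obtain v where v: "v \<in> cauchy_seqs A p" "Y = cls v" "(\<lambda>n. N (v n)) \<longlonglongrightarrow> 0"
          by (rule null_ideal_cases)
        have lim: "(\<lambda>n. N (u n) - N (v n)) \<longlonglongrightarrow> r" using tendsto_diff[OF r v(3)] by simp
        have "N (u n) - N (v n) \<le> p (u n \<ominus> v n)" for n
        proof -
          have "u n \<in> carrier A" "v n \<in> carrier A" using u v cauchy_seqs_carrier by auto
          then show ?thesis using N_diff_le[of "u n" "v n"] N_le[of "u n \<ominus> v n"] by simp
        qed
        then have "r \<le> norm_dist ?C (alg_norm ?C) X Y"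
          unfolding u(2) v(2) using LIMSEQ_le[OF lim norm_dist_completion[OF u(1) v(1)]] by blast
        then show False using Y by simp
      qed
      then show "Y \<in> carrier ?C - null_ideal" using Y by simp
    qed
    ultimately show "\<exists>r>0. M.mball X r \<subseteq> carrier ?C - null_ideal" by blast
  qed simp
  moreover have "null_ideal \<subseteq> carrier ?C" by (auto simp: null_ideal_def completion_carrier)
  ultimately show ?thesis by (simp add: norm_topology_def closedin_def)
qed

end

text \<open>Scalar multiplication in the quotient is a union over representatives; closure of
  \<open>I\<close> under scalars collapses it to one coset.\<close>

lemma quotient_algebra_hom:
  assumes "vectorspace class_ring A" "ideal I A" "\<And>c x. x \<in> I \<Longrightarrow> c \<odot>\<^bsub>A\<^esub> x \<in> I"
  shows "(+>\<^bsub>A\<^esub>) I \<in> module_hom class_ring A (quotient_algebra A I)"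
    and "(+>\<^bsub>A\<^esub>) I ` carrier A = carrier (quotient_algebra A I)"
    and "I +>\<^bsub>A\<^esub> \<zero>\<^bsub>A\<^esub> = \<zero>\<^bsub>quotient_algebra A I\<^esub>"
proof -
  interpret A: vectorspace class_ring A by fact
  interpret I: ideal I A by fact
  have smult: "(\<Union>y\<in>I +>\<^bsub>A\<^esub> x. I +>\<^bsub>A\<^esub> (c \<odot>\<^bsub>A\<^esub> y)) = I +>\<^bsub>A\<^esub> (c \<odot>\<^bsub>A\<^esub> x)" if x: "x \<in> carrier A" for c x
  proof -
    have "I +>\<^bsub>A\<^esub> (c \<odot>\<^bsub>A\<^esub> y) = I +>\<^bsub>A\<^esub> (c \<odot>\<^bsub>A\<^esub> x)" if "y \<in> I +>\<^bsub>A\<^esub> x" for y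
    proof -
      obtain i where i: "i \<in> I" "y = i \<oplus>\<^bsub>A\<^esub> x" using \<open>y \<in> I +>\<^bsub>A\<^esub> x\<close> by (auto simp: a_r_coset_def')
      then have "c \<odot>\<^bsub>A\<^esub> y = c \<odot>\<^bsub>A\<^esub> i \<oplus>\<^bsub>A\<^esub> c \<odot>\<^bsub>A\<^esub> x"
        using x I.a_subset by (auto simp: A.smult_r_distr)
      then have "c \<odot>\<^bsub>A\<^esub> y \<in> I +>\<^bsub>A\<^esub> (c \<odot>\<^bsub>A\<^esub> x)" using assms(3)[OF i(1)] by (auto simp: a_r_coset_def')
      then show ?thesis
        by (rule A.M.a_repr_independence[OF _ _ I.a_subgroup, symmetric]) (use x in simp)
    qed
    moreover have "I +>\<^bsub>A\<^esub> x \<noteq> {}" using I.a_rcos_self[OF x] by blast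
    ultimately show ?thesis by simp
  qed
  show "(+>\<^bsub>A\<^esub>) I \<in> module_hom class_ring A (quotient_algebra A I)"
    by (auto simp: module_hom_def quotient_algebra_def FactRing_def I.a_rcos_sum smult
        intro!: A.M.a_rcosetsI I.a_subset)
  show "(+>\<^bsub>A\<^esub>) I ` carrier A = carrier (quotient_algebra A I)"
    by (auto simp: quotient_algebra_def FactRing_def A_RCOSETS_def')
  show "I +>\<^bsub>A\<^esub> \<zero>\<^bsub>A\<^esub> = \<zero>\<^bsub>quotient_algebra A I\<^esub>"
    by (simp add: quotient_algebra_def FactRing_def I.a_rcos_const[OF I.zero_closed])
qed

subsection \<open>The maximal C*-norm\<close>

context group
begin

lemma delta_mult:
  assumes "g \<in> carrier G" "h \<in> carrier G"
  shows "delta g \<otimes>\<^bsub>group_algebra G\<^esub> delta h = delta (g \<otimes> h)"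
proof -
  interpret L: set_action G "carrier G" "mult G" by (rule group_set_action) (rule is_group)
  show ?thesis
    using L.perm_rep_delta[OF assms] L.delta_ell2[OF assms(2)]
    by (simp add: group_algebra_mult[OF is_group] L.perm_rep_def)
qed

lemma star_delta: "g \<in> carrier G \<Longrightarrow> star (group_algebra G) (delta g) = delta (inv g)"
  by (rule ext) (auto simp: group_algebra_simps delta_def)

text \<open>Since \<open>delta g\<close> is unitary, the C*-identity gives
  \<open>p (delta \<one>) = (p (delta g))^2\<close>. The case of the unit leaves only 0 and 1 for
  \<open>p (delta \<one>)\<close>, and definiteness excludes 0.\<close>

lemma cstar_norm_delta:
  assumes p: "cstar_norm (group_algebra G) p" and g: "g \<in> carrier G"
  shows "p (delta g) = 1"
proof -
  have sq: "p (delta \<one>) = (p (delta g))\<^sup>2" if "g \<in> carrier G" for g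
    using p delta_closed[OF that] delta_mult[of "inv g" g] star_delta[OF that] that
    by (auto simp: cstar_norm_def dest!: bspec[where x = "delta g"])
  have one: "delta \<one> \<in> carrier (group_algebra G)" by (simp add: delta_closed)
  have "delta \<one> \<noteq> \<zero>\<^bsub>group_algebra G\<^esub>" by (auto simp: group_algebra_simps delta_def fun_eq_iff)
  then have "p (delta \<one>) \<noteq> 0" using p one by (simp add: cstar_norm_def)
  then have "p (delta \<one>) = 1" using sq[OF one_closed] by (simp add: power2_eq_square)
  moreover have "0 \<le> p (delta g)" using p delta_closed[OF g] by (simp add: cstar_norm_def)
  ultimately show ?thesis using sq[OF g] by (simp add: power2_eq_1_iff)
qed

text \<open>Support points are removed one at a time. The condition \<open>f g = 0\<close> in the
  step excludes cancellation, as needed for an estimate by the sum of absolute values.\<close>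

lemma group_algebra_add_delta_induct [consumes 1, case_names zero add]:
  assumes "f \<in> carrier (group_algebra G)"
    and "P (\<lambda>x. 0)"
    and step: "\<And>f g c. \<lbrakk>f \<in> carrier (group_algebra G); g \<in> carrier G; f g = 0; P f\<rbrakk>
      \<Longrightarrow> P (\<lambda>x. f x + c * delta g x)"
  shows "P f"
proof -
  have "\<forall>f. (\<forall>x. f x \<noteq> 0 \<longrightarrow> x \<in> F) \<longrightarrow> P f" if "finite F" "F \<subseteq> carrier G" for F
    using that
  proof (induction rule: finite_induct)
    case empty
    have "f = (\<lambda>x. 0)" if "\<forall>x. f x \<noteq> 0 \<longrightarrow> x \<in> {}" for f :: "'a \<Rightarrow> complex" using that by auto
    then show ?case using assms(2) by blast
  next
    case (insert g F)
    show ?case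
    proof (intro allI impI)
      fix f :: "'a \<Rightarrow> complex" assume f: "\<forall>x. f x \<noteq> 0 \<longrightarrow> x \<in> insert g F"
      let ?f = "f(g := 0)"
      have supp: "\<forall>x. ?f x \<noteq> 0 \<longrightarrow> x \<in> F" using f by auto
      have fc: "?f \<in> carrier (group_algebra G)"
        by (rule group_algebra_memI[of F]) (use insert supp in auto)
      have Pf: "P ?f" using insert supp by blast
      have "P (\<lambda>x. ?f x + f g * delta g x)"
        by (rule step[OF fc _ _ Pf]) (use insert.prems in auto)
      also have "(\<lambda>x. ?f x + f g * delta g x) = f" by (auto simp: delta_def)
      finally show "P f" .
    qed
  qed
  from this[OF group_algebra_memD(1,2)[OF assms(1)]] show ?thesis by simp
qed

text \<open>The triangle inequality, each group element having norm 1. \<open>F\<close> may exceed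
  the support, so that the induction can pass to \<open>F - {g}\<close> and, for a finite group, the
  whole group can serve as index set.\<close>

lemma cstar_norm_le_sum:
  assumes p: "cstar_norm (group_algebra G) p" and "f \<in> carrier (group_algebra G)"
    and "finite F" "\<And>x. f x \<noteq> 0 \<Longrightarrow> x \<in> F"
  shows "p f \<le> (\<Sum>x\<in>F. cmod (f x))"
  using assms(2-)
proof (induction arbitrary: F rule: group_algebra_add_delta_induct)
  case zero
  have "\<forall>x\<in>carrier (group_algebra G). p x = 0 \<longleftrightarrow> x = (\<lambda>x. 0)"
    using p by (simp add: cstar_norm_def group_algebra_simps(3))
  moreover have "(\<lambda>x. 0) \<in> carrier (group_algebra G)" by (rule group_algebra_memI[of "{}"]) auto
  ultimately have "p (\<lambda>x. 0) = 0" by blast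
  then show ?case by simp
next
  case (add f g c)
  have d: "delta g \<in> carrier (group_algebra G)" by (rule delta_closed[OF add.hyps(2)])
  have "p (\<lambda>x. f x + c * delta g x) \<le> p f + p (\<lambda>x. c * delta g x)"
    using p add.hyps(1) group_algebra_smult_closed[OF d]
    by (simp add: cstar_norm_def group_algebra_simps(4))
  also have "p (\<lambda>x. c * delta g x) = cmod c * p (delta g)"
    using p d by (simp add: cstar_norm_def group_algebra_simps(5))
  also have "\<dots> = cmod c" using cstar_norm_delta[OF p add.hyps(2)] by simp
  also have "p f \<le> (\<Sum>x\<in>F - {g}. cmod (f x))"
  proof (rule add.IH)
    show "x \<in> F - {g}" if "f x \<noteq> 0" for x
    proof -
      have "x \<noteq> g" using that add.hyps(3) by blast
      then show ?thesis using that add.prems(2)[of x] by (simp add: delta_def)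
    qed
  qed (use add.prems in simp)
  also have "(\<Sum>x\<in>F - {g}. cmod (f x)) = (\<Sum>x\<in>F - {g}. cmod (f x + c * delta g x))"
    by (rule sum.cong) (auto simp: delta_def)
  also have "\<dots> + cmod c = (\<Sum>x\<in>F. cmod (f x + c * delta g x))"
  proof (cases "g \<in> F")
    case True
    then show ?thesis using add.prems(1) add.hyps(3) by (simp add: sum.remove delta_def)
  next
    case False
    \<comment> \<open>The function vanishes outside \<open>F\<close>, and its value at
      \<open>g\<close> is \<open>c\<close>.\<close>
    then have "c = 0" using add.prems(2)[of g] add.hyps(3) by (auto simp: delta_def)
    then show ?thesis using False by simp
  qed
  finally show ?case by simp
qed

lemma max_cstar_norm_upper:
  assumes p: "cstar_norm (group_algebra G) p" and f: "f \<in> carrier (group_algebra G)"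
  shows "p f \<le> max_cstar_norm (group_algebra G) f"
  unfolding max_cstar_norm_def
proof (rule cSUP_upper)
  show "bdd_above ((\<lambda>p. p f) ` {p. cstar_norm (group_algebra G) p})"
    using cstar_norm_le_sum[OF _ f group_algebra_memD(1)[OF f]]
    by (intro bdd_aboveI2[where M = "\<Sum>x | f x \<noteq> 0. cmod (f x)"]) simp
qed (use p in simp)

lemma max_cstar_norm_least:
  assumes "\<And>p. cstar_norm (group_algebra G) p \<Longrightarrow> p f \<le> K"
  shows "max_cstar_norm (group_algebra G) f \<le> K"
  unfolding max_cstar_norm_def
proof (rule cSUP_least)
  show "{p. cstar_norm (group_algebra G) p} \<noteq> {}" using cstar_norm_exists by blast
qed (use assms in simp)

lemma cmod_le_max_cstar_norm:
  assumes f: "f \<in> carrier (group_algebra G)"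
  shows "cmod (f g) \<le> max_cstar_norm (group_algebra G) f"
proof -
  obtain p where p: "cstar_norm (group_algebra G) p" "cmod (f g) \<le> p f"
    using cstar_norm_exists f by blast
  show ?thesis by (rule order_trans[OF p(2) max_cstar_norm_upper[OF p(1) f]])
qed

lemma max_cstar_norm_le_sum:
  assumes "f \<in> carrier (group_algebra G)" "finite F" "\<And>x. f x \<noteq> 0 \<Longrightarrow> x \<in> F"
  shows "max_cstar_norm (group_algebra G) f \<le> (\<Sum>x\<in>F. cmod (f x))"
  by (intro max_cstar_norm_least cstar_norm_le_sum assms)

lemma normed_algebra_group_algebra: "normed_algebra (group_algebra G) (max_cstar_norm (group_algebra G))"
proof -
  interpret A: vectorspace class_ring "group_algebra G" by (rule vectorspace_group_algebra)
  interpret R: ring "group_algebra G" by (rule ring_group_algebra)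
  let ?A = "group_algebra G" and ?P = "max_cstar_norm (group_algebra G)"
  note up = max_cstar_norm_upper
  have nonneg: "0 \<le> ?P f" if "f \<in> carrier ?A" for f
    using cmod_le_max_cstar_norm[OF that, of \<one>] norm_ge_zero[of "f \<one>"] by linarith
  have smult_le: "?P (c \<odot>\<^bsub>?A\<^esub> f) \<le> cmod c * ?P f" if f: "f \<in> carrier ?A" for c f
  proof (rule max_cstar_norm_least)
    fix p assume p: "cstar_norm ?A p"
    then have "p (c \<odot>\<^bsub>?A\<^esub> f) = cmod c * p f" using f by (simp add: cstar_norm_def)
    also have "\<dots> \<le> cmod c * ?P f" using up[OF p f] by (simp add: mult_left_mono)
    finally show "p (c \<odot>\<^bsub>?A\<^esub> f) \<le> cmod c * ?P f" .
  qed
  show ?thesis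
  proof
    fix f assume f: "f \<in> carrier ?A"
    show "0 \<le> ?P f" by (rule nonneg[OF f])
    show "?P f = 0 \<longleftrightarrow> f = \<zero>\<^bsub>?A\<^esub>"
    proof
      assume "?P f = 0"
      then show "f = \<zero>\<^bsub>?A\<^esub>" using cmod_le_max_cstar_norm[OF f] by (auto simp: group_algebra_simps)
    next
      assume "f = \<zero>\<^bsub>?A\<^esub>"
      then show "?P f = 0" using max_cstar_norm_le_sum[OF f, of "{}"] nonneg[OF f]
        by (simp add: group_algebra_simps)
    qed
    show "?P (c \<odot>\<^bsub>?A\<^esub> f) = cmod c * ?P f" for c
    proof (cases "c = 0")
      case True
      then show ?thesis using smult_le[OF f, of c] nonneg[of "c \<odot>\<^bsub>?A\<^esub> f"] f by simp
    next
      case False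
      \<comment> \<open>Homogeneity is recovered from \<open>smult_le\<close> for the inverse
        scalar, without scaling the supremum.\<close>
      have "?P f = ?P (inverse c \<odot>\<^bsub>?A\<^esub> (c \<odot>\<^bsub>?A\<^esub> f))"
        using f False A.smult_assoc1[of "inverse c" c f] A.smult_one[of f] by simp
      also have "\<dots> \<le> cmod (inverse c) * ?P (c \<odot>\<^bsub>?A\<^esub> f)" using f by (intro smult_le) simp
      also have "\<dots> = ?P (c \<odot>\<^bsub>?A\<^esub> f) / cmod c" by (simp add: norm_inverse divide_inverse)
      finally have "cmod c * ?P f \<le> ?P (c \<odot>\<^bsub>?A\<^esub> f)" using False by (simp add: field_simps)
      then show ?thesis using smult_le[OF f, of c] by simp
    qed
    fix h assume h: "h \<in> carrier ?A"
    show "?P (f \<oplus>\<^bsub>?A\<^esub> h) \<le> ?P f + ?P h"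
    proof (rule max_cstar_norm_least)
      fix p assume p: "cstar_norm ?A p"
      then have "p (f \<oplus>\<^bsub>?A\<^esub> h) \<le> p f + p h" using f h by (simp add: cstar_norm_def)
      then show "p (f \<oplus>\<^bsub>?A\<^esub> h) \<le> ?P f + ?P h" using up[OF p f] up[OF p h] by linarith
    qed
    show "?P (f \<otimes>\<^bsub>?A\<^esub> h) \<le> ?P f * ?P h"
    proof (rule max_cstar_norm_least)
      fix p assume p: "cstar_norm ?A p"
      then have "p (f \<otimes>\<^bsub>?A\<^esub> h) \<le> p f * p h" "0 \<le> p f" "0 \<le> p h" using f h by (simp_all add: cstar_norm_def)
      moreover have "p f * p h \<le> ?P f * ?P h"
        using up[OF p f] up[OF p h] calculation nonneg[OF f] by (intro mult_mono)
      ultimately show "p (f \<otimes>\<^bsub>?A\<^esub> h) \<le> ?P f * ?P h" by linarith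
    qed
  qed
qed

lemma cstar_seminorm_le_max:
  assumes N: "cstar_seminorm (group_algebra G) N" and f: "f \<in> carrier (group_algebra G)"
  shows "N f \<le> max_cstar_norm (group_algebra G) f"
proof -
  interpret A: vectorspace class_ring "group_algebra G" by (rule vectorspace_group_algebra)
  interpret L: set_action G "carrier G" "mult G" by (rule group_set_action) (rule is_group)
  obtain p where p: "cstar_norm (group_algebra G) p" using cstar_norm_exists by blast
  \<comment> \<open>Homogeneity at the scalar 0 gives the value 0 of \<open>N\<close> at zero, so
    that the maximum with \<open>p\<close> still vanishes there; elsewhere \<open>p\<close> makes it
    positive.\<close>
  have "\<forall>c. \<forall>x\<in>carrier (group_algebra G). N (c \<odot>\<^bsub>group_algebra G\<^esub> x) = cmod c * N x"
    using N by (simp add: cstar_seminorm_def)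
  from bspec[OF spec[OF this, of 0], of "\<zero>\<^bsub>group_algebra G\<^esub>"] have N0: "N \<zero>\<^bsub>group_algebra G\<^esub> = 0" using A.smult_r_null[of 0] by simp
  have "cstar_norm (group_algebra G) (\<lambda>x. max (p x) (N x))"
    unfolding cstar_norm_iff_seminorm
  proof (intro conjI ballI)
    show "cstar_seminorm (group_algebra G) (\<lambda>x. max (p x) (N x))"
      using p N group_algebra_star_closed by (intro cstar_seminorm_max) (auto simp: cstar_norm_iff_seminorm)
    fix x assume x: "x \<in> carrier (group_algebra G)"
    then have "0 \<le> p x" "p x = 0 \<longleftrightarrow> x = \<zero>\<^bsub>group_algebra G\<^esub>" using p by (simp_all add: cstar_norm_def)
    then show "max (p x) (N x) = 0 \<longleftrightarrow> x = \<zero>\<^bsub>group_algebra G\<^esub>"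
      using N0 by (auto simp: max_def split: if_splits)
  qed
  from max_cstar_norm_upper[OF this f] show ?thesis by simp
qed

text \<open>The functions \<open>delta g\<close> form a basis, with evaluation at \<open>g\<close>
  as coordinate functionals.\<close>

lemma fin_dim_group_algebra_iff: "finite_dimensional (group_algebra G) \<longleftrightarrow> finite (carrier G)"
proof
  interpret A: vectorspace class_ring "group_algebra G" by (rule vectorspace_group_algebra)
  show "finite (carrier G)" if "finite_dimensional (group_algebra G)"
  proof (rule ccontr)
    assume "infinite (carrier G)"
    then have "\<not> finite_dimensional (group_algebra G)"
      by (rule infinite_dim_if_biorthogonal[OF vectorspace_group_algebra,
            where e = delta and \<phi> = "\<lambda>g f. f g"])
        (simp_all add: delta_closed group_algebra_simps(4,5), simp add: delta_def)
    then show False using that by blast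
  qed
  assume fin: "finite (carrier G)"
  have sub: "delta ` carrier G \<subseteq> carrier (group_algebra G)" by (auto simp: delta_closed)
  interpret S: submodule class_ring "A.span (delta ` carrier G)" "group_algebra G"
    by (rule A.span_is_submodule[OF sub])
  have "f \<in> A.span (delta ` carrier G)" if "f \<in> carrier (group_algebra G)" for f
    using that
  proof (induction rule: group_algebra_add_delta_induct)
    case zero
    then show ?case using S.zero_closed by (simp add: group_algebra_simps)
  next
    case (add f g c)
    have "delta g \<in> A.span (delta ` carrier G)" using A.in_own_span[OF sub] add.hyps(2) by blast
    from S.m_closed[OF add.IH S.smult_closed[OF _ this, of c]] show ?case
      by (simp add: group_algebra_simps)
  qed
  then have "A.span (delta ` carrier G) = carrier (group_algebra G)" using A.span_is_subset2[OF sub] by blast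
  then show "finite_dimensional (group_algebra G)"
    unfolding A.fin_dim_def using fin sub by (intro exI[of _ "delta ` carrier G"]) simp
qed

lemma group_algebra_minus:
  assumes "f \<in> carrier (group_algebra G)" "h \<in> carrier (group_algebra G)"
  shows "f \<ominus>\<^bsub>group_algebra G\<^esub> h = (\<lambda>x. f x - h x)"
proof -
  interpret A: vectorspace class_ring "group_algebra G" by (rule vectorspace_group_algebra)
  have "\<ominus>\<^bsub>group_algebra G\<^esub> h = (-1) \<odot>\<^bsub>group_algebra G\<^esub> h"
    using A.smult_minus_1[OF assms(2)] by (simp add: class_ring_simps)
  then show ?thesis by (simp add: a_minus_def group_algebra_simps)
qed

end

lemma (in normed_algebra) const_module_hom:
  "(\<lambda>x. cls (\<lambda>n. x)) \<in> module_hom class_ring A (completion A p)"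
  by (auto simp: module_hom_def completion_carrier completion_add completion_smult cauchy_seqs_const)

context group
begin

text \<open>For finite \<open>G\<close> the group algebra is already complete: coefficients converge
  since the norm dominates them, and the bound by the finite sum of their absolute values turns this
  into norm convergence. Hence constant sequences meet every class of the completion.\<close>

lemma fin_dim_full_group_cstar:
  assumes fin: "finite (carrier G)"
  shows "finite_dimensional (full_group_cstar G)"
proof -
  let ?P = "max_cstar_norm (group_algebra G)"
  interpret A: normed_algebra "group_algebra G" ?P by (rule normed_algebra_group_algebra)
  have lim: "\<exists>f \<in> carrier (group_algebra G). (u, \<lambda>n. f) \<in> null_rel (group_algebra G) ?P"
    if u: "u \<in> cauchy_seqs (group_algebra G) ?P" for u
  proof -
    note c = A.cauchy_seqs_carrier[OF u]
    have "convergent (\<lambda>n. u n x)" for x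
    proof -
      have "Cauchy (\<lambda>n. u n x)"
      proof (rule CauchyI)
        fix e :: real assume "0 < e"
        then obtain M where M: "\<forall>m\<ge>M. \<forall>n\<ge>M. ?P (u m \<ominus>\<^bsub>group_algebra G\<^esub> u n) < e"
          using A.cauchy_seqsD[OF u] by blast
        have "norm (u m x - u n x) \<le> ?P (u m \<ominus>\<^bsub>group_algebra G\<^esub> u n)" for m n
        proof -
          have "u m \<ominus>\<^bsub>group_algebra G\<^esub> u n \<in> carrier (group_algebra G)" using c by simp
          from cmod_le_max_cstar_norm[OF this, of x] show ?thesis by (simp add: group_algebra_minus c)
        qed
        then show "\<exists>M. \<forall>m\<ge>M. \<forall>n\<ge>M. norm (u m x - u n x) < e" using M by (meson order_le_less_trans)
      qed
      then show ?thesis by (rule Cauchy_convergent)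
    qed
    then obtain f where f: "(\<lambda>n. u n x) \<longlonglongrightarrow> f x" for x unfolding convergent_def by metis
    have supp: "x \<in> carrier G" if "f x \<noteq> 0" for x
    proof (rule ccontr)
      assume "x \<notin> carrier G"
      then have "u n x = 0" for n using group_algebra_memD(3)[OF c[of n], of x] by blast
      then show False using f[of x] that by (simp add: LIMSEQ_const_iff)
    qed
    then have fc: "f \<in> carrier (group_algebra G)" by (intro group_algebra_memI[OF fin]) auto
    have "(\<lambda>n. ?P (u n \<ominus>\<^bsub>group_algebra G\<^esub> f)) \<longlonglongrightarrow> 0"
    proof (rule LIMSEQ_null_comparison)
      have "(\<lambda>n. \<Sum>x\<in>carrier G. cmod (u n x - f x)) \<longlonglongrightarrow> (\<Sum>x\<in>carrier G. cmod (f x - f x))"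
        by (intro tendsto_intros f)
      then show "(\<lambda>n. \<Sum>x\<in>carrier G. cmod (u n x - f x)) \<longlonglongrightarrow> 0" by simp
      fix n
      have m: "u n \<ominus>\<^bsub>group_algebra G\<^esub> f \<in> carrier (group_algebra G)"
        using c fc by simp
      then show "0 \<le> ?P (u n \<ominus>\<^bsub>group_algebra G\<^esub> f)" by (rule A.p_nonneg)
      show "?P (u n \<ominus>\<^bsub>group_algebra G\<^esub> f) \<le> (\<Sum>x\<in>carrier G. cmod (u n x - f x))"
        using max_cstar_norm_le_sum[OF m fin group_algebra_memD(3)[OF m]] c fc
        by (simp add: group_algebra_minus)
    qed
    then show ?thesis using u fc by (intro bexI[of _ f]) (simp_all add: A.null_rel_iff A.cauchy_seqs_const)
  qed
  show ?thesis
    unfolding full_group_cstar_def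
  proof (rule fin_dim_surj_image[OF vectorspace_group_algebra A.const_module_hom])
    show "(\<lambda>x. A.cls (\<lambda>n. x)) ` carrier (group_algebra G) = carrier (completion (group_algebra G) ?P)"
      using A.cauchy_seqs_const lim A.cls_eqI unfolding A.completion_carrier by (fastforce simp: image_iff)
    show "A.cls (\<lambda>n. \<zero>\<^bsub>group_algebra G\<^esub>) = \<zero>\<^bsub>completion (group_algebra G) ?P\<^esub>"
      by (simp add: A.completion_zero_one)
    show "finite_dimensional (group_algebra G)" using fin by (simp add: fin_dim_group_algebra_iff)
  qed
qed

end

subsection \<open>Just-infiniteness\<close>

text \<open>Provides the vector space whose dimension is meant in \<open>star_just_infinite\<close>;
  its laws are inherited from \<open>A\<close>.\<close>

lemma vectorspace_representation_image:
  assumes "vectorspace class_ring A" "pre_hilbert_space H" "star_representation A H \<pi>"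
  defines "W \<equiv> (bounded_operators H)\<lparr>carrier := \<pi> ` carrier A\<rparr>"
  shows "vectorspace class_ring W" "\<pi> \<in> module_hom class_ring A W"
proof -
  show hom: "\<pi> \<in> module_hom class_ring A W"
    using assms(3) by (auto simp: star_representation_def module_hom_def W_def)
  show "vectorspace class_ring W"
    by (rule vectorspace_surj_image[OF assms(1) hom])
      (simp_all add: W_def star_representation_zero[OF assms(1-3)])
qed

context group
begin

text \<open>The dichotomy is proved by assuming an infinite dimensional image: then
  \<open>null_ideal\<close> must be zero, and this forces \<open>\<pi>\<close> to be
  injective.\<close>

theorem just_infinite_cstar_imp_star_just_infinite:
  assumes ji: "just_infinite_cstar (full_group_cstar G)"
  shows "star_just_infinite TYPE('h) (group_algebra G)"
  unfolding star_just_infinite_def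
proof (intro conjI allI impI)
  show "\<not> finite_dimensional (group_algebra G)"
    using ji fin_dim_full_group_cstar fin_dim_group_algebra_iff by (auto simp: just_infinite_cstar_def)
next
  fix H :: "'h inner_space" and \<pi>
  assume "complex_hilbert_space H \<and> star_representation (group_algebra G) H \<pi>"
  then have H: "pre_hilbert_space H" and \<pi>: "star_representation (group_algebra G) H \<pi>"
    by (auto intro: complex_hilbert_space.pre_hilbert_space)
  let ?A = "group_algebra G" and ?P = "max_cstar_norm (group_algebra G)"
  let ?W = "(bounded_operators H)\<lparr>carrier := \<pi> ` carrier ?A\<rparr>"
  define N where "N f = op_norm H (\<pi> f)" for f
  interpret H: pre_hilbert_space H by (rule H)
  interpret L: set_action G "carrier G" "mult G" by (rule group_set_action) (rule is_group)
  interpret R: ring ?A by (rule ring_group_algebra)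
  have semi: "cstar_seminorm ?A N"
    unfolding N_def
    by (rule cstar_seminorm_op_norm[OF vectorspace_group_algebra H \<pi>])
      (simp_all add: group_algebra_star_closed)
  interpret A: normed_algebra ?A ?P by (rule normed_algebra_group_algebra)
  interpret N: dominated_seminorm ?A ?P N
    by unfold_locales (use semi cstar_seminorm_le_max[OF semi] in \<open>auto simp: cstar_seminorm_def\<close>)
  let ?C = "completion ?A ?P" and ?I = N.null_ideal
  have const: "(\<lambda>n. f) \<in> cauchy_seqs ?A ?P" if "f \<in> carrier ?A" for f using that by (rule A.cauchy_seqs_const)
  \<comment> \<open>Along a constant sequence the limit of \<open>N\<close> is \<open>N f\<close>,
    which vanishes exactly when the operator does.\<close>
  have mem: "A.cls (\<lambda>n. f) \<in> ?I \<longleftrightarrow> \<pi> f = \<zero>\<^bsub>?W\<^esub>" if f: "f \<in> carrier ?A" for f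
    using N.cls_mem_null_ideal_iff[OF const[OF f]] H.op_norm_zero_iff[OF star_representationD(1)[OF \<pi> f]]
    by (simp add: LIMSEQ_const_iff N_def)
  note W = vectorspace_representation_image[OF vectorspace_group_algebra H \<pi>]
  interpret W: vectorspace class_ring ?W by (rule W(1))
  interpret \<pi>: mod_hom class_ring ?A ?W \<pi>
    by (intro mod_hom.intro mod_hom_axioms.intro A.module_axioms W.module_axioms W(2))
  show "inj_on \<pi> (carrier ?A) \<or> finite_dimensional ?W"
  proof (rule disjCI)
    assume nfd: "\<not> finite_dimensional ?W"
    have "?I = {\<zero>\<^bsub>?C\<^esub>}"
    proof (rule ccontr)
      assume "?I \<noteq> {\<zero>\<^bsub>?C\<^esub>}"
      then have fd: "finite_dimensional (quotient_algebra ?C ?I)"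
        using ji N.ideal_null_ideal N.closedin_null_ideal
        by (auto simp: just_infinite_cstar_def full_group_cstar_def)
      note q = quotient_algebra_hom[OF A.vectorspace_completion N.ideal_null_ideal N.null_ideal_smult]
      interpret I: ideal ?I ?C by (rule N.ideal_null_ideal)
      have "finite_dimensional ?W"
      \<comment> \<open>Both \<open>\<pi>\<close> and the map from the group algebra to the quotient
        of the completion start at the group algebra, and the kernel of the second lies in that of
        the first.\<close>
      proof (rule fin_dim_transfer[OF vectorspace_group_algebra W(1) _ W(2) _ _ _ fd])
        show "vectorspace class_ring (quotient_algebra ?C ?I)"
          by (rule vectorspace_surj_image[OF A.vectorspace_completion q])
        show "(\<lambda>f. ?I +>\<^bsub>?C\<^esub> A.cls (\<lambda>n. f)) \<in> module_hom class_ring ?A (quotient_algebra ?C ?I)"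
          using A.const_module_hom q(1) by (auto simp: module_hom_def Pi_iff)
        show "\<pi> f = \<zero>\<^bsub>?W\<^esub>"
          if "f \<in> carrier ?A" "?I +>\<^bsub>?C\<^esub> A.cls (\<lambda>n. f) = \<zero>\<^bsub>quotient_algebra ?C ?I\<^esub>" for f
        proof -
          \<comment> \<open>A coset contains its representative, and the zero of the quotient is the
            ideal itself.\<close>
          have "A.cls (\<lambda>n. f) \<in> ?I +>\<^bsub>?C\<^esub> A.cls (\<lambda>n. f)"
            using const[OF that(1)] by (intro I.a_rcos_self) (simp add: A.completion_carrier)
          then have "A.cls (\<lambda>n. f) \<in> ?I" using that(2) by (simp add: quotient_algebra_def FactRing_def)
          then show ?thesis using mem[OF that(1)] by simp
        qed
      qed simp
      then show False using nfd by blast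
    qed
    show "inj_on \<pi> (carrier ?A)"
    proof (rule inj_onI)
      fix f h assume fh: "f \<in> carrier ?A" "h \<in> carrier ?A" "\<pi> f = \<pi> h"
      let ?d = "f \<ominus>\<^bsub>?A\<^esub> h"
      have d: "?d \<in> carrier ?A" using fh by simp
      have "\<pi> ?d = \<pi> f \<ominus>\<^bsub>?W\<^esub> \<pi> h" using fh(1,2) by (rule \<pi>.f_minus)
      also have "\<dots> = \<zero>\<^bsub>?W\<^esub>"
        unfolding fh(3) a_minus_def by (rule W.M.r_neg[OF \<pi>.f_im[OF fh(2)]])
      \<comment> \<open>The ideal being zero, \<open>?d\<close> represents zero in the completion;
        definiteness of the maximal norm then gives \<open>?d = 0\<close>.\<close>
      finally have "A.cls (\<lambda>n. ?d) = A.cls (\<lambda>n. \<zero>\<^bsub>?A\<^esub>)"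
        using mem[OF d] \<open>?I = {\<zero>\<^bsub>?C\<^esub>}\<close> by (simp add: A.completion_zero_one)
      then have "(\<lambda>n. ?d, \<lambda>n. \<zero>\<^bsub>?A\<^esub>) \<in> null_rel ?A ?P"
        using A.cls_eq_iff[OF const[OF d] const] by simp
      then have "?d = \<zero>\<^bsub>?A\<^esub>" using d by (simp add: A.null_rel_iff LIMSEQ_const_iff A.p_zero_iff a_minus_def)
      then show "f = h" using A.minus_eq_zero_iff[OF fh(1,2)] by simp
    qed
  qed
qed

text \<open>A nontrivial normal subgroup of infinite index yields a representation violating the
  dichotomy: the subgroup acts trivially, while translates of one basis vector show that the image
  is infinite dimensional.\<close>

theorem star_just_infinite_imp_just_infinite_group:
  assumes sji: "star_just_infinite TYPE('a \<Rightarrow> complex) (group_algebra G)"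
  shows "just_infinite_group G"
  unfolding just_infinite_group_def
proof (intro conjI allI impI)
  show "infinite (carrier G)"
    using sji by (simp add: star_just_infinite_def fin_dim_group_algebra_iff)
next
  fix M assume M: "M \<lhd> G \<and> M \<noteq> {\<one>}"
  then interpret M: normal M G by simp
  show "finite (carrier (G Mod M))"
  proof (rule ccontr)
    assume inf: "infinite (carrier (G Mod M))"
    \<comment> \<open>The Hilbert space \<open>\<ell>\<^sup>2(G/M)\<close> is realised on a transversal \<open>X\<close>, since its elements have to be
      functions on \<^typ>\<open>'a\<close>.\<close>
    define r where "r x = (SOME y. y \<in> M #> x)" for x
    define X where "X = r ` carrier G"
    have r_mem: "r x \<in> M #> x" if "x \<in> carrier G" for x
      unfolding r_def using rcos_self[OF that M.subgroup_axioms] by (rule someI)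
    have r_closed: "r x \<in> carrier G" if "x \<in> carrier G" for x
      using r_mem[OF that] r_coset_subset_G[OF M.subset that] by blast
    have r_coset: "M #> r x = M #> x" if "x \<in> carrier G" for x
      using repr_independence[OF r_mem[OF that] that M.subgroup_axioms] by simp
    have r_cong: "r x = r y" if "M #> x = M #> y" for x y using that by (simp add: r_def)
    \<comment> \<open>By normality the coset of a product depends only on the cosets of the factors.
      Left multiplication therefore acts on the right cosets, and so on the transversal.\<close>
    have r_mult: "r (g \<otimes> r x) = r (g \<otimes> x)" if "g \<in> carrier G" "x \<in> carrier G" for g x
      using that M.rcos_sum[of g "r x"] M.rcos_sum[of g x] by (intro r_cong) (simp add: r_closed r_coset)
    have X: "x \<in> carrier G" "r x = x" if "x \<in> X" for x
      using that by (auto simp: X_def r_closed intro!: r_cong r_coset)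
    interpret S: set_action G X "\<lambda>g x. r (g \<otimes> x)"
    proof
      show "r (g \<otimes> x) \<in> X" if "g \<in> carrier G" "x \<in> X" for g x
        using that X(1) by (simp add: X_def)
      show "r (\<one> \<otimes> x) = x" if "x \<in> X" for x using X[OF that] by simp
      show "r (g \<otimes> h \<otimes> x) = r (g \<otimes> r (h \<otimes> x))" if "g \<in> carrier G" "h \<in> carrier G" "x \<in> X" for g h x
        using that X(1) by (simp add: r_mult m_assoc)
    qed
    have "infinite X"
    proof
      assume "finite X"
      moreover have "carrier (G Mod M) \<subseteq> (\<lambda>x. M #> x) ` X"
      proof
        fix C assume "C \<in> carrier (G Mod M)"
        then obtain x where "x \<in> carrier G" "C = M #> x" by (auto simp: FactGroup_def RCOSETS_def)
        then show "C \<in> (\<lambda>x. M #> x) ` X" using r_coset by (auto simp: X_def)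
      qed
      ultimately show False using inf by (meson finite_imageI finite_subset)
    qed
    let ?H = "ell2 X" and ?A = "group_algebra G"
    let ?W = "(bounded_operators ?H)\<lparr>carrier := S.perm_rep ` carrier ?A\<rparr>"
    have H: "complex_hilbert_space ?H" by (rule complex_hilbert_space_ell2)
    obtain m where m: "m \<in> M" "m \<noteq> \<one>" using M M.one_closed by blast
    have mG: "m \<in> carrier G" using m(1) M.subset by blast
    \<comment> \<open>Since \<open>inv m\<close> lies in \<open>M\<close>, it moves no coset, so
      \<open>m\<close> and the unit give the same operator although \<open>m\<close> is not the
      unit.\<close>
    have "S.perm_rep (delta m) = S.perm_rep (delta \<one>)"
      unfolding S.perm_rep_def
    proof (rule restrict_ext, rule ext)
      fix \<xi> x
      show "S.conv (delta m) \<xi> x = S.conv (delta \<one>) \<xi> x"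
      proof (cases "x \<in> X")
        case True
        have "inv m \<in> M" using m by simp
        then have "M #> (inv m \<otimes> x) = M #> x"
          using X(1)[OF True] mG
          by (simp add: coset_mult_assoc[symmetric] M.subset coset_join2 M.subgroup_axioms)
        then have "r (inv m \<otimes> x) = r (inv \<one> \<otimes> x)" using X(1)[OF True] by (intro r_cong) simp
        then show ?thesis using True mG by (simp add: S.conv_delta)
      qed (simp add: S.conv_outside)
    qed
    moreover have "delta m \<noteq> delta \<one>" using m(2) by (auto simp: delta_def fun_eq_iff)
    ultimately have "\<not> inj_on S.perm_rep (carrier ?A)"
      using mG by (meson delta_closed inj_onD one_closed)
    then have fd: "finite_dimensional ?W"
      using sji H S.star_representation_perm_rep unfolding star_just_infinite_def by blast
    have xX: "r \<one> \<in> X" by (simp add: X_def)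
    \<comment> \<open>\<open>s\<close> moves the base point \<open>r \<one>\<close> to
      \<open>r s = s\<close>, so every basis vector is reached from that of the base point.\<close>
    have e: "S.perm_rep (delta s) (delta (r \<one>)) = delta s" if "s \<in> X" for s
      using S.perm_rep_delta[OF X(1)[OF that] xX] X[OF that] by (simp add: r_mult)
    have "\<not> finite_dimensional ?W"
    \<comment> \<open>The dual functionals are the matrix entries of an operator in the column of
      the base point.\<close>
    proof (rule infinite_dim_if_biorthogonal[OF _ \<open>infinite X\<close>, where e = "\<lambda>s. S.perm_rep (delta s)"
          and \<phi> = "\<lambda>s T. T (delta (r \<one>)) s"])
      show "vectorspace class_ring ?W"
        by (rule vectorspace_representation_image[OF vectorspace_group_algebra
              complex_hilbert_space.pre_hilbert_space[OF H] S.star_representation_perm_rep])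
      show "S.perm_rep (delta s) \<in> carrier ?W" if "s \<in> X" for s using X(1)[OF that] by (simp add: delta_closed)
      show "S.perm_rep (delta t) (delta (r \<one>)) s = (if s = t then 1 else 0)" if "s \<in> X" "t \<in> X" for s t
        using that by (simp add: e delta_def)
    qed (simp_all add: bounded_operators_simps S.delta_ell2[OF xX] ell2_simps)
    then show False using fd by blast
  qed
qed

end

text \<open>The first implication holds for Hilbert spaces over an arbitrary type \<open>'h\<close>.
  In the second, functions on the group suffice, because \<open>ell2\<close> of a transversal
  consists of such functions.\<close>

theorem corollary6p5:
  fixes G :: "('g, 'm) monoid_scheme"
  assumes "group G"
  shows "(just_infinite_cstar (full_group_cstar G) \<longrightarrow>
            star_just_infinite TYPE('h) (group_algebra G)) \<and>
         (star_just_infinite TYPE('g \<Rightarrow> complex) (group_algebra G) \<longrightarrow>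
            just_infinite_group G)"
  using group.just_infinite_cstar_imp_star_just_infinite[OF assms]
    group.star_just_infinite_imp_just_infinite_group[OF assms] by blast

end
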